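(* Let $C=\operatorname{Spec}A_0$ be a smooth affine curve over $\mathbb{C}$ and let $A=\bigoplus_{i\in\mathbb{Z}}A_i$ be a normal graded finitely generated domain of dimension $2$ with $A_+:=\bigoplus_{i>0}A_i\ne0$ and $A_-:=\bigoplus_{i<0}A_i\neq 0$, such that the corresponding $\mathbb{C}^*$-action on $\operatorname{Spec}A$ is effective. Then the following hold. (a) $A$ is isomorphic to $A_0[D_+,D_-]$, where $D_+$, $D_-$ are $\mathbb{Q}$-divisors on $C$ satisfying $D_++D_-\le 0$. More precisely, if $u\in\operatorname{Frac}(A_0)\cdot A_1$ is a non-zero element and if the divisors $D_+$, $D_-$ on $C$ are defined by $$\pi_+^*(D_+)=\operatorname{div}(u)-\iota_+(C)\ \text{ on } V_+\quad\text{and}\quad \pi_-^*(D_-)=\operatorname{div}(u^{-1})-\iota_-(C)\ \text{ on } V_-,$$ then $D_++D_-\le0$ and $A\cong A_0[D_+,D_-]$. (b) For $\mathbb{Q}$-divisors $D_\pm$, $D'_\pm$ on $C$ with $D_++D_-\le 0$ and $D'_++D'_-\le 0$, one has $A_0[D_+,D_-]\cong A_0[D'_+,D'_-]$ as graded $A_0$-algebras if and only if, for some (non-zero) rational function $\varphi\in\operatorname{Frac}(A_0)$, $$D'_+=D_++\operatorname{div}\varphi\quad\text{and}\quad D'_-=D_--\operatorname{div}\varphi.$$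
   Context: For a $\mathbb{Q}$-divisor $D=\sum D(a)\,a$ on $C$, $\lfloor D\rfloor=\sum\lfloor D(a)\rfloor a$. Given $\mathbb{Q}$-divisors $D_+,D_-$ on $C$ with $D_++D_-\le0$, the graded $A_0$-algebra $A_0[D_+,D_-]=\bigoplus_{n\in\mathbb{Z}}A_n\subseteq\operatorname{Frac}(A_0)[u,u^{-1}]$ ($u$ an indeterminate of degree $1$) is defined by $A_n=H^0(C,\mathcal{O}_C(\lfloor nD_+\rfloor))\cdot u^n$ and $A_{-n}=H^0(C,\mathcal{O}_C(\lfloor nD_-\rfloor))\cdot u^{-n}$ for $n\ge0$. For a graded algebra $A$ as in the claim put $A_{\ge0}=\bigoplus_{i\ge0}A_i$, $A_{\le0}=\bigoplus_{i\le0}A_i$, $V_+=\operatorname{Spec}A_{\ge0}$, $V_-=\operatorname{Spec}A_{\le0}$ (these are normal affine surfaces). The morphisms $\pi_\pm:V_\pm\to C$ are induced by the inclusions $A_0\hookrightarrow A_{\ge0}$ and $A_0\hookrightarrow A_{\le0}$, and $\iota_\pm:C\hookrightarrow V_\pm$ are the closed embeddings induced by the projections $A_{\ge0}\to A_0$ and $A_{\le0}\to A_0$. Effectiveness of the action ensures that $\operatorname{Frac}(A_0)\cdot A_1\ne0$. *)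

theory Defs
  imports
    Complex_Main
    "HOL-Library.Extended_Nat"
    "HOL-Library.Function_Algebras"
    "HOL-Library.Indicator_Function"
    "HOL-Library.Poly_Mapping"
    "HOL-Algebra.Ring_Divisibility"
    "HOL-Algebra.Generated_Rings"
begin

text \<open>
  Integral domains are presented as subrings of an ambient field (every domain is one, e.g. of its
  fraction field), so that a domain, its graded pieces, its localizations and its field of fractions
  all live in one type.  The following turns a subset of a type-class ring into a HOL-Algebra ring,
  which gives access to ideals, homomorphisms and so on.
\<close>

definition ring_on :: "'a::comm_ring_1 set \<Rightarrow> 'a ring" where
  "ring_on S = \<lparr>carrier = S, mult = (*), one = 1, zero = 0, add = (+)\<rparr>"

definition frac_field :: "'k::field set \<Rightarrow> 'k set" where
  "frac_field R = {x / y | x y. x \<in> R \<and> y \<in> R \<and> y \<noteq> 0}"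

definition normal_domain :: "'k::field set \<Rightarrow> bool" where
  "normal_domain R \<longleftrightarrow> domain (ring_on R) \<and>
    (\<forall>x \<in> frac_field R.
      (\<exists>(n::nat) c. (\<forall>i<n. c i \<in> R) \<and> x ^ n + (\<Sum>i<n. c i * x ^ i) = 0) \<longrightarrow> x \<in> R)"

text \<open>The structure map \<open>\<kappa>\<close> makes \<open>R\<close> a complex algebra.\<close>

definition fin_gen_algebra :: "(complex \<Rightarrow> 'k::field) \<Rightarrow> 'k set \<Rightarrow> bool" where
  "fin_gen_algebra \<kappa> R \<longleftrightarrow> \<kappa> \<in> ring_hom (ring_on UNIV) (ring_on R) \<and>
    (\<exists>S. finite S \<and> S \<subseteq> R \<and> generate_ring (ring_on R) (range \<kappa> \<union> S) = R)"


section \<open>Dimension, local rings, smooth affine curves\<close>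

definition prime_chain :: "('a, 'b) ring_scheme \<Rightarrow> nat \<Rightarrow> (nat \<Rightarrow> 'a set) \<Rightarrow> bool" where
  "prime_chain R n p \<longleftrightarrow> (\<forall>i\<le>n. primeideal (p i) R) \<and> (\<forall>i<n. p i \<subset> p (Suc i))"

definition krull_dim :: "('a, 'b) ring_scheme \<Rightarrow> enat" where
  "krull_dim R = Sup {enat n | n. \<exists>p. prime_chain R n p}"

definition height :: "('a, 'b) ring_scheme \<Rightarrow> 'a set \<Rightarrow> enat" where
  "height R P = Sup {enat n | n. \<exists>p. prime_chain R n p \<and> p n = P}"

definition regular_local_ring :: "('a, 'b) ring_scheme \<Rightarrow> bool" where
  "regular_local_ring L \<longleftrightarrow> cring L \<and> noetherian_ring L \<and>
    (\<exists>M. {I. maximalideal I L} = {M} \<and>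
      (\<exists>S. finite S \<and> S \<subseteq> M \<and> Idl\<^bsub>L\<^esub> S = M \<and> enat (card S) = krull_dim L))"

definition local_ring :: "'k::field set \<Rightarrow> 'k set \<Rightarrow> 'k set" where
  "local_ring R P = {x / s | x s. x \<in> R \<and> s \<in> R \<and> s \<notin> P}"

definition local_max :: "'k::field set \<Rightarrow> 'k set \<Rightarrow> 'k set" where
  "local_max R P = {x / s | x s. x \<in> P \<and> s \<in> R \<and> s \<notin> P}"

text \<open>Over the complex numbers, smooth means that the local rings at all closed points are regular.\<close>

definition smooth_affine_curve :: "(complex \<Rightarrow> 'k::field) \<Rightarrow> 'k set \<Rightarrow> bool" where
  "smooth_affine_curve \<kappa> R \<longleftrightarrow>
    domain (ring_on R) \<and> fin_gen_algebra \<kappa> R \<and> krull_dim (ring_on R) = 1 \<and>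
    (\<forall>P. maximalideal P (ring_on R) \<longrightarrow> regular_local_ring (ring_on (local_ring R P)))"


section \<open>Divisors\<close>

text \<open>
  A prime divisor on \<open>Spec R\<close> is represented by the corresponding prime ideal of height one; on an
  affine curve these are exactly the closed points.  Divisors, with integral or rational
  coefficients, are rational-valued functions on ideals that vanish off the prime divisors.
\<close>

definition prime_divisors :: "'k::field set \<Rightarrow> 'k set set" where
  "prime_divisors R = {P. primeideal P (ring_on R) \<and> height (ring_on R) P = 1}"

definition q_divisor :: "'k::field set \<Rightarrow> ('k set \<Rightarrow> rat) \<Rightarrow> bool" where
  "q_divisor R D \<longleftrightarrow> finite {P. D P \<noteq> 0} \<and> {P. D P \<noteq> 0} \<subseteq> prime_divisors R"

definition uniformizer :: "'k::field set \<Rightarrow> 'k set \<Rightarrow> 'k \<Rightarrow> bool" where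
  "uniformizer R P t \<longleftrightarrow> t \<in> local_ring R P \<and> PIdl\<^bsub>ring_on (local_ring R P)\<^esub> t = local_max R P"

text \<open>
  For normal noetherian \<open>R\<close> and a prime divisor \<open>P\<close> the local ring at \<open>P\<close> is a discrete valuation
  ring, and every non-zero rational function \<open>f\<close> has a unique order.
\<close>

definition order_at :: "'k::field set \<Rightarrow> 'k set \<Rightarrow> 'k \<Rightarrow> int" where
  "order_at R P f = (THE n. \<exists>t v. uniformizer R P t \<and>
      v \<in> Units (ring_on (local_ring R P)) \<and> f = v * t powi n)"

definition div_of :: "'k::field set \<Rightarrow> 'k \<Rightarrow> 'k set \<Rightarrow> rat" where
  "div_of R f = (\<lambda>P. if P \<in> prime_divisors R then of_int (order_at R P f) else 0)"

definition floor_div :: "('k set \<Rightarrow> rat) \<Rightarrow> 'k set \<Rightarrow> rat" where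
  "floor_div D = (\<lambda>P. of_int \<lfloor>D P\<rfloor>)"

text \<open>Global sections of \<open>\<O>(D)\<close>, for an integral divisor \<open>D\<close>.\<close>

definition sections :: "'k::field set \<Rightarrow> ('k set \<Rightarrow> rat) \<Rightarrow> 'k set" where
  "sections R D = {f \<in> frac_field R. f = 0 \<or> 0 \<le> div_of R f + D}"

text \<open>
  Pullback along the morphism \<open>Spec S \<rightarrow> Spec R\<close> induced by an inclusion \<open>R \<subseteq> S\<close>.  The pullback of a
  prime divisor \<open>P\<close> of the smooth curve \<open>Spec R\<close> is the divisor of a local equation, i.e. of a
  uniformizer at \<open>P\<close>.  Such an equation is a unit away from \<open>P\<close>, so the coefficient at \<open>Q\<close> only
  involves the image \<open>Q \<inter> R\<close> of the generic point of \<open>Q\<close>, and vanishes if \<open>Q\<close> dominates the curve.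
\<close>

definition pullback_div :: "'k::field set \<Rightarrow> 'k set \<Rightarrow> ('k set \<Rightarrow> rat) \<Rightarrow> 'k set \<Rightarrow> rat" where
  "pullback_div R S D = (\<lambda>Q.
    if Q \<in> prime_divisors S \<and> Q \<inter> R \<in> prime_divisors R
    then D (Q \<inter> R) * of_int (order_at S Q (SOME t. uniformizer R (Q \<inter> R) t))
    else 0)"


section \<open>Graded rings and torus actions\<close>

definition decomposition :: "(int \<Rightarrow> 'a::comm_ring_1 set) \<Rightarrow> 'a \<Rightarrow> (int \<Rightarrow> 'a) \<Rightarrow> bool" where
  "decomposition G a c \<longleftrightarrow>
    (\<forall>i. c i \<in> G i) \<and> finite {i. c i \<noteq> 0} \<and> a = (\<Sum>i | c i \<noteq> 0. c i)"

definition graded_ring :: "'a::comm_ring_1 set \<Rightarrow> (int \<Rightarrow> 'a set) \<Rightarrow> bool" where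
  "graded_ring A G \<longleftrightarrow> cring (ring_on A) \<and>
    (\<forall>i. additive_subgroup (G i) (ring_on A)) \<and>
    (\<forall>i j. \<forall>a\<in>G i. \<forall>b\<in>G j. a * b \<in> G (i + j)) \<and>
    (\<forall>a\<in>A. \<exists>!c. decomposition G a c)"

definition component :: "(int \<Rightarrow> 'a::comm_ring_1 set) \<Rightarrow> int \<Rightarrow> 'a \<Rightarrow> 'a" where
  "component G i a = (THE c. decomposition G a c) i"

definition graded_sum :: "(int \<Rightarrow> 'a::comm_ring_1 set) \<Rightarrow> int set \<Rightarrow> 'a set" where
  "graded_sum G I = {\<Sum>i\<in>F. c i | F c. finite F \<and> F \<subseteq> I \<and> (\<forall>i\<in>F. c i \<in> G i)}"

text \<open>
  The action on the ring \<open>A\<close> corresponding to the grading: \<open>t\<close> acts on elements of degree \<open>i\<close> as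
  multiplication by \<open>t\<close> to the power \<open>i\<close>.  It is effective iff only \<open>t = 1\<close> acts trivially.
\<close>

definition torus_act ::
  "(complex \<Rightarrow> 'k::field) \<Rightarrow> (int \<Rightarrow> 'k set) \<Rightarrow> complex \<Rightarrow> 'k \<Rightarrow> 'k" where
  "torus_act \<kappa> G t a = (\<Sum>i | component G i a \<noteq> 0. \<kappa> (t powi i) * component G i a)"

definition effective_action ::
  "(complex \<Rightarrow> 'k::field) \<Rightarrow> 'k set \<Rightarrow> (int \<Rightarrow> 'k set) \<Rightarrow> bool" where
  "effective_action \<kappa> A G \<longleftrightarrow>
    (\<forall>t. t \<noteq> 0 \<and> (\<forall>a\<in>A. torus_act \<kappa> G t a = a) \<longrightarrow> t = 1)"

text \<open>
  Isomorphism of graded \<open>R\<close>-algebras, where \<open>e\<close> and \<open>e'\<close> are the structure maps from \<open>R\<close>.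
\<close>

definition graded_algebra_iso ::
  "'r set \<Rightarrow> ('r \<Rightarrow> 'a::comm_ring_1) \<Rightarrow> 'a set \<Rightarrow> (int \<Rightarrow> 'a set) \<Rightarrow>
    ('r \<Rightarrow> 'b::comm_ring_1) \<Rightarrow> 'b set \<Rightarrow> (int \<Rightarrow> 'b set) \<Rightarrow> bool" where
  "graded_algebra_iso R e A G e' B H \<longleftrightarrow>
    (\<exists>h \<in> ring_iso (ring_on A) (ring_on B).
      (\<forall>i. h ` G i = H i) \<and> (\<forall>r\<in>R. h (e r) = e' r))"

text \<open>
  The vertex section of \<open>Spec V \<rightarrow> Spec (G 0)\<close> (with \<open>V\<close> the non-negative or the non-positive part),
  as a prime divisor: the closed embedding induced by the projection of \<open>V\<close> onto degree zero has as
  image the zero locus of the kernel of this projection.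
\<close>

definition section_divisor :: "(int \<Rightarrow> 'k::field set) \<Rightarrow> 'k set \<Rightarrow> 'k set \<Rightarrow> rat" where
  "section_divisor G V = indicator {a_kernel (ring_on V) (ring_on (G 0)) (component G 0)}"


section \<open>The algebra defined by a pair of divisors\<close>

text \<open>
  \<open>int \<Rightarrow>\<^sub>0 'k\<close> is the ring of Laurent polynomials in \<open>u\<close>; the monomial \<open>f u\<^sup>n\<close> is
  \<open>Poly_Mapping.single n f\<close>, and \<open>R\<close> is embedded by \<open>Poly_Mapping.single 0\<close>.
\<close>

definition dpd_piece ::
  "'k::field set \<Rightarrow> ('k set \<Rightarrow> rat) \<Rightarrow> ('k set \<Rightarrow> rat) \<Rightarrow> int \<Rightarrow> (int \<Rightarrow>\<^sub>0 'k) set" where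
  "dpd_piece R Dp Dm i = Poly_Mapping.single i `
    (if 0 \<le> i then sections R (floor_div (\<lambda>P. of_int i * Dp P))
     else sections R (floor_div (\<lambda>P. of_int (- i) * Dm P)))"

definition dpd_ring ::
  "'k::field set \<Rightarrow> ('k set \<Rightarrow> rat) \<Rightarrow> ('k set \<Rightarrow> rat) \<Rightarrow> (int \<Rightarrow>\<^sub>0 'k) set" where
  "dpd_ring R Dp Dm = graded_sum (dpd_piece R Dp Dm) UNIV"

definition iso_to_dpd ::
  "'k::field set \<Rightarrow> (int \<Rightarrow> 'k set) \<Rightarrow> ('k set \<Rightarrow> rat) \<Rightarrow> ('k set \<Rightarrow> rat) \<Rightarrow> bool" where
  "iso_to_dpd A G Dp Dm \<longleftrightarrow>
    graded_algebra_iso (G 0) (\<lambda>r. r) A G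
      (Poly_Mapping.single 0) (dpd_ring (G 0) Dp Dm) (dpd_piece (G 0) Dp Dm)"

definition dpd_iso_dpd ::
  "'k::field set \<Rightarrow> ('k set \<Rightarrow> rat) \<Rightarrow> ('k set \<Rightarrow> rat) \<Rightarrow>
    ('k set \<Rightarrow> rat) \<Rightarrow> ('k set \<Rightarrow> rat) \<Rightarrow> bool" where
  "dpd_iso_dpd R Dp Dm Dp' Dm' \<longleftrightarrow>
    graded_algebra_iso R
      (Poly_Mapping.single 0) (dpd_ring R Dp Dm) (dpd_piece R Dp Dm)
      (Poly_Mapping.single 0) (dpd_ring R Dp' Dm') (dpd_piece R Dp' Dm')"

end

theory Submission
  imports Defs "HOL-Computational_Algebra.Polynomial"
begin

text \<open>
  Put \<open>R = G 0\<close> and \<open>K = Frac R\<close>.  As \<open>A\<close> has elements of degrees \<open>1\<close> and \<open>-1\<close> (effectiveness), every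
  homogeneous element of degree \<open>i\<close> lies in \<open>K u\<^sup>i\<close>, so \<open>A\<close> is a sum of pieces \<open>L\<^sub>i u\<^sup>i\<close> with
  \<open>L\<^sub>i \<subseteq> K\<close>.  The coefficient of \<open>D\<^sub>+\<close> at \<open>P\<close> is the maximum of \<open>- ord\<^sub>P f / i\<close> over the homogeneous
  components \<open>f u\<^sup>i\<close>, \<open>i > 0\<close>, of finitely many generators of \<open>A\<close>, and \<open>D\<^sub>-\<close> is obtained by reversing
  the grading.  A section \<open>f\<close> of \<open>\<lfloor>i D\<^sub>+\<rfloor>\<close> has a power of \<open>f u\<^sup>i\<close> that lies in \<open>A\<close> locally over the curve,
  hence globally, and normality puts \<open>f u\<^sup>i\<close> into \<open>A\<close>.

  For the pullback formula let \<open>D\<^sub>+(P) = e/d\<close> in lowest terms and let \<open>t\<close> be a uniformizer at \<open>P\<close>.  The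
  only prime divisor of \<open>V\<^sub>+\<close> over \<open>P\<close> is the locus where the weight \<open>d ord\<^sub>P f + i e\<close> of \<open>f u\<^sup>i\<close> is positive;
  \<open>t\<^sup>a u\<^sup>b\<close> with \<open>a d + b e = 1\<close> is a uniformizer there, and \<open>t\<close> and \<open>u\<close> have orders \<open>d\<close> and \<open>e\<close>.

  An isomorphism in (b) is multiplication by the \<open>i\<close>-th power of a rational function in degree \<open>i\<close>, and
  the sections of all \<open>\<lfloor>i D\<rfloor>\<close> determine \<open>D\<close>.
\<close>

section \<open>Local rings and orders\<close>

text \<open>The algebra A, its localizations and its fraction field all lie in one field, and u is
  an element of that field rather than an indeterminate. That the powers of u are linearly
  independent over Frac R is extracted from the uniqueness of homogeneous decompositions. An order
  is a definite description, so it can be computed only where a uniformizer has been exhibited. On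
  the curve uniformizers come from regularity. On \<open>V\<^sub>+\<close> they are written down by
  hand: over a point from weights, at the primes that dominate the curve from division in K[u]. This
  replaces any structure theory of the surface. The divisor \<open>D\<^sub>+\<close> is built from
  generators first, and the pullback equation is then shown to have it as its only solution;
  existence, uniqueness and independence of the generators thus come together. The maximum defining
  \<open>D\<^sub>+\<close> may be attained by different generators at different points; a common
  multiple of their degrees supplies one exponent that works over the whole curve.\<close>

locale subdom =
  fixes S :: "'k::field set"
  assumes zero_mem [simp, intro]: "0 \<in> S" and one_mem [simp, intro]: "1 \<in> S"
    and add_mem [simp, intro]: "x \<in> S \<Longrightarrow> y \<in> S \<Longrightarrow> x + y \<in> S"
    and mult_mem [simp, intro]: "x \<in> S \<Longrightarrow> y \<in> S \<Longrightarrow> x * y \<in> S"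
    and uminus_mem [simp, intro]: "x \<in> S \<Longrightarrow> - x \<in> S"

lemma ring_on_simps [simp]:
  "carrier (ring_on S) = S" "x \<otimes>\<^bsub>ring_on S\<^esub> y = x * y" "\<one>\<^bsub>ring_on S\<^esub> = 1"
  "\<zero>\<^bsub>ring_on S\<^esub> = 0" "x \<oplus>\<^bsub>ring_on S\<^esub> y = x + y"
  by (simp_all add: ring_on_def)

lemma (in subdom) cring_ring_on: "cring (ring_on S)"
proof (rule cringI)
  show "abelian_group (ring_on S)"
    by (rule abelian_groupI) (auto simp: algebra_simps intro: bexI[where x = "- x" for x])
  show "comm_monoid (ring_on S)"
    by (rule comm_monoidI) (auto simp: algebra_simps)
qed (auto simp: algebra_simps)

lemma (in subdom) a_inv_ring_on: "x \<in> S \<Longrightarrow> \<ominus>\<^bsub>ring_on S\<^esub> x = - x"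
proof -
  assume x: "x \<in> S"
  interpret cring "ring_on S" by (rule cring_ring_on)
  show ?thesis
    by (rule minus_equality) (use x in auto)
qed

text \<open>Only negation needs an argument: the additive inverse in the record is known by its
  defining equation alone and has to be identified with negation in the field.\<close>

lemma subdom_of_cring:
  fixes S :: "'k::field set"
  assumes "cring (ring_on S)"
  shows "subdom S"
proof -
  interpret cring "ring_on S" by fact
  show ?thesis
  proof
    show "0 \<in> S" "1 \<in> S"
      using zero_closed one_closed by simp_all
    show "x + y \<in> S" "x * y \<in> S" if "x \<in> S" "y \<in> S" for x y
      using that a_closed[of x y] m_closed[of x y] by simp_all
    show "- x \<in> S" if "x \<in> S" for x
    proof -
      have "\<ominus>\<^bsub>ring_on S\<^esub> x \<in> S" and "x + \<ominus>\<^bsub>ring_on S\<^esub> x = 0"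
        using a_inv_closed[of x] r_neg[of x] that by simp_all
      then have "\<ominus>\<^bsub>ring_on S\<^esub> x = - x"
        by (simp add: eq_neg_iff_add_eq_0 add.commute)
      with \<open>\<ominus>\<^bsub>ring_on S\<^esub> x \<in> S\<close> show ?thesis by simp
    qed
  qed
qed

lemma subdom_of_domain: "domain (ring_on S) \<Longrightarrow> subdom (S :: 'k::field set)"
  by (simp add: domain_def subdom_of_cring)

context subdom
begin

lemma diff_mem [simp, intro]: "x \<in> S \<Longrightarrow> y \<in> S \<Longrightarrow> x - y \<in> S"
  using add_mem[of x "- y"] by simp

lemma power_mem [simp, intro]: "x \<in> S \<Longrightarrow> x ^ n \<in> S"
  by (induction n) auto

lemma sum_mem: "(\<And>i. i \<in> F \<Longrightarrow> f i \<in> S) \<Longrightarrow> sum f F \<in> S"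
  by (induction F rule: infinite_finite_induct) auto

end

section \<open>Ideals and primes of a subring of a field, elementwise\<close>

definition is_ideal :: "'k::field set \<Rightarrow> 'k set \<Rightarrow> bool" where
  "is_ideal S I \<longleftrightarrow> I \<subseteq> S \<and> 0 \<in> I \<and> (\<forall>a\<in>I. \<forall>b\<in>I. a + b \<in> I) \<and> (\<forall>x\<in>S. \<forall>a\<in>I. x * a \<in> I)"

definition is_prime :: "'k::field set \<Rightarrow> 'k set \<Rightarrow> bool" where
  "is_prime S P \<longleftrightarrow> is_ideal S P \<and> 1 \<notin> P \<and> (\<forall>a\<in>S. \<forall>b\<in>S. a * b \<in> P \<longrightarrow> a \<in> P \<or> b \<in> P)"

lemma (in subdom) ideal_iff: "ideal I (ring_on S) \<longleftrightarrow> is_ideal S I"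
proof
  assume "ideal I (ring_on S)"
  then interpret ideal I "ring_on S" .
  show "is_ideal S I"
    unfolding is_ideal_def
    using a_subset I_l_closed additive_subgroup.a_closed[OF additive_subgroup_axioms]
      additive_subgroup.zero_closed[OF additive_subgroup_axioms] by auto
next
  interpret cring "ring_on S" by (rule cring_ring_on)
  assume I: "is_ideal S I"
  show "ideal I (ring_on S)"
  proof (rule idealI)
    show "ring (ring_on S)" by (rule ring_axioms)
    show "subgroup I (add_monoid (ring_on S))"
    proof (rule group.subgroupI)
      show "Group.group (add_monoid (ring_on S))"
        using a_group .
      show "I \<subseteq> carrier (add_monoid (ring_on S))" "I \<noteq> {}"
        using I by (auto simp: is_ideal_def)
      fix a b assume a: "a \<in> I" and b: "b \<in> I"
      show "a \<otimes>\<^bsub>add_monoid (ring_on S)\<^esub> b \<in> I"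
        using a b I by (auto simp: is_ideal_def)
      have "\<ominus>\<^bsub>ring_on S\<^esub> a = (- 1) * a"
        using I a by (subst a_inv_ring_on) (auto simp: is_ideal_def)
      also have "\<dots> \<in> I"
        using I a unfolding is_ideal_def by blast
      finally show "inv\<^bsub>add_monoid (ring_on S)\<^esub> a \<in> I"
        by (simp add: a_inv_def)
    qed
    fix a x assume "a \<in> I" and "x \<in> carrier (ring_on S)"
    then show "x \<otimes>\<^bsub>ring_on S\<^esub> a \<in> I" "a \<otimes>\<^bsub>ring_on S\<^esub> x \<in> I"
      using I by (auto simp: is_ideal_def mult.commute)
  qed
qed

context subdom
begin

lemma ideal_eq_top: "is_ideal S I \<Longrightarrow> 1 \<in> I \<Longrightarrow> I = S"
  unfolding is_ideal_def by (metis mult.right_neutral subset_antisym subsetI)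

lemma prime_iff: "primeideal P (ring_on S) \<longleftrightarrow> is_prime S P"
proof
  assume "primeideal P (ring_on S)"
  then interpret primeideal P "ring_on S" .
  have "is_ideal S P"
    using ideal_axioms ideal_iff by simp
  then show "is_prime S P"
    using I_notcarr I_prime ideal_eq_top unfolding is_prime_def by auto
next
  assume "is_prime S P"
  then show "primeideal P (ring_on S)"
    using cring_ring_on ideal_iff by (intro primeidealI) (auto simp: is_prime_def)
qed

lemma is_idealD:
  assumes "is_ideal S I"
  shows "a \<in> I \<Longrightarrow> a \<in> S" "0 \<in> I" "a \<in> I \<Longrightarrow> b \<in> I \<Longrightarrow> a + b \<in> I"
    "x \<in> S \<Longrightarrow> a \<in> I \<Longrightarrow> x * a \<in> I" "x \<in> S \<Longrightarrow> a \<in> I \<Longrightarrow> a * x \<in> I"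
    "a \<in> I \<Longrightarrow> - a \<in> I" "a \<in> I \<Longrightarrow> b \<in> I \<Longrightarrow> a - b \<in> I"
proof -
  show *: "x \<in> S \<Longrightarrow> a \<in> I \<Longrightarrow> x * a \<in> I" and add: "a \<in> I \<Longrightarrow> b \<in> I \<Longrightarrow> a + b \<in> I" for x a b
    using assms by (auto simp: is_ideal_def)
  show neg: "a \<in> I \<Longrightarrow> - a \<in> I" for a
    using *[of "- 1" a] by simp
  show "a \<in> I \<Longrightarrow> b \<in> I \<Longrightarrow> a - b \<in> I"
    using add[of a "- b"] neg[of b] by simp
qed (use assms in \<open>auto simp: is_ideal_def mult.commute\<close>)

lemma is_primeD:
  assumes "is_prime S P"
  shows "is_ideal S P" "1 \<notin> P" "a \<in> S \<Longrightarrow> b \<in> S \<Longrightarrow> a * b \<in> P \<Longrightarrow> a \<in> P \<or> b \<in> P"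
    "a \<in> P \<Longrightarrow> a \<in> S" "0 \<in> P" "a \<in> P \<Longrightarrow> b \<in> P \<Longrightarrow> a + b \<in> P"
    "x \<in> S \<Longrightarrow> a \<in> P \<Longrightarrow> x * a \<in> P" "x \<in> S \<Longrightarrow> a \<in> P \<Longrightarrow> a * x \<in> P"
  using assms is_idealD[of P] by (auto simp: is_prime_def)

lemma prime_power:
  assumes "is_prime S P" "a \<in> S" "a ^ n \<in> P"
  shows "a \<in> P"
  using assms(3)
proof (induction n)
  case 0
  then show ?case using is_primeD[OF assms(1)] by simp
next
  case (Suc n)
  then show ?case using is_primeD(3)[OF assms(1), of a "a ^ n"] assms(2) by auto
qed

lemma prime_zero: "is_prime S {0}"
  by (auto simp: is_prime_def is_ideal_def)

lemma prime_zero_subset: "is_prime S P \<Longrightarrow> {0} \<subseteq> P"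
  using is_primeD(5) by blast

end

lemma prime_chain_mono: "prime_chain R n p \<Longrightarrow> i < j \<Longrightarrow> j \<le> n \<Longrightarrow> p i \<subset> p j"
proof (induction j)
  case (Suc j)
  then have "p j \<subset> p (Suc j)" by (auto simp: prime_chain_def)
  with Suc show ?case by (cases "i = j") auto
qed simp

text \<open>A finite supremum of natural numbers is attained. Height and Krull dimension are suprema
  of chain lengths, and this turns the value 1 into the existence of one chain and the absence of
  longer ones.\<close>

lemma enat_Sup_eq_1_iff:
  assumes "0 \<in> N"
  shows "Sup {enat n | n. n \<in> N} = 1 \<longleftrightarrow> 1 \<in> N \<and> (\<forall>n\<in>N. n \<le> 1)"
proof
  assume *: "Sup {enat n | n. n \<in> N} = 1"
  have le: "n \<le> 1" if "n \<in> N" for n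
    using Sup_upper[of "enat n" "{enat n | n. n \<in> N}"] that * by (auto simp: one_enat_def)
  moreover have "1 \<in> N"
  proof (rule ccontr)
    assume "1 \<notin> N"
    have "n = 0" if "n \<in> N" for n
      using le[OF that] that \<open>1 \<notin> N\<close> by (cases "n = 1") auto
    then have "{enat n | n. n \<in> N} = {0}"
      using assms by (force simp: zero_enat_def)
    with * show False by simp
  qed
  ultimately show "1 \<in> N \<and> (\<forall>n\<in>N. n \<le> 1)" by blast
next
  assume "1 \<in> N \<and> (\<forall>n\<in>N. n \<le> 1)"
  then show "Sup {enat n | n. n \<in> N} = 1"
    by (intro antisym Sup_least Sup_upper) (auto simp: one_enat_def)
qed

context subdom
begin

text \<open>In a domain {0} lies below every prime. So a prime strictly between {0} and Q gives a
  chain of length 2, and the second term of any chain of length at least 2 ending in Q is such a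
  prime.\<close>

lemma height_one_iff:
  assumes "is_prime S Q"
  shows "height (ring_on S) Q = 1 \<longleftrightarrow>
    Q \<noteq> {0} \<and> (\<forall>P. is_prime S P \<and> P \<subseteq> Q \<longrightarrow> P = {0} \<or> P = Q)"
proof -
  define N where "N = {n. \<exists>p. prime_chain (ring_on S) n p \<and> p n = Q}"
  have N0: "0 \<in> N"
    using assms by (auto simp: N_def prime_chain_def prime_iff intro!: exI[of _ "\<lambda>_. Q"])
  have h: "height (ring_on S) Q = Sup {enat n | n. n \<in> N}"
    by (simp add: height_def N_def)
  have one: "1 \<in> N \<longleftrightarrow> Q \<noteq> {0}"
  proof
    assume "1 \<in> N"
    then obtain p where "prime_chain (ring_on S) 1 p" "p 1 = Q"
      by (auto simp: N_def)
    then have "p 0 \<subset> Q" "is_prime S (p 0)"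
      by (auto simp: prime_chain_def prime_iff)
    then show "Q \<noteq> {0}" using prime_zero_subset by auto
  next
    assume "Q \<noteq> {0}"
    then have "{0} \<subset> Q" using prime_zero_subset[OF assms] by auto
    then have "prime_chain (ring_on S) 1 (\<lambda>i. if i = 0 then {0} else Q)"
      using prime_zero assms by (auto simp: prime_chain_def prime_iff)
    then show "1 \<in> N" by (auto simp: N_def intro!: exI[of _ "\<lambda>i. if i = 0 then {0} else Q"])
  qed
  have two: "(\<forall>n\<in>N. n \<le> 1) \<longleftrightarrow> (\<forall>P. is_prime S P \<and> P \<subseteq> Q \<longrightarrow> P = {0} \<or> P = Q)"
  proof
    assume le: "\<forall>n\<in>N. n \<le> 1"
    show "\<forall>P. is_prime S P \<and> P \<subseteq> Q \<longrightarrow> P = {0} \<or> P = Q"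
    proof (intro allI impI, elim conjE, rule ccontr)
      fix P assume P: "is_prime S P" "P \<subseteq> Q" "\<not> (P = {0} \<or> P = Q)"
      then have sub: "{0} \<subset> P" "P \<subset> Q" using prime_zero_subset by auto
      let ?p = "\<lambda>i::nat. if i = 0 then {0} else if i = 1 then P else Q"
      have "prime_chain (ring_on S) 2 ?p"
        using P sub prime_zero assms
        by (auto simp: prime_chain_def prime_iff less_2_cases_iff)
      then have "2 \<in> N" by (auto simp: N_def intro!: exI[of _ ?p])
      with le show False by fastforce
    qed
  next
    assume *: "\<forall>P. is_prime S P \<and> P \<subseteq> Q \<longrightarrow> P = {0} \<or> P = Q"
    show "\<forall>n\<in>N. n \<le> 1"
    proof (intro ballI, rule ccontr)
      fix n assume "n \<in> N" "\<not> n \<le> 1"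
      then obtain p where p: "prime_chain (ring_on S) n p" "p n = Q" "2 \<le> n"
        by (auto simp: N_def)
      have "p 0 \<subset> p 1" "p 1 \<subset> Q" "is_prime S (p 1)" "is_prime S (p 0)"
        using prime_chain_mono[OF p(1), of 0 1] prime_chain_mono[OF p(1), of 1 n] p
        by (auto simp: prime_chain_def prime_iff)
      then show False using * prime_zero_subset[of "p 0"] by blast
    qed
  qed
  show ?thesis
    using enat_Sup_eq_1_iff[OF N0] h one two by auto
qed

lemma prime_divisors_iff:
  "Q \<in> prime_divisors S \<longleftrightarrow>
    is_prime S Q \<and> Q \<noteq> {0} \<and> (\<forall>P. is_prime S P \<and> P \<subseteq> Q \<longrightarrow> P = {0} \<or> P = Q)"
  using height_one_iff[of Q] by (auto simp: prime_divisors_def prime_iff)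

lemma frac_fieldI: "x \<in> S \<Longrightarrow> y \<in> S \<Longrightarrow> y \<noteq> 0 \<Longrightarrow> x / y \<in> frac_field S"
  by (auto simp: frac_field_def)

lemma subset_frac_field: "x \<in> S \<Longrightarrow> x \<in> frac_field S"
  using frac_fieldI[of x 1] by simp

lemma frac_fieldE:
  assumes "f \<in> frac_field S"
  obtains x y where "x \<in> S" "y \<in> S" "y \<noteq> 0" "f = x / y"
  using assms by (auto simp: frac_field_def)

lemma frac_field_subdom: "subdom (frac_field S)"
proof
  show "0 \<in> frac_field S" "1 \<in> frac_field S"
    by (auto intro: subset_frac_field)
  fix f g assume "f \<in> frac_field S" "g \<in> frac_field S"
  then obtain a b c d where *: "a \<in> S" "b \<in> S" "b \<noteq> 0" "f = a / b" "c \<in> S" "d \<in> S" "d \<noteq> 0" "g = c / d"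
    by (metis frac_fieldE)
  then have "f + g = (a * d + b * c) / (b * d)" "f * g = (a * c) / (b * d)" "- f = (- a) / b"
    by (auto simp: field_simps)
  with * show "f + g \<in> frac_field S" "f * g \<in> frac_field S" "- f \<in> frac_field S"
    by (metis add_mem mult_mem uminus_mem frac_fieldI no_zero_divisors)+
qed

lemma frac_field_inverse: "f \<in> frac_field S \<Longrightarrow> inverse f \<in> frac_field S"
  by (metis frac_fieldE frac_fieldI div_0 inverse_divide inverse_zero zero_mem subset_frac_field)

lemma frac_field_divide: "f \<in> frac_field S \<Longrightarrow> g \<in> frac_field S \<Longrightarrow> f / g \<in> frac_field S"
  unfolding divide_inverse by (intro subdom.mult_mem[OF frac_field_subdom] frac_field_inverse)

lemma frac_field_powi: "f \<in> frac_field S \<Longrightarrow> f powi n \<in> frac_field S"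
  unfolding power_int_def
  by (auto intro: subdom.power_mem[OF frac_field_subdom] frac_field_inverse)

end

text \<open>For a prime Q these are the units of the localization, as
  \<open>Units_local_ring\<close> confirms. In this form they are recognized without producing an
  inverse.\<close>

definition local_unit :: "'k::field set \<Rightarrow> 'k set \<Rightarrow> 'k \<Rightarrow> bool" where
  "local_unit S Q v \<longleftrightarrow> (\<exists>a b. a \<in> S - Q \<and> b \<in> S - Q \<and> v = a / b)"

lemma (in subdom) Units_ring_on: "Units (ring_on S) = {x \<in> S. x \<noteq> 0 \<and> inverse x \<in> S}"
proof -
  have "inverse x \<in> S" if "y \<in> S" "x * y = 1" for x y
    using that by (metis inverse_unique)
  moreover have "\<exists>y\<in>S. x * y = 1" if "x \<noteq> 0" "inverse x \<in> S" for x
    using that by (intro bexI[of _ "inverse x"]) auto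
  ultimately show ?thesis
    by (auto simp: Units_def mult.commute)
qed

locale subdom_prime = subdom +
  fixes Q
  assumes prime: "is_prime S Q"
begin

lemmas primeD = is_primeD[OF prime]

lemma one_notin [simp]: "1 \<notin> Q" and zero_in [simp, intro]: "0 \<in> Q"
  using primeD by auto

lemma mult_notin: "a \<in> S - Q \<Longrightarrow> b \<in> S - Q \<Longrightarrow> a * b \<in> S - Q"
  using primeD(3) by blast

lemma power_notin: "a \<in> S - Q \<Longrightarrow> a ^ n \<in> S - Q"
  using prime_power[OF prime] by blast

lemma local_ringI: "a \<in> S \<Longrightarrow> b \<in> S - Q \<Longrightarrow> a / b \<in> local_ring S Q"
  by (auto simp: local_ring_def)

lemma local_ringE:
  assumes "x \<in> local_ring S Q"
  obtains a b where "a \<in> S" "b \<in> S - Q" "x = a / b" "b \<noteq> 0"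
  using assms zero_in unfolding local_ring_def by blast

lemma local_ring_subdom: "subdom (local_ring S Q)"
proof
  show "0 \<in> local_ring S Q" "1 \<in> local_ring S Q"
    using local_ringI[of 0 1] local_ringI[of 1 1] by auto
  fix f g assume "f \<in> local_ring S Q" "g \<in> local_ring S Q"
  then obtain a b c d where *: "a \<in> S" "b \<in> S - Q" "b \<noteq> 0" "f = a / b"
     "c \<in> S" "d \<in> S - Q" "d \<noteq> 0" "g = c / d"
    by (metis local_ringE)
  then have "f + g = (a * d + b * c) / (b * d)" "f * g = (a * c) / (b * d)" "- f = (- a) / b"
    by (auto simp: field_simps)
  with * show "f + g \<in> local_ring S Q" "f * g \<in> local_ring S Q" "- f \<in> local_ring S Q"
    by (metis local_ringI mult_notin DiffD1 add_mem mult_mem uminus_mem)+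
qed

lemma subset_local_ring: "x \<in> S \<Longrightarrow> x \<in> local_ring S Q"
  using local_ringI[of x 1] by simp

lemma local_ring_subset: "local_ring S Q \<subseteq> frac_field S"
  by (auto elim!: local_ringE intro: frac_fieldI)

lemma local_unitI: "a \<in> S - Q \<Longrightarrow> b \<in> S - Q \<Longrightarrow> local_unit S Q (a / b)"
  by (auto simp: local_unit_def)

lemma local_unitI1: "a \<in> S - Q \<Longrightarrow> local_unit S Q a"
  using local_unitI[of a 1] by simp

lemma local_unit_1 [simp]: "local_unit S Q 1"
  using local_unitI1[of 1] by simp

lemma local_unit_nonzero: "local_unit S Q v \<Longrightarrow> v \<noteq> 0"
  unfolding local_unit_def by (metis DiffD2 divide_eq_0_iff zero_in)

lemma local_unit_mult: "local_unit S Q v \<Longrightarrow> local_unit S Q w \<Longrightarrow> local_unit S Q (v * w)"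
  unfolding local_unit_def by (metis mult_notin times_divide_times_eq)

lemma local_unit_inverse: "local_unit S Q v \<Longrightarrow> local_unit S Q (inverse v)"
  unfolding local_unit_def by (metis inverse_divide)

lemma local_unit_divide: "local_unit S Q v \<Longrightarrow> local_unit S Q w \<Longrightarrow> local_unit S Q (v / w)"
  by (simp add: divide_inverse local_unit_mult local_unit_inverse)

lemma local_unit_power: "local_unit S Q v \<Longrightarrow> local_unit S Q (v ^ n)"
  by (induction n) (auto intro: local_unit_mult)

lemma local_unit_powi: "local_unit S Q v \<Longrightarrow> local_unit S Q (v powi n)"
  by (simp add: power_int_def local_unit_power local_unit_inverse)

lemma local_unit_mem: "local_unit S Q v \<Longrightarrow> v \<in> local_ring S Q"
  unfolding local_unit_def using local_ringI by auto

lemma local_maxI: "a \<in> Q \<Longrightarrow> b \<in> S - Q \<Longrightarrow> a / b \<in> local_max S Q"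
  by (auto simp: local_max_def)

lemma local_maxE:
  assumes "x \<in> local_max S Q"
  obtains a b where "x = a / b" "a \<in> Q" "b \<in> S - Q"
  using assms unfolding local_max_def by blast

lemma local_max_subset: "local_max S Q \<subseteq> local_ring S Q"
  unfolding local_max_def local_ring_def using primeD(4) by blast

lemma local_unit_iff: "local_unit S Q v \<longleftrightarrow> v \<in> local_ring S Q - local_max S Q"
proof
  assume v: "local_unit S Q v"
  have "v \<notin> local_max S Q"
  proof
    assume "v \<in> local_max S Q"
    then obtain x s a b where *: "v = x / s" "x \<in> Q" "s \<in> S - Q" "v = a / b" "a \<in> S - Q" "b \<in> S - Q"
      using v unfolding local_max_def local_unit_def by blast
    have "s \<noteq> 0" "b \<noteq> 0" using * zero_in by auto
    then have "a * s = x * b"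
      using * by (simp add: field_simps)
    moreover have "x * b \<in> Q" using * primeD(8)[of b x] by auto
    ultimately show False using * primeD(3)[of a s] by auto
  qed
  then show "v \<in> local_ring S Q - local_max S Q" using local_unit_mem[OF v] by blast
next
  assume "v \<in> local_ring S Q - local_max S Q"
  then show "local_unit S Q v"
    unfolding local_ring_def local_max_def local_unit_def by auto
qed

lemma local_max_ideal: "is_ideal (local_ring S Q) (local_max S Q)"
  unfolding is_ideal_def
proof (intro conjI ballI)
  show "local_max S Q \<subseteq> local_ring S Q" by (rule local_max_subset)
  show "0 \<in> local_max S Q" using local_maxI[of 0 1] by auto
  show "a + b \<in> local_max S Q" if ab: "a \<in> local_max S Q" "b \<in> local_max S Q" for a b
  proof -
    obtain x s where x: "a = x / s" "x \<in> Q" "s \<in> S - Q"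
      using ab(1) by (rule local_maxE)
    obtain y t where y: "b = y / t" "y \<in> Q" "t \<in> S - Q"
      using ab(2) by (rule local_maxE)
    note * = x y
    have "s \<noteq> 0" "t \<noteq> 0" using * zero_in by auto
    then have "a + b = (t * x + s * y) / (s * t)"
      using * by (simp add: field_simps)
    then show ?thesis using * primeD(6,7) mult_notin by (auto intro!: local_maxI)
  qed
  show "x * a \<in> local_max S Q" if xa: "x \<in> local_ring S Q" "a \<in> local_max S Q" for x a
  proof -
    obtain y s where y: "a = y / s" "y \<in> Q" "s \<in> S - Q"
      using xa(2) by (rule local_maxE)
    obtain z t where z: "z \<in> S" "t \<in> S - Q" "x = z / t"
      using xa(1) by (rule local_ringE)
    note * = y z
    then have "x * a = (z * y) / (t * s)" by simp
    then show ?thesis using * primeD(7) mult_notin by (auto intro!: local_maxI)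
  qed
qed

lemma Units_local_ring: "v \<in> Units (ring_on (local_ring S Q)) \<longleftrightarrow> local_unit S Q v"
proof -
  interpret L: subdom "local_ring S Q" by (rule local_ring_subdom)
  have "1 \<notin> local_max S Q"
    using local_unit_iff[of 1] by simp
  then have "v \<notin> local_max S Q" if "v \<noteq> 0" "inverse v \<in> local_ring S Q"
    using L.is_idealD(4)[OF local_max_ideal, of "inverse v" v] that by auto
  then show ?thesis
    using local_unit_iff[of v] local_unit_inverse[of v] local_unit_nonzero[of v] local_unit_mem
    unfolding L.Units_ring_on by blast
qed

lemma uniformizer_iff:
  "uniformizer S Q t \<longleftrightarrow> t \<in> local_max S Q \<and> (\<forall>x\<in>local_max S Q. \<exists>y\<in>local_ring S Q. x = y * t)"
proof -
  interpret L: subdom "local_ring S Q" by (rule local_ring_subdom)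
  show ?thesis
  proof
    assume "uniformizer S Q t"
    then have t: "t \<in> local_ring S Q" "{y * t | y. y \<in> local_ring S Q} = local_max S Q"
      by (simp_all add: uniformizer_def cgenideal_def)
    have "1 * t \<in> local_max S Q"
      unfolding t(2)[symmetric] using L.one_mem by blast
    then show "t \<in> local_max S Q \<and> (\<forall>x\<in>local_max S Q. \<exists>y\<in>local_ring S Q. x = y * t)"
      using t(2) by auto
  next
    assume "t \<in> local_max S Q \<and> (\<forall>x\<in>local_max S Q. \<exists>y\<in>local_ring S Q. x = y * t)"
    then show "uniformizer S Q t"
      using L.is_idealD(1,4)[OF local_max_ideal] by (auto simp: uniformizer_def cgenideal_def)
  qed
qed

text \<open>A general element of the maximal ideal is a / s with a in Q, and 1 / s is in the local
  ring, so divisibility has to be tested on Q only.\<close>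

lemma uniformizerI:
  assumes "t \<in> local_max S Q" "\<And>x. x \<in> Q \<Longrightarrow> x \<noteq> 0 \<Longrightarrow> \<exists>y\<in>local_ring S Q. x = y * t"
  shows "uniformizer S Q t"
  unfolding uniformizer_iff
proof (intro conjI ballI)
  interpret L: subdom "local_ring S Q" by (rule local_ring_subdom)
  fix x assume "x \<in> local_max S Q"
  then obtain a s where *: "x = a / s" "a \<in> Q" "s \<in> S - Q"
    by (rule local_maxE)
  show "\<exists>y\<in>local_ring S Q. x = y * t"
  proof (cases "a = 0")
    case False
    then obtain y where "y \<in> local_ring S Q" "a = y * t" using assms(2) * by blast
    then have "x = y * (1 / s) * t" using * by simp
    moreover have "y * (1 / s) \<in> local_ring S Q"
      using * \<open>y \<in> _\<close> by (intro L.mult_mem local_ringI) auto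
    ultimately show ?thesis by blast
  qed (use * in \<open>auto intro!: bexI[of _ 0]\<close>)
qed (rule assms)

lemma uniformizer_powi_unit:
  assumes "uniformizer S Q t" "local_unit S Q (t powi n)"
  shows "n = 0"
proof -
  interpret L: subdom "local_ring S Q" by (rule local_ring_subdom)
  have t: "t \<in> local_max S Q" using assms(1) by (simp add: uniformizer_iff)
  have no: "\<not> local_unit S Q (t ^ Suc m)" for m
    using L.is_idealD(5)[OF local_max_ideal _ t, of "t ^ m"] L.power_mem[of t m] t local_max_subset
    by (auto simp: local_unit_iff)
  show ?thesis
  proof (rule ccontr)
    assume "n \<noteq> 0"
    then have "0 < nat \<bar>n\<bar>" by simp
    then obtain m where m: "nat \<bar>n\<bar> = Suc m" using gr0_implies_Suc by blast
    show False
    proof (cases "n > 0")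
      case True
      then show ?thesis using no[of m] assms(2) m by (simp add: power_int_def)
    next
      case False
      then have "t powi n = inverse (t ^ Suc m)"
        using m \<open>n \<noteq> 0\<close> by (simp add: power_int_def power_inverse flip: power_Suc)
      then show ?thesis using no[of m] local_unit_inverse[OF assms(2)] by simp
    qed
  qed
qed

lemma uniformizer_associated:
  assumes "uniformizer S Q t" "uniformizer S Q t'" "t \<noteq> 0"
  shows "\<exists>w. local_unit S Q w \<and> t' = w * t"
proof -
  obtain y where y: "y \<in> local_ring S Q" "t' = y * t"
    using assms unfolding uniformizer_iff by blast
  obtain z where z: "z \<in> local_ring S Q" "t = z * t'"
    using assms unfolding uniformizer_iff by blast
  have "z * y = 1" using y z assms(3) by (metis mult.assoc mult_cancel_right1 mult.commute)
  then have "y \<in> Units (ring_on (local_ring S Q))"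
    using y z by (auto simp: Units_def mult.commute)
  then show ?thesis using y Units_local_ring by blast
qed

text \<open>The definite description ranges over all uniformizers. They differ by units, so
  comparing two representations of f makes a power of t a unit, which forces equal exponents. One
  non-zero uniformizer suffices; no factorization of other elements enters. This is how orders are
  computed at prime divisors of a cone that dominate the curve.\<close>

lemma order_at_eqI:
  assumes t: "uniformizer S Q t" "t \<noteq> 0" and v: "local_unit S Q v" and f: "f = v * t powi n"
  shows "order_at S Q f = n"
  unfolding order_at_def Units_local_ring
proof (rule the_equality)
  show "\<exists>t v. uniformizer S Q t \<and> local_unit S Q v \<and> f = v * t powi n"
    using assms by blast
  fix m assume "\<exists>t v. uniformizer S Q t \<and> local_unit S Q v \<and> f = v * t powi m"
  then obtain t' v' where *: "uniformizer S Q t'" "local_unit S Q v'" "f = v' * t' powi m" by blast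
  obtain w where w: "local_unit S Q w" "t' = w * t"
    using uniformizer_associated[OF t(1) *(1) t(2)] by blast
  have "v * t powi n = v' * w powi m * t powi m"
    using f *(3) unfolding w(2) by (simp add: power_int_mult_distrib mult.assoc)
  then have "t powi (n - m) = v' * w powi m / v"
    using t(2) local_unit_nonzero[OF v] by (simp add: power_int_diff field_simps)
  moreover have "local_unit S Q (v' * w powi m / v)"
    using * w v by (intro local_unit_divide local_unit_mult local_unit_powi)
  ultimately have "n - m = 0" using uniformizer_powi_unit[OF t(1), of "n - m"] by simp
  then show "m = n" by simp
qed

end

text \<open>A discrete valuation ring in the form in which it gets verified: elements of the ring
  itself factor, and fractions follow. No chain condition is involved, so the locale can be
  instantiated by explicit computation on a cone.\<close>

locale dvr_at = subdom_prime +
  fixes t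
  assumes unif: "uniformizer S Q t" and t_nz: "t \<noteq> 0"
    and factor: "\<And>x. x \<in> S \<Longrightarrow> x \<noteq> 0 \<Longrightarrow> \<exists>v n. local_unit S Q v \<and> x = v * t ^ n"
begin

lemma order_atI: "local_unit S Q v \<Longrightarrow> f = v * t powi n \<Longrightarrow> order_at S Q f = n"
  by (rule order_at_eqI[OF unif t_nz])

lemma order_at_factor:
  assumes "f \<in> frac_field S" "f \<noteq> 0"
  shows "\<exists>v. local_unit S Q v \<and> f = v * t powi order_at S Q f"
proof -
  obtain x y where *: "x \<in> S" "y \<in> S" "y \<noteq> 0" "f = x / y" using assms(1) by (rule frac_fieldE)
  then obtain v n w m where v: "local_unit S Q v" "x = v * t ^ n" "local_unit S Q w" "y = w * t ^ m"
    using factor[of x] factor[of y] assms(2) by fastforce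
  have "f = v / w * t powi (int n - int m)"
    using * v t_nz by (simp add: power_int_diff)
  moreover have "local_unit S Q (v / w)" using v by (intro local_unit_divide)
  ultimately show ?thesis using order_atI by metis
qed

lemma order_mult:
  assumes "f \<in> frac_field S" "f \<noteq> 0" "g \<in> frac_field S" "g \<noteq> 0"
  shows "order_at S Q (f * g) = order_at S Q f + order_at S Q g"
proof -
  obtain v w where "local_unit S Q v" "f = v * t powi order_at S Q f"
    "local_unit S Q w" "g = w * t powi order_at S Q g"
    using order_at_factor assms by metis
  moreover from this have "f * g = (v * w) * t powi (order_at S Q f + order_at S Q g)"
    using t_nz by (metis (no_types, opaque_lifting) mult.assoc mult.left_commute power_int_add)
  ultimately show ?thesis by (metis order_atI local_unit_mult)
qed

lemma order_unit: "local_unit S Q v \<Longrightarrow> order_at S Q v = 0"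
  by (rule order_atI) auto

lemma order_one [simp]: "order_at S Q 1 = 0"
  by (simp add: order_unit)

lemma order_uniformizer: "order_at S Q t = 1"
  by (rule order_atI[of 1]) auto

lemma order_inverse:
  assumes "f \<in> frac_field S" "f \<noteq> 0"
  shows "order_at S Q (inverse f) = - order_at S Q f"
  using order_mult[of f "inverse f"] assms frac_field_inverse[of f] by simp

lemma order_divide:
  assumes "f \<in> frac_field S" "f \<noteq> 0" "g \<in> frac_field S" "g \<noteq> 0"
  shows "order_at S Q (f / g) = order_at S Q f - order_at S Q g"
  using order_mult[of f "inverse g"] assms frac_field_inverse[of g] order_inverse[of g]
  by (simp add: divide_inverse)

lemma order_power:
  assumes "f \<in> frac_field S" "f \<noteq> 0"
  shows "order_at S Q (f ^ n) = int n * order_at S Q f"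
proof (induction n)
  case (Suc n)
  have "f ^ n \<in> frac_field S" using assms subdom.power_mem[OF frac_field_subdom] by blast
  with Suc show ?case using order_mult[of f "f ^ n"] assms by (simp add: algebra_simps)
qed simp

lemma order_powi:
  assumes "f \<in> frac_field S" "f \<noteq> 0"
  shows "order_at S Q (f powi n) = n * order_at S Q f"
proof (cases "n \<ge> 0")
  case True
  then show ?thesis using order_power[OF assms, of "nat n"] by (simp add: power_int_def)
next
  case False
  then show ?thesis
    using order_power[of "inverse f" "nat (- n)"] assms frac_field_inverse order_inverse
    by (simp add: power_int_def)
qed

lemma order_nonneg_iff:
  assumes "f \<in> frac_field S" "f \<noteq> 0"
  shows "0 \<le> order_at S Q f \<longleftrightarrow> f \<in> local_ring S Q"
    and "0 < order_at S Q f \<longleftrightarrow> f \<in> local_max S Q"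
proof -
  interpret L: subdom "local_ring S Q" by (rule local_ring_subdom)
  have tm: "t \<in> local_max S Q" using unif by (simp add: uniformizer_iff)
  then have tl: "t \<in> local_ring S Q" using local_max_subset by blast
  have a: "f \<in> local_ring S Q" if f: "f \<in> frac_field S" "f \<noteq> 0" "0 \<le> order_at S Q f" for f
  proof -
    obtain v where "local_unit S Q v" "f = v * t powi order_at S Q f"
      using order_at_factor[OF f(1,2)] by blast
    then show ?thesis using that L.power_mem[OF tl] L.mult_mem local_unit_mem
      by (metis power_int_nonneg_exp)
  qed
  have b: "f \<in> local_max S Q" if f: "f \<in> frac_field S" "f \<noteq> 0" "0 < order_at S Q f" for f
  proof -
    have tf: "t \<in> frac_field S" using tl local_ring_subset by blast
    have "f / t \<in> local_ring S Q"
      by (rule a) (use f tf t_nz in \<open>auto simp: frac_field_divide order_divide order_uniformizer\<close>)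
    then have "f / t * t \<in> local_max S Q"
      using tm L.is_idealD(4)[OF local_max_ideal] by blast
    then show ?thesis using t_nz by simp
  qed
  have c: "order_at S Q f = 0" if "f \<in> local_ring S Q - local_max S Q"
    using that local_unit_iff order_unit by blast
  have d: "\<not> order_at S Q f < 0" if "f \<in> local_ring S Q"
  proof
    assume "order_at S Q f < 0"
    then have "inverse f \<in> local_max S Q"
      using b[of "inverse f"] assms order_inverse frac_field_inverse by simp
    then have "f * inverse f \<in> local_max S Q"
      using that L.is_idealD(4)[OF local_max_ideal] by blast
    then show False using assms local_unit_iff[of 1] by simp
  qed
  have e: "order_at S Q f \<noteq> 0" if "f \<in> local_max S Q"
  proof
    assume "order_at S Q f = 0"
    then have "local_unit S Q f" using order_at_factor[OF assms] by auto
    then show False using that local_unit_iff by blast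
  qed
  show "0 \<le> order_at S Q f \<longleftrightarrow> f \<in> local_ring S Q"
    using a assms d by force
  show "0 < order_at S Q f \<longleftrightarrow> f \<in> local_max S Q"
    using b assms d e local_max_subset by force
qed

lemma order_add:
  assumes "f \<in> frac_field S" "f \<noteq> 0" "g \<in> frac_field S" "g \<noteq> 0" "f + g \<noteq> 0"
    and "n \<le> order_at S Q f" "n \<le> order_at S Q g"
  shows "n \<le> order_at S Q (f + g)"
proof -
  interpret L: subdom "local_ring S Q" by (rule local_ring_subdom)
  interpret F: subdom "frac_field S" by (rule frac_field_subdom)
  have tf: "t \<in> frac_field S" using unif local_ring_subset by (auto simp: uniformizer_def)
  have tn: "t powi n \<in> frac_field S" "t powi n \<noteq> 0"
    using tf t_nz by (auto simp: frac_field_powi)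
  have o: "order_at S Q (h / t powi n) = order_at S Q h - n" if "h \<in> frac_field S" "h \<noteq> 0" for h
    using that tn tf t_nz by (simp add: order_divide order_powi order_uniformizer)
  \<comment> \<open>Division by \<open>t powi n\<close> turns both bounds into membership in the
    local ring, which is closed under addition.\<close>
  have "f / t powi n \<in> local_ring S Q" "g / t powi n \<in> local_ring S Q"
    using assms o[of f] o[of g] tn order_nonneg_iff(1)[of "f / t powi n"] order_nonneg_iff(1)[of "g / t powi n"]
    by (simp_all add: frac_field_divide)
  then have "(f + g) / t powi n \<in> local_ring S Q"
    by (simp add: add_divide_distrib)
  then show ?thesis
    using o[of "f + g"] assms tn order_nonneg_iff(1)[of "(f + g) / t powi n"]
    by (simp add: frac_field_divide)
qed

lemma order_mem_nonneg: "x \<in> S \<Longrightarrow> x \<noteq> 0 \<Longrightarrow> 0 \<le> order_at S Q x"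
  using order_nonneg_iff(1)[of x] subset_frac_field subset_local_ring by blast

lemma order_pos_iff: "x \<in> S \<Longrightarrow> x \<noteq> 0 \<Longrightarrow> 0 < order_at S Q x \<longleftrightarrow> x \<in> Q"
  using order_nonneg_iff(2)[of x] subset_frac_field[of x] local_maxI[of x 1]
    local_unitI1[of x] local_unit_iff[of x] by auto

text \<open>A non-zero prime inside Q contains a local unit times a power of t, hence the numerator
  of t. Locally t divides every element of Q, so clearing denominators puts all of Q into that
  prime.\<close>

lemma prime_divisor: "Q \<in> prime_divisors S"
proof -
  interpret L: subdom "local_ring S Q" by (rule local_ring_subdom)
  have tm: "t \<in> local_max S Q" using unif by (simp add: uniformizer_iff)
  then obtain a s where t: "t = a / s" "a \<in> Q" "s \<in> S - Q"
    by (rule local_maxE)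
  have s0: "s \<noteq> 0" and a0: "a \<noteq> 0" using t t_nz by auto
  have "P = {0} \<or> P = Q" if P: "is_prime S P" "P \<subseteq> Q" for P
  proof (rule disjCI)
    assume "P \<noteq> Q"
    show "P = {0}"
    proof (rule ccontr)
      assume "P \<noteq> {0}"
      then obtain x where x: "x \<in> P" "x \<noteq> 0" using is_primeD(5)[OF P(1)] by blast
      then have xS: "x \<in> S" using is_primeD(4)[OF P(1)] by blast
      obtain v n where v: "local_unit S Q v" "x = v * t ^ n" using factor[OF xS x(2)] by blast
      obtain c d where cd: "c \<in> S - Q" "d \<in> S - Q" "v = c / d"
        using v(1) unfolding local_unit_def by blast
      have "d \<noteq> 0" using cd by auto
      then have "s ^ n * d * x = c * a ^ n"
        using v(2) cd t s0 by (simp add: field_simps)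
      moreover have "s ^ n * d * x \<in> P"
        using x(1) cd(2) t(3) by (intro is_primeD(7)[OF P(1)] mult_mem power_mem) auto
      ultimately have "c * a ^ n \<in> P" by simp
      moreover have aS: "a \<in> S" using t primeD(4) by blast
      ultimately have aP: "a \<in> P"
        using is_primeD(3)[OF P(1), of c "a ^ n"] cd P(2) prime_power[OF P(1) aS] by blast
      have "Q \<subseteq> P"
      proof
        fix y assume y: "y \<in> Q"
        then have "y \<in> local_max S Q" using local_maxI[of y 1] by auto
        then obtain z where "z \<in> local_ring S Q" "y = z * t"
          using unif unfolding uniformizer_iff by blast
        then obtain e f where ef: "e \<in> S" "f \<in> S - Q" "y = e / f * t" "f \<noteq> 0"
          by (metis local_ringE)
        then have "(f * s) * y = e * a" using t s0 by simp
        then have "(f * s) * y \<in> P" using is_primeD(7)[OF P(1) ef(1) aP] by simp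
        moreover have "f * s \<in> S - Q" using ef t by (intro mult_notin)
        ultimately show "y \<in> P" using is_primeD(3)[OF P(1), of "f * s" y] P(2) y primeD(4) by blast
      qed
      with \<open>P \<noteq> Q\<close> P(2) show False by blast
    qed
  qed
  moreover have "Q \<noteq> {0}" using t a0 by blast
  ultimately show ?thesis using prime prime_divisors_iff by blast
qed

end

section \<open>Noetherian rings and smooth affine curves\<close>

definition acc :: "'k::field set \<Rightarrow> bool" where
  "acc S \<longleftrightarrow> (\<forall>I::nat \<Rightarrow> 'k set. (\<forall>n. is_ideal S (I n) \<and> I n \<subseteq> I (Suc n)) \<longrightarrow>
    (\<exists>N. \<forall>n\<ge>N. I n = I N))"

lemma accD:
  assumes "acc S" "\<And>n. is_ideal S (I n)" "\<And>n. I n \<subseteq> I (Suc n)"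
  obtains N where "\<And>n. n \<ge> N \<Longrightarrow> I n = I (N::nat)"
  using assms unfolding acc_def by metis

lemma acc_maximal:
  assumes "acc S" "X \<noteq> {}" "\<And>I. I \<in> X \<Longrightarrow> is_ideal S I"
  shows "\<exists>I\<in>X. \<forall>J\<in>X. I \<subseteq> J \<longrightarrow> J = I"
proof (rule ccontr)
  assume "\<not> ?thesis"
  then have *: "\<And>I. I \<in> X \<Longrightarrow> \<exists>J. J \<in> X \<and> I \<subset> J" by auto
  have "\<exists>f. \<forall>n::nat. f n \<in> X \<and> f n \<subset> f (Suc n)"
    by (rule dependent_nat_choice) (use * assms(2) in auto)
  then obtain f where f: "\<And>n::nat. f n \<in> X" "\<And>n. f n \<subset> f (Suc n)" by blast
  obtain N where N: "\<And>n. n \<ge> N \<Longrightarrow> f n = f N"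
    by (rule accD[OF assms(1), of f]) (use f assms(3) in auto)
  have "f (Suc N) = f N" by (rule N) simp
  with f(2)[of N] show False by simp
qed

text \<open>The diagonal stabilizes at some N. A row with index at least N lies below the diagonal
  and, from column N on, above \<open>J N N\<close>, so it is constant there; the finitely many
  earlier rows have individual bounds, and the maximum of all bounds is uniform.\<close>

lemma acc_double:
  fixes J :: "nat \<Rightarrow> nat \<Rightarrow> 'k::field set"
  assumes "acc S" and ideal: "\<And>n m. is_ideal S (J n m)"
    and m1: "\<And>n m. J n m \<subseteq> J (Suc n) m" and m2: "\<And>n m. J n m \<subseteq> J n (Suc m)"
  shows "\<exists>M. \<forall>n. \<forall>m\<ge>M. J n m = J n M"
proof -
  have mono1: "n \<le> n' \<Longrightarrow> J n m \<subseteq> J n' m" for n n' m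
    by (rule lift_Suc_mono_le[of "\<lambda>n. J n m"]) (use m1 in auto)
  have mono2: "m \<le> m' \<Longrightarrow> J n m \<subseteq> J n m'" for n m m'
    by (rule lift_Suc_mono_le[of "J n"]) (use m2 in auto)
  have mono: "J n m \<subseteq> J n' m'" if "n \<le> n'" "m \<le> m'" for n n' m m'
    using mono1[OF that(1), of m] mono2[OF that(2), of n'] by blast
  obtain N where N: "\<And>n. n \<ge> N \<Longrightarrow> J n n = J N N"
    by (rule accD[OF assms(1), of "\<lambda>n. J n n"]) (use ideal mono in auto)
  have "\<exists>K. \<forall>m\<ge>K. J n m = J n K" for n
    by (rule accD[OF assms(1), of "J n"]) (use ideal m2 in auto)
  then obtain K where K: "\<And>n m. m \<ge> K n \<Longrightarrow> J n m = J n (K n)" by metis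
  define M where "M = Max (insert N (K ` {..N}))"
  have M: "N \<le> M" "\<And>n. n \<le> N \<Longrightarrow> K n \<le> M"
    unfolding M_def by (auto intro!: Max_ge simp del: Max_insert)
  have "J n m = J n M" if "m \<ge> M" for n m
  proof (cases "n \<le> N")
    case True
    then show ?thesis using K[of n m] K[of n M] M(2)[of n] that by simp
  next
    case False
    have "J n m' = J N N" if "m' \<ge> M" for m'
    proof
      show "J N N \<subseteq> J n m'" using mono[of N n N m'] False that M by simp
      have "J n m' \<subseteq> J (max n m') (max n m')" by (rule mono) auto
      then show "J n m' \<subseteq> J N N" using N[of "max n m'"] False by simp
    qed
    then show ?thesis using that by simp
  qed
  then show ?thesis by blast
qed

section \<open>Adjoining one element, and Hilbert's basis theorem\<close>

definition polys :: "'k::field set \<Rightarrow> 'k poly set" where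
  "polys B = {p. \<forall>i. coeff p i \<in> B}"

context subdom
begin

lemma polys_add: "p \<in> polys S \<Longrightarrow> q \<in> polys S \<Longrightarrow> p + q \<in> polys S"
  and polys_diff: "p \<in> polys S \<Longrightarrow> q \<in> polys S \<Longrightarrow> p - q \<in> polys S"
  and polys_uminus: "p \<in> polys S \<Longrightarrow> - p \<in> polys S"
  and polys_smult: "c \<in> S \<Longrightarrow> p \<in> polys S \<Longrightarrow> smult c p \<in> polys S"
  and polys_pCons: "c \<in> S \<Longrightarrow> p \<in> polys S \<Longrightarrow> pCons c p \<in> polys S"
  and polys_0: "0 \<in> polys S" and polys_1: "1 \<in> polys S"
  and polys_monom: "c \<in> S \<Longrightarrow> Polynomial.monom c n \<in> polys S"
  by (auto simp: polys_def coeff_pCons split: nat.split)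

lemma polys_mult: "p \<in> polys S \<Longrightarrow> q \<in> polys S \<Longrightarrow> p * q \<in> polys S"
  by (auto simp: polys_def coeff_mult intro!: sum_mem)

definition adjoin :: "'k \<Rightarrow> 'k set" where
  "adjoin x = (\<lambda>p. poly p x) ` polys S"

lemma subdom_adjoin: "subdom (adjoin x)"
proof
  show "0 \<in> adjoin x" "1 \<in> adjoin x"
    using polys_0 polys_1 poly_0 poly_1 unfolding adjoin_def by (metis imageI)+
  fix f g assume "f \<in> adjoin x" "g \<in> adjoin x"
  then obtain p q where "f = poly p x" "g = poly q x" "p \<in> polys S" "q \<in> polys S"
    by (auto simp: adjoin_def)
  then show "f + g \<in> adjoin x" "f * g \<in> adjoin x" "- f \<in> adjoin x"
    unfolding adjoin_def
    by (auto simp: image_iff simp flip: poly_add poly_mult poly_minus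
        intro: polys_add polys_mult polys_uminus)
qed

lemma subset_adjoin: "S \<subseteq> adjoin x"
proof
  fix s assume "s \<in> S"
  then have "[:s:] \<in> polys S" by (intro polys_pCons polys_0)
  then show "s \<in> adjoin x" by (force simp: adjoin_def)
qed

lemma self_in_adjoin: "x \<in> adjoin x"
proof -
  have "[:0, 1:] \<in> polys S" by (intro polys_pCons polys_0) auto
  then show ?thesis by (force simp: adjoin_def)
qed

lemma adjoin_subset:
  assumes "subdom T" "S \<subseteq> T" "x \<in> T"
  shows "adjoin x \<subseteq> T"
proof -
  interpret T: subdom T by fact
  show ?thesis
    using assms(2,3) by (auto simp: adjoin_def polys_def poly_altdef intro!: T.sum_mem)
qed

text \<open>Hilbert's basis theorem: \<open>J n m\<close> below consists of the leading coefficients of the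
  representatives of degree \<open>n\<close> of elements of the \<open>m\<close>-th ideal.\<close>

lemma acc_adjoin:
  assumes "acc S"
  shows "acc (adjoin x)"
  unfolding acc_def
proof (intro allI impI)
  fix I :: "nat \<Rightarrow> 'k set"
  assume I: "\<forall>n. is_ideal (adjoin x) (I n) \<and> I n \<subseteq> I (Suc n)"
  interpret B: subdom "adjoin x" by (rule subdom_adjoin)
  have Iid: "is_ideal (adjoin x) (I m)" for m using I by blast
  have Imono: "m \<le> m' \<Longrightarrow> I m \<subseteq> I m'" for m m'
    by (rule lift_Suc_mono_le[of I]) (use I in auto)
  define J where "J n m = {coeff p n | p. p \<in> polys S \<and> degree p \<le> n \<and> poly p x \<in> I m}" for n m
  have "\<exists>M. \<forall>n. \<forall>m\<ge>M. J n m = J n M"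
  proof (rule acc_double[OF assms])
    fix n m
    show "is_ideal S (J n m)"
      unfolding is_ideal_def
    proof (intro conjI ballI)
      show "J n m \<subseteq> S" by (auto simp: J_def polys_def)
      show "0 \<in> J n m"
        unfolding J_def using B.is_idealD(2)[OF Iid] polys_0
        by (intro CollectI exI[of _ "0 :: 'k poly"]) auto
    next
      fix a b assume "a \<in> J n m" "b \<in> J n m"
      then obtain p q where "a = coeff p n" "p \<in> polys S" "degree p \<le> n" "poly p x \<in> I m"
        "b = coeff q n" "q \<in> polys S" "degree q \<le> n" "poly q x \<in> I m"
        by (auto simp: J_def)
      then show "a + b \<in> J n m"
        unfolding J_def using B.is_idealD(3)[OF Iid]
        by (intro CollectI exI[of _ "p + q"]) (auto intro: polys_add degree_add_le)
    next
      fix c a assume "c \<in> S" "a \<in> J n m"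
      then obtain p where "c \<in> adjoin x" "a = coeff p n" "p \<in> polys S" "degree p \<le> n" "poly p x \<in> I m"
        using subset_adjoin by (auto simp: J_def)
      then show "c * a \<in> J n m"
        unfolding J_def using B.is_idealD(4)[OF Iid] \<open>c \<in> S\<close> degree_smult_le[of c p]
        by (intro CollectI exI[of _ "smult c p"]) (auto intro: polys_smult)
    qed
    show "J n m \<subseteq> J (Suc n) m"
    proof
      fix a assume "a \<in> J n m"
      then obtain p where "a = coeff p n" "p \<in> polys S" "degree p \<le> n" "poly p x \<in> I m"
        by (auto simp: J_def)
      then show "a \<in> J (Suc n) m"
        unfolding J_def using B.is_idealD(4)[OF Iid self_in_adjoin]
        by (intro CollectI exI[of _ "pCons 0 p"]) (auto intro: polys_pCons)
    qed
    show "J n m \<subseteq> J n (Suc m)"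
      using I by (auto simp: J_def)
  qed
  then obtain M where M: "\<And>n m. m \<ge> M \<Longrightarrow> J n m = J n M" by blast
  have "poly p x \<in> I M" if "m \<ge> M" "p \<in> polys S" "degree p < n" "poly p x \<in> I m" for m p n
    using that(2-)
  proof (induction n arbitrary: p)
    case (Suc n)
    then have "coeff p n \<in> J n m" by (auto simp: J_def)
    then have "coeff p n \<in> J n M" using M that(1) by blast
    \<comment> \<open>The element q evaluates into the smaller ideal \<open>I M\<close> and has the
      same coefficient in degree n. Subtracting it lowers the degree, so induction applies to p -
      q.\<close>
    then obtain q where q: "coeff q n = coeff p n" "q \<in> polys S" "degree q \<le> n" "poly q x \<in> I M"
      by (auto simp: J_def)
    have qm: "poly q x \<in> I m" using q(4) Imono[OF that(1)] by blast
    show ?case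
    proof (cases "p = q")
      case False
      then have "poly (p - q) x \<in> I M"
      \<comment> \<open>The strict bound \<open>degree p < n\<close> in the induction hypothesis is
        unsatisfiable for n = 0; there p - q vanishes outright, against the case assumption.\<close>
      proof (cases "n = 0")
        case True
        have "coeff (p - q) k = 0" for k
          using True q Suc.prems by (cases k) (auto simp: coeff_eq_0)
        then have "p - q = 0" by (intro poly_eqI) simp
        then show ?thesis using False by simp
      next
        case False
        have "degree (p - q) < n"
        proof (rule degree_lessI)
          show "p - q \<noteq> 0 \<or> n > 0" using False by simp
          show "\<forall>k\<ge>n. coeff (p - q) k = 0"
            using q Suc.prems by (auto simp: le_less coeff_eq_0)
        qed
        moreover have "poly (p - q) x \<in> I m"
          using B.is_idealD(7)[OF Iid Suc.prems(3) qm] by simp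
        ultimately show ?thesis using Suc.IH[of "p - q"] polys_diff Suc.prems(1) q(2) by blast
      qed
      then have "poly (p - q) x + poly q x \<in> I M" using B.is_idealD(3)[OF Iid] q(4) by blast
      then show ?thesis by simp
    qed (use q in simp)
  qed simp
  then have *: "poly p x \<in> I M" if "m \<ge> M" "p \<in> polys S" "poly p x \<in> I m" for m p
    using that by blast
  have "I m \<subseteq> I M" if "m \<ge> M" for m
  proof
    fix y assume y: "y \<in> I m"
    then have "y \<in> adjoin x" by (rule B.is_idealD(1)[OF Iid])
    then show "y \<in> I M" using * that y by (auto simp: adjoin_def)
  qed
  then show "\<exists>N. \<forall>n\<ge>N. I n = I N"
    using Imono by blast
qed

lemma acc_field:
  assumes "\<And>x. x \<in> S \<Longrightarrow> inverse x \<in> S"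
  shows "acc S"
  unfolding acc_def
proof (intro allI impI)
  fix I :: "nat \<Rightarrow> 'k set"
  assume I: "\<forall>n. is_ideal S (I n) \<and> I n \<subseteq> I (Suc n)"
  have Imono: "m \<le> m' \<Longrightarrow> I m \<subseteq> I m'" for m m'
    by (rule lift_Suc_mono_le[of I]) (use I in auto)
  show "\<exists>N. \<forall>n\<ge>N. I n = I N"
  proof (cases "\<exists>N. \<exists>x\<in>I N. x \<noteq> 0")
    case True
    then obtain N x where x: "x \<in> I N" "x \<noteq> 0" by blast
    have "I n = S" if "n \<ge> N" for n
    proof -
      have *: "is_ideal S (I n)" "x \<in> I n" using I Imono[OF that] x by auto
      then have "inverse x * x \<in> I n"
        using is_idealD(1,4)[OF *(1)] assms by blast
      then show ?thesis using ideal_eq_top[OF *(1)] x(2) by simp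
    qed
    then show ?thesis by auto
  next
    case False
    then have "I n = {0}" for n using is_idealD(2)[of "I n"] I by auto
    then show ?thesis by auto
  qed
qed

end

text \<open>The image of \<open>\<kappa>\<close> is a field and so has only trivial ideals. The
  generators are adjoined to it one at a time, and the resulting subring contains everything they
  generate.\<close>

lemma fin_gen_acc:
  fixes \<kappa> :: "complex \<Rightarrow> 'k::field"
  assumes "subdom R" "fin_gen_algebra \<kappa> R"
  shows "acc R"
proof -
  interpret R: subdom R by fact
  have hom: "\<kappa> \<in> ring_hom (ring_on UNIV) (ring_on R)"
    using assms(2) by (simp add: fin_gen_algebra_def)
  have k: "\<kappa> c \<in> R" "\<kappa> (c + d) = \<kappa> c + \<kappa> d" "\<kappa> (c * d) = \<kappa> c * \<kappa> d" "\<kappa> 1 = 1" for c d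
    using hom by (auto simp: ring_hom_def)
  have k0: "\<kappa> 0 = 0" using k(2)[of 0 0] by (metis add_cancel_right_right)
  have km: "\<kappa> (- c) = - \<kappa> c" for c
    using k(2)[of c "- c"] k0 by (simp add: minus_unique)
  have ki: "inverse (\<kappa> c) = \<kappa> (inverse c)" for c
  proof (cases "c = 0")
    case False
    then have "\<kappa> c * \<kappa> (inverse c) = 1" using k(3)[of c "inverse c"] k(4) by simp
    then show ?thesis by (rule inverse_unique)
  qed (simp add: k0)
  interpret K: subdom "range \<kappa>"
  proof
    show "0 \<in> range \<kappa>" "1 \<in> range \<kappa>" using k0 k(4) by (metis rangeI)+
  qed (auto simp flip: k(2,3) km)
  obtain X where X: "finite X" "X \<subseteq> R" "generate_ring (ring_on R) (range \<kappa> \<union> X) = R"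
    using assms(2) by (auto simp: fin_gen_algebra_def)
  have "\<exists>B. subdom B \<and> acc B \<and> range \<kappa> \<union> X \<subseteq> B \<and> B \<subseteq> R"
    using X(1,2)
  proof (induction X)
    case empty
    show ?case
      using K.subdom_axioms K.acc_field ki k(1) by (intro exI[of _ "range \<kappa>"]) auto
  next
    case (insert x X)
    then obtain B where B: "subdom B" "acc B" "range \<kappa> \<union> X \<subseteq> B" "B \<subseteq> R" by auto
    then interpret B: subdom B by simp
    show ?case
      using B insert.prems B.subdom_adjoin[of x] B.acc_adjoin[of x] B.subset_adjoin[of x]
        B.self_in_adjoin[of x] B.adjoin_subset[of R x] R.subdom_axioms
      by (intro exI[of _ "B.adjoin x"]) auto
  qed
  then obtain B where B: "subdom B" "acc B" "range \<kappa> \<union> X \<subseteq> B" "B \<subseteq> R" by blast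
  interpret B: subdom B by fact
  have "r \<in> B" if "r \<in> generate_ring (ring_on R) (range \<kappa> \<union> X)" for r
    using that
  proof induction
    case (a_inv h)
    then show ?case using B(4) R.a_inv_ring_on[of h] by auto
  qed (use B in auto)
  then have "B = R" using X(3) B(4) by blast
  then show ?thesis using B by simp
qed

text \<open>What the later parts use about the curve. The second condition is the device for gluing:
  an ideal contained in no prime divisor is the unit ideal.\<close>

locale dedekind = subdom R for R :: "'k::field set" +
  assumes dvr: "\<And>Q. Q \<in> prime_divisors R \<Longrightarrow> \<exists>t. dvr_at R Q t"
    and proper_ideal_subset: "\<And>I. is_ideal R I \<Longrightarrow> I \<noteq> R \<Longrightarrow> \<exists>Q\<in>prime_divisors R. I \<subseteq> Q"
    and finite_prime_divisors: "\<And>x. x \<in> R \<Longrightarrow> x \<noteq> 0 \<Longrightarrow> finite {Q \<in> prime_divisors R. x \<in> Q}"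

section \<open>From a smooth affine curve to a Dedekind ring\<close>

lemma (in subdom) maximal_iff:
  "maximalideal M (ring_on S) \<longleftrightarrow>
    is_ideal S M \<and> M \<noteq> S \<and> (\<forall>J. is_ideal S J \<and> M \<subseteq> J \<longrightarrow> J = M \<or> J = S)"
proof -
  interpret cring "ring_on S" by (rule cring_ring_on)
  show ?thesis
  proof
    assume "maximalideal M (ring_on S)"
    then interpret maximalideal M "ring_on S" .
    show "is_ideal S M \<and> M \<noteq> S \<and> (\<forall>J. is_ideal S J \<and> M \<subseteq> J \<longrightarrow> J = M \<or> J = S)"
      using ideal_axioms ideal_iff I_notcarr I_maximal is_idealD(1) by auto
  next
    assume *: "is_ideal S M \<and> M \<noteq> S \<and> (\<forall>J. is_ideal S J \<and> M \<subseteq> J \<longrightarrow> J = M \<or> J = S)"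
    then show "maximalideal M (ring_on S)"
      by (intro maximalidealI) (auto simp: ideal_iff)
  qed
qed

lemma (in subdom) maximal_is_prime: "maximalideal M (ring_on S) \<Longrightarrow> is_prime S M"
  using cring.maximalideal_prime[OF cring_ring_on] prime_iff by blast

lemma (in subdom) principal_ideal: "a \<in> S \<Longrightarrow> is_ideal S ((\<lambda>r. r * a) ` S)"
  unfolding is_ideal_def
  by (auto simp: image_iff simp flip: distrib_right mult.assoc intro: bexI[of _ 0])

lemma (in subdom) ideal_add_principal:
  assumes "is_ideal S I" "a \<in> S"
  shows "is_ideal S {i + r * a | i r. i \<in> I \<and> r \<in> S}" (is "is_ideal S ?J")
  unfolding is_ideal_def
proof (intro conjI ballI)
  note D = is_idealD[OF assms(1)]
  show "?J \<subseteq> S" using D(1) assms(2) by auto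
  show "0 \<in> ?J" using D(2) by (intro CollectI exI[of _ 0]) auto
  show "x + y \<in> ?J" if x: "x \<in> ?J" and y: "y \<in> ?J" for x y
  proof -
    obtain i r j s where "x = i + r * a" "y = j + s * a" "i \<in> I" "j \<in> I" "r \<in> S" "s \<in> S"
      using x y by blast
    then show ?thesis using D(3)
      by (intro CollectI exI[of _ "i + j"] exI[of _ "r + s"]) (auto simp: algebra_simps)
  qed
  show "c * x \<in> ?J" if c: "c \<in> S" and x: "x \<in> ?J" for c x
  proof -
    obtain i r where "x = i + r * a" "i \<in> I" "r \<in> S"
      using x by blast
    then show ?thesis using D(4) c
      by (intro CollectI exI[of _ "c * i"] exI[of _ "c * r"]) (auto simp: algebra_simps)
  qed
qed

lemma (in subdom_prime) local_max_unique:
  assumes "maximalideal M (ring_on (local_ring S Q))"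
  shows "M = local_max S Q"
proof -
  interpret L: subdom "local_ring S Q" by (rule local_ring_subdom)
  have M: "is_ideal (local_ring S Q) M" "M \<noteq> local_ring S Q"
    and max: "\<And>J. is_ideal (local_ring S Q) J \<Longrightarrow> M \<subseteq> J \<Longrightarrow> J = M \<or> J = local_ring S Q"
    using assms by (auto simp: L.maximal_iff)
  have "M \<subseteq> local_max S Q"
  proof
    fix x assume x: "x \<in> M"
    show "x \<in> local_max S Q"
    proof (rule ccontr)
      assume "x \<notin> local_max S Q"
      then have "local_unit S Q x" using L.is_idealD(1)[OF M(1) x] by (simp add: local_unit_iff)
      then have "inverse x * x \<in> M"
        using L.is_idealD(4)[OF M(1)] local_unit_inverse local_unit_mem x by blast
      then show False using L.ideal_eq_top[OF M(1)] M(2) local_unit_nonzero[OF \<open>local_unit S Q x\<close>] by simp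
    qed
  qed
  then show ?thesis using max[OF local_max_ideal] local_unit_iff[of 1] local_unit_1 by blast
qed

text \<open>Primes of the localization contract to primes of S. Strict inclusions survive, because
  multiplying a witness by its denominator brings it into S without changing which of the two primes
  contains it.\<close>

lemma (in subdom_prime) krull_dim_local_ring_le:
  assumes "krull_dim (ring_on S) = 1"
  shows "krull_dim (ring_on (local_ring S Q)) \<le> 1"
proof -
  interpret L: subdom "local_ring S Q" by (rule local_ring_subdom)
  have "enat n \<le> 1" if p: "prime_chain (ring_on (local_ring S Q)) n p" for n p
  proof -
    have pr: "is_prime (local_ring S Q) (p i)" if "i \<le> n" for i
      using p that L.prime_iff by (auto simp: prime_chain_def)
    have "is_prime S (p i \<inter> S)" if "i \<le> n" for i
      unfolding is_prime_def is_ideal_def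
      using L.is_primeD[OF pr[OF that]] subset_local_ring by auto
    moreover have "p i \<inter> S \<subset> p (Suc i) \<inter> S" if i: "i < n" for i
    proof -
      have "p i \<subset> p (Suc i)" using p i by (auto simp: prime_chain_def)
      then obtain x where x: "x \<in> p (Suc i)" "x \<notin> p i" by blast
      then have "x \<in> local_ring S Q" using L.is_primeD(4)[OF pr, of "Suc i"] i by simp
      then obtain a b where ab: "a \<in> S" "b \<in> S - Q" "x = a / b" "b \<noteq> 0" by (rule local_ringE)
      have "b * x \<in> p (Suc i)"
        using L.is_primeD(7)[OF pr, of "Suc i" b x] i x(1) subset_local_ring ab by auto
      then have "a \<in> p (Suc i)" using ab by simp
      moreover have "a \<notin> p i"
      proof
        assume "a \<in> p i"
        then have "(1 / b) * a \<in> p i"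
          using L.is_primeD(7)[OF pr, of i "1 / b" a] i local_ringI[of 1 b] ab by auto
        then show False using x ab by simp
      qed
      ultimately show ?thesis using \<open>p i \<subset> p (Suc i)\<close> ab(1) by blast
    qed
    ultimately have "prime_chain (ring_on S) n (\<lambda>i. p i \<inter> S)"
      by (auto simp: prime_chain_def prime_iff)
    then have "enat n \<le> krull_dim (ring_on S)"
      unfolding krull_dim_def by (intro Sup_upper) auto
    then show ?thesis using assms by simp
  qed
  then show ?thesis
    unfolding krull_dim_def by (intro Sup_least) auto
qed

text \<open>If x is not a unit times a power of t, then every x / t^n lies in the local ring. The
  ideals of those r for which r t^n / x is in the local ring increase with n, and once they
  stabilize 1 / t is in the local ring, which is absurd. They are formed inside S so that the chain
  condition on S itself applies.\<close>

lemma (in subdom_prime) dvr_atI: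
  assumes "acc S" and t: "uniformizer S Q t" "t \<noteq> 0"
  shows "dvr_at S Q t"
proof
  interpret L: subdom "local_ring S Q" by (rule local_ring_subdom)
  show "uniformizer S Q t" "t \<noteq> 0" by fact+
  have tL: "t \<in> local_ring S Q" using t by (simp add: uniformizer_def)
  fix x assume x: "x \<in> S" "x \<noteq> 0"
  show "\<exists>v n. local_unit S Q v \<and> x = v * t ^ n"
  proof (rule ccontr)
    assume no: "\<not> ?thesis"
    have loc: "x / t ^ n \<in> local_ring S Q" for n
    proof (induction n)
      case 0
      then show ?case using x subset_local_ring by simp
    next
      case (Suc n)
      have "x = (x / t ^ n) * t ^ n" using t(2) by simp
      then have "\<not> local_unit S Q (x / t ^ n)" using no by blast
      then have "x / t ^ n \<in> local_max S Q" using Suc local_unit_iff by blast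
      then obtain y where "y \<in> local_ring S Q" "x / t ^ n = y * t"
        using t(1) unfolding uniformizer_iff by blast
      then show ?case using t(2) by (simp add: field_simps)
    qed
    define I where "I n = {r \<in> S. r * (t ^ n / x) \<in> local_ring S Q}" for n
    have "is_ideal S (I n)" for n
      unfolding is_ideal_def I_def
      using subset_local_ring L.mult_mem L.add_mem L.zero_mem
      by (auto simp: distrib_right mult.assoc simp del: times_divide_eq_right)
    moreover have "I n \<subseteq> I (Suc n)" for n
    proof
      fix r assume "r \<in> I n"
      then have r: "r \<in> S" "t * (r * (t ^ n / x)) \<in> local_ring S Q"
        using L.mult_mem[OF tL, of "r * (t ^ n / x)"] by (simp_all add: I_def)
      have "t * (r * (t ^ n / x)) = r * (t ^ Suc n / x)" by simp
      with r show "r \<in> I (Suc n)" by (simp only: I_def mem_Collect_eq)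
    qed
    ultimately obtain N where N: "\<And>n. n \<ge> N \<Longrightarrow> I n = I N"
      using accD[OF assms(1)] by blast
    \<comment> \<open>The numerator a of x / t^(N+1) lies in \<open>I (Suc N)\<close> by
      construction; its membership in \<open>I N\<close> says that s / t is in the local
      ring.\<close>
    obtain a s where as: "a \<in> S" "s \<in> S - Q" "x / t ^ Suc N = a / s" "s \<noteq> 0"
      using loc[of "Suc N"] by (rule local_ringE)
    have eq: "a * t ^ Suc N = s * x" using as x t(2) by (simp add: field_simps)
    have "a * (t ^ Suc N / x) = s" using eq x by simp
    then have "a \<in> I (Suc N)" using as subset_local_ring by (simp add: I_def)
    then have "a \<in> I N" using N[of "Suc N"] by simp
    then have "a * (t ^ N / x) \<in> local_ring S Q" by (simp add: I_def)
    moreover have "a * (t ^ N / x) = s / t" using eq x t(2) by (simp add: field_simps)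
    ultimately have "(1 / s) * (s / t) \<in> local_ring S Q"
      using L.mult_mem[OF local_ringI[of 1 s], of "s / t"] as by auto
    moreover have "(1 / s) * (s / t) = 1 / t" using as by simp
    ultimately have "1 / t \<in> local_ring S Q" by (simp only:)
    then have "(1 / t) * t \<in> local_max S Q"
      using L.is_idealD(4)[OF local_max_ideal] t(1) uniformizer_iff by blast
    then show False using t(2) local_unit_iff[of 1] by simp
  qed
qed

text \<open>Dimension one makes the non-zero primes coincide with the maximal ideals. Regularity
  makes each local maximal ideal principal. The chain condition provides a maximal ideal above every
  proper ideal and the finiteness of the set of zeros of a function.\<close>

lemma smooth_affine_curve_dedekind:
  fixes R :: "'k::field set"
  assumes "smooth_affine_curve \<kappa> R"
  shows "dedekind R"
proof -
  have R: "domain (ring_on R)" "fin_gen_algebra \<kappa> R" "krull_dim (ring_on R) = 1"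
    and reg: "\<And>P. maximalideal P (ring_on R) \<Longrightarrow> regular_local_ring (ring_on (local_ring R P))"
    using assms by (auto simp: smooth_affine_curve_def)
  interpret subdom R using R(1) by (rule subdom_of_domain)
  have acc: "acc R" by (rule fin_gen_acc[OF subdom_axioms R(2)])
  define N where "N = {n. \<exists>p. prime_chain (ring_on R) n p}"
  have "prime_chain (ring_on R) 0 (\<lambda>_. {0})"
    using prime_zero by (auto simp: prime_chain_def prime_iff)
  then have "0 \<in> N" by (auto simp: N_def)
  then have N: "1 \<in> N" "\<And>n. n \<in> N \<Longrightarrow> n \<le> 1"
    using enat_Sup_eq_1_iff[of N] R(3) by (auto simp: krull_dim_def N_def)
  have dim: "P = {0} \<or> P = Q" if PQ: "is_prime R P" "is_prime R Q" "P \<subseteq> Q" for P Q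
  proof (rule ccontr)
    assume n: "\<not> (P = {0} \<or> P = Q)"
    let ?p = "\<lambda>i::nat. if i = 0 then {0} else if i = 1 then P else Q"
    have "{0} \<subset> P" "P \<subset> Q" using prime_zero_subset[OF PQ(1)] n PQ(3) by auto
    then have "prime_chain (ring_on R) 2 ?p"
      using PQ prime_zero by (auto simp: prime_chain_def prime_iff less_2_cases_iff)
    then have "2 \<in> N" by (auto simp: N_def)
    with N(2) show False by fastforce
  qed
  obtain p where "prime_chain (ring_on R) 1 p" using N(1) by (auto simp: N_def)
  then have p: "is_prime R (p 0)" "is_prime R (p 1)" "p 0 \<subset> p 1"
    by (auto simp: prime_chain_def prime_iff)
  have not_max0: "\<not> maximalideal {0} (ring_on R)"
  proof
    assume "maximalideal {0} (ring_on R)"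
    then have "p 1 = {0} \<or> p 1 = R"
      using p(2) prime_zero_subset is_primeD(1) unfolding maximal_iff by blast
    then show False using p prime_zero_subset[OF p(1)] is_primeD(2)[OF p(2)] by auto
  qed
  have max_pd: "M \<in> prime_divisors R" if "maximalideal M (ring_on R)" for M
    using that not_max0 maximal_is_prime[OF that] dim unfolding prime_divisors_iff by blast
  have proper: "\<exists>Q. maximalideal Q (ring_on R) \<and> I \<subseteq> Q" if I: "is_ideal R I" "I \<noteq> R" for I
  proof -
    define X where "X = {J. is_ideal R J \<and> J \<noteq> R \<and> I \<subseteq> J}"
    have "\<exists>M\<in>X. \<forall>J\<in>X. M \<subseteq> J \<longrightarrow> J = M"
      by (rule acc_maximal[OF acc]) (use I in \<open>auto simp: X_def\<close>)
    then obtain M where "M \<in> X" "\<forall>J\<in>X. M \<subseteq> J \<longrightarrow> J = M" by blast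
    then have "maximalideal M (ring_on R)" "I \<subseteq> M"
      unfolding maximal_iff X_def by auto
    then show ?thesis by blast
  qed
  have pd_max: "maximalideal Q (ring_on R)" if Q: "is_prime R Q" "Q \<noteq> {0}" for Q
  proof -
    have "Q \<noteq> R" using is_primeD(2)[OF Q(1)] by auto
    then obtain M where M: "maximalideal M (ring_on R)" "Q \<subseteq> M"
      using proper[of Q] is_primeD(1)[OF Q(1)] by blast
    then have "Q = M" using dim[OF Q(1) maximal_is_prime[OF M(1)]] Q(2) by blast
    then show ?thesis using M by simp
  qed
  show ?thesis
  proof
    show "\<exists>Q\<in>prime_divisors R. I \<subseteq> Q" if "is_ideal R I" "I \<noteq> R" for I
      using proper[OF that] max_pd by blast
  next
    fix Q assume "Q \<in> prime_divisors R"
    then have Q: "is_prime R Q" "Q \<noteq> {0}" by (auto simp: prime_divisors_iff)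
    interpret subdom_prime R Q by unfold_locales fact
    interpret L: subdom "local_ring R Q" by (rule local_ring_subdom)
    have "regular_local_ring (ring_on (local_ring R Q))" using reg pd_max[OF Q] by blast
    then obtain M X where M: "{I. maximalideal I (ring_on (local_ring R Q))} = {M}"
      and X: "finite X" "X \<subseteq> M" "Idl\<^bsub>ring_on (local_ring R Q)\<^esub> X = M"
        "enat (card X) = krull_dim (ring_on (local_ring R Q))"
      unfolding regular_local_ring_def by blast
    have Mm: "M = local_max R Q" using M local_max_unique[of M] by blast
    \<comment> \<open>Regularity equates the number of generators with the dimension. An empty set
      of generators is excluded below, as q is a non-zero element of the maximal ideal.\<close>
    have "enat (card X) \<le> 1" using X(4) krull_dim_local_ring_le[OF R(3)] by simp
    then have "card X \<le> 1" by (simp add: one_enat_def)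
    obtain q where q: "q \<in> Q" "q \<noteq> 0" using Q prime_zero_subset[of Q] by blast
    have qM: "q \<in> M" using q Mm local_maxI[of q 1] by auto
    have "X \<noteq> {}"
    proof
      assume "X = {}"
      have "ideal {0} (ring_on (local_ring R Q))"
        using L.prime_zero L.is_primeD(1) L.ideal_iff by blast
      then have "M \<subseteq> {0}" using X(3) \<open>X = {}\<close> unfolding genideal_def by blast
      then show False using qM q(2) by blast
    qed
    then have "card X = 1" using \<open>card X \<le> 1\<close> X(1) by (simp add: card_gt_0_iff le_antisym Suc_leI)
    then obtain t where t: "X = {t}" by (rule card_1_singletonE)
    have tL: "t \<in> local_ring R Q" using X(2) t Mm local_max_subset by blast
    have "PIdl\<^bsub>ring_on (local_ring R Q)\<^esub> t = M"
      using cring.cgenideal_eq_genideal[OF L.cring_ring_on, of t] tL X(3) t by simp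
    then have u: "uniformizer R Q t" using tL Mm by (simp add: uniformizer_def)
    then obtain y where "q = y * t" using qM Mm unfolding uniformizer_iff by blast
    then have "t \<noteq> 0" using q by auto
    then show "\<exists>t. dvr_at R Q t" using dvr_atI[OF acc u] by blast
  next
    fix x assume x: "x \<in> R" "x \<noteq> 0"
    \<comment> \<open>A maximal ideal among those contained in infinitely many prime divisors would be prime.\<close>
    define V where "V I = {Q \<in> prime_divisors R. I \<subseteq> Q}" for I
    define X where "X = {I. is_ideal R I \<and> I \<noteq> {0} \<and> infinite (V I)}"
    have "X = {}"
    proof (rule ccontr)
      assume "X \<noteq> {}"
      then have "\<exists>I\<in>X. \<forall>J\<in>X. I \<subseteq> J \<longrightarrow> J = I"
        by (intro acc_maximal[OF acc]) (auto simp: X_def)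
      then obtain I where I: "is_ideal R I" "I \<noteq> {0}" "infinite (V I)"
        and max: "\<And>J. J \<in> X \<Longrightarrow> I \<subseteq> J \<Longrightarrow> J = I"
        unfolding X_def by blast
      have "1 \<notin> I"
      proof
        assume "1 \<in> I"
        then have "V I = {}" unfolding V_def prime_divisors_iff using is_primeD(2) by blast
        then show False using I(3) by simp
      qed
      have "\<not> is_prime R I"
      proof
        assume "is_prime R I"
        then have "V I \<subseteq> {I}" using I(2) unfolding V_def prime_divisors_iff by blast
        then show False using I(3) finite_subset by blast
      qed
      then obtain a b where ab: "a \<in> R" "b \<in> R" "a * b \<in> I" "a \<notin> I" "b \<notin> I"
        using I(1) \<open>1 \<notin> I\<close> unfolding is_prime_def by blast
      \<comment> \<open>By maximality of I the strictly larger ideal I + (c) is contained in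
        finitely many prime divisors. Since a b is in I, each member of \<open>V I\<close> contains
        a or b, so this is applied with c = a and c = b.\<close>
      have fin: "finite {Q \<in> V I. c \<in> Q}" if c: "c \<in> R" "c \<notin> I" for c
      proof -
        let ?J = "{i + r * c | i r. i \<in> I \<and> r \<in> R}"
        have J: "is_ideal R ?J" by (rule ideal_add_principal[OF I(1) c(1)])
        have sub: "I \<subseteq> ?J"
        proof
          fix i assume "i \<in> I"
          then show "i \<in> ?J" by (intro CollectI exI[of _ i] exI[of _ 0]) auto
        qed
        have cJ: "c \<in> ?J"
          using is_idealD(2)[OF I(1)] by (intro CollectI exI[of _ 0] exI[of _ 1]) auto
        have "?J \<noteq> I" using cJ c(2) by auto
        then have "?J \<notin> X" using max[of ?J] sub by blast
        moreover have "?J \<noteq> {0}" using sub I(2) is_idealD(2)[OF I(1)] by blast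
        ultimately have "finite (V ?J)" using J unfolding X_def by blast
        moreover have "{Q \<in> V I. c \<in> Q} \<subseteq> V ?J"
        proof
          fix Q assume Q: "Q \<in> {Q \<in> V I. c \<in> Q}"
          then have "is_prime R Q" by (simp add: V_def prime_divisors_iff)
          then show "Q \<in> V ?J" using Q is_primeD(6,7) by (auto simp: V_def)
        qed
        ultimately show ?thesis using finite_subset by blast
      qed
      have "V I \<subseteq> {Q \<in> V I. a \<in> Q} \<union> {Q \<in> V I. b \<in> Q}"
        unfolding V_def prime_divisors_iff using ab is_primeD(3) by blast
      then show False using fin[of a] fin[of b] ab I(3) finite_subset by (metis finite_Un)
    qed
    moreover have id: "is_ideal R ((\<lambda>r. r * x) ` R)" by (rule principal_ideal[OF x(1)])
    moreover have "(\<lambda>r. r * x) ` R \<noteq> {0}"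
      using x(2) one_mem by (metis image_eqI mult_1 singletonD)
    ultimately have "finite (V ((\<lambda>r. r * x) ` R))" unfolding X_def by blast
    moreover have "{Q \<in> prime_divisors R. x \<in> Q} \<subseteq> V ((\<lambda>r. r * x) ` R)"
      unfolding V_def prime_divisors_iff using is_primeD(7) by blast
    ultimately show "finite {Q \<in> prime_divisors R. x \<in> Q}" using finite_subset by blast
  qed
qed

section \<open>Sections of divisors on a smooth affine curve\<close>

context dedekind
begin

lemma pd_prime: "P \<in> prime_divisors R \<Longrightarrow> is_prime R P"
  by (simp add: prime_divisors_iff)

lemma pd_nonzero: "P \<in> prime_divisors R \<Longrightarrow> P \<noteq> {0}"
  by (simp add: prime_divisors_iff)

text \<open>A non-zero prime lies in some prime divisor, whose height one leaves no room for a
  proper inclusion.\<close>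

lemma prime_cases:
  assumes "is_prime R p"
  obtains "p = {0}" | "p \<in> prime_divisors R"
proof (cases "p = {0}")
  case False
  moreover have "p \<noteq> R" using is_primeD(2)[OF assms] by auto
  then obtain Q where "Q \<in> prime_divisors R" "p \<subseteq> Q"
    using proper_ideal_subset is_primeD(1)[OF assms] by blast
  ultimately have "p \<in> prime_divisors R" using assms prime_divisors_iff[of Q] by blast
  then show thesis by (rule that)
qed (rule that)

lemma pd_not_subset: "Q \<in> prime_divisors R \<Longrightarrow> is_prime R p \<Longrightarrow> Q \<noteq> p \<Longrightarrow> \<not> Q \<subseteq> p"
  using prime_cases[of p] prime_divisors_iff[of p] prime_divisors_iff[of Q] is_primeD(5)[of Q]
  by blast

text \<open>The facts of \<open>dvr_at\<close> with the uniformizer hidden, so that orders at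
  varying points can be used without interpreting a locale at each of them.\<close>

lemma
  assumes "P \<in> prime_divisors R"
  shows ord_mult: "f \<in> frac_field R \<Longrightarrow> f \<noteq> 0 \<Longrightarrow> g \<in> frac_field R \<Longrightarrow> g \<noteq> 0 \<Longrightarrow>
      order_at R P (f * g) = order_at R P f + order_at R P g"
    and ord_divide: "f \<in> frac_field R \<Longrightarrow> f \<noteq> 0 \<Longrightarrow> g \<in> frac_field R \<Longrightarrow> g \<noteq> 0 \<Longrightarrow>
      order_at R P (f / g) = order_at R P f - order_at R P g"
    and ord_inverse: "f \<in> frac_field R \<Longrightarrow> f \<noteq> 0 \<Longrightarrow> order_at R P (inverse f) = - order_at R P f"
    and ord_power: "f \<in> frac_field R \<Longrightarrow> f \<noteq> 0 \<Longrightarrow> order_at R P (f ^ n) = int n * order_at R P f"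
    and ord_powi: "f \<in> frac_field R \<Longrightarrow> f \<noteq> 0 \<Longrightarrow> order_at R P (f powi k) = k * order_at R P f"
    and ord_one: "order_at R P 1 = 0"
    and ord_add: "f \<in> frac_field R \<Longrightarrow> f \<noteq> 0 \<Longrightarrow> g \<in> frac_field R \<Longrightarrow> g \<noteq> 0 \<Longrightarrow> f + g \<noteq> 0 \<Longrightarrow>
      m \<le> order_at R P f \<Longrightarrow> m \<le> order_at R P g \<Longrightarrow> m \<le> order_at R P (f + g)"
    and ord_nonneg: "x \<in> R \<Longrightarrow> x \<noteq> 0 \<Longrightarrow> 0 \<le> order_at R P x"
    and ord_pos_iff: "x \<in> R \<Longrightarrow> x \<noteq> 0 \<Longrightarrow> 0 < order_at R P x \<longleftrightarrow> x \<in> P"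
    and ord_notin: "x \<in> R - P \<Longrightarrow> order_at R P x = 0"
    and ord_nonneg_iff: "f \<in> frac_field R \<Longrightarrow> f \<noteq> 0 \<Longrightarrow> 0 \<le> order_at R P f \<longleftrightarrow> f \<in> local_ring R P"
    and ex_uniformizer: "\<exists>t. uniformizer R P t \<and> t \<in> frac_field R \<and> t \<noteq> 0 \<and> order_at R P t = 1"
    and uniformizer_ord: "uniformizer R P s \<Longrightarrow> s \<in> frac_field R \<and> s \<noteq> 0 \<and> order_at R P s = 1"
proof -
  obtain t where "dvr_at R P t" using dvr[OF assms] by blast
  then interpret dvr_at R P t .
  show "f \<in> frac_field R \<Longrightarrow> f \<noteq> 0 \<Longrightarrow> g \<in> frac_field R \<Longrightarrow> g \<noteq> 0 \<Longrightarrow>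
      order_at R P (f * g) = order_at R P f + order_at R P g"
    by (rule order_mult)
  show "f \<in> frac_field R \<Longrightarrow> f \<noteq> 0 \<Longrightarrow> g \<in> frac_field R \<Longrightarrow> g \<noteq> 0 \<Longrightarrow>
      order_at R P (f / g) = order_at R P f - order_at R P g"
    by (rule order_divide)
  show "f \<in> frac_field R \<Longrightarrow> f \<noteq> 0 \<Longrightarrow> order_at R P (inverse f) = - order_at R P f"
    by (rule order_inverse)
  show "f \<in> frac_field R \<Longrightarrow> f \<noteq> 0 \<Longrightarrow> order_at R P (f ^ n) = int n * order_at R P f"
    by (rule order_power)
  show "f \<in> frac_field R \<Longrightarrow> f \<noteq> 0 \<Longrightarrow> order_at R P (f powi k) = k * order_at R P f"
    by (rule order_powi)
  show "order_at R P 1 = 0" by (rule order_one)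
  show "f \<in> frac_field R \<Longrightarrow> f \<noteq> 0 \<Longrightarrow> g \<in> frac_field R \<Longrightarrow> g \<noteq> 0 \<Longrightarrow> f + g \<noteq> 0 \<Longrightarrow>
      m \<le> order_at R P f \<Longrightarrow> m \<le> order_at R P g \<Longrightarrow> m \<le> order_at R P (f + g)"
    by (rule order_add)
  show "x \<in> R \<Longrightarrow> x \<noteq> 0 \<Longrightarrow> 0 \<le> order_at R P x"
    by (rule order_mem_nonneg)
  show "x \<in> R \<Longrightarrow> x \<noteq> 0 \<Longrightarrow> 0 < order_at R P x \<longleftrightarrow> x \<in> P"
    by (rule order_pos_iff)
  show "x \<in> R - P \<Longrightarrow> order_at R P x = 0"
    using order_unit local_unitI1 by blast
  show "f \<in> frac_field R \<Longrightarrow> f \<noteq> 0 \<Longrightarrow> 0 \<le> order_at R P f \<longleftrightarrow> f \<in> local_ring R P"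
    by (rule order_nonneg_iff)
  have t: "t \<in> frac_field R" using unif local_ring_subset by (auto simp: uniformizer_def)
  then show "\<exists>t. uniformizer R P t \<and> t \<in> frac_field R \<and> t \<noteq> 0 \<and> order_at R P t = 1"
    using unif t_nz order_uniformizer by blast
  show "s \<in> frac_field R \<and> s \<noteq> 0 \<and> order_at R P s = 1" if s: "uniformizer R P s"
  proof -
    obtain w where w: "local_unit R P w" "s = w * t"
      using uniformizer_associated[OF unif s t_nz] by blast
    have "s \<in> frac_field R" using s local_ring_subset by (auto simp: uniformizer_def)
    moreover have "s \<noteq> 0" using w local_unit_nonzero t_nz by simp
    moreover have "order_at R P s = 1" by (rule order_atI[OF w(1)]) (use w in simp)
    ultimately show ?thesis by simp
  qed
qed

lemma finite_support:
  assumes "f \<in> frac_field R" "f \<noteq> 0"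
  shows "finite {P \<in> prime_divisors R. order_at R P f \<noteq> 0}"
proof -
  obtain x y where xy: "x \<in> R" "y \<in> R" "y \<noteq> 0" "f = x / y" using assms(1) by (rule frac_fieldE)
  then have "x \<noteq> 0" using assms(2) by auto
  have "{P \<in> prime_divisors R. order_at R P f \<noteq> 0} \<subseteq>
    {P \<in> prime_divisors R. x \<in> P} \<union> {P \<in> prime_divisors R. y \<in> P}"
  proof
    fix P assume "P \<in> {P \<in> prime_divisors R. order_at R P f \<noteq> 0}"
    then have P: "P \<in> prime_divisors R" "order_at R P x \<noteq> order_at R P y"
      using xy \<open>x \<noteq> 0\<close> by (auto simp: ord_divide subset_frac_field)
    then have "x \<in> P \<or> y \<in> P"
      using ord_notin[OF P(1), of x] ord_notin[OF P(1), of y] xy(1,2) by (metis DiffI)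
    then show "P \<in> {P \<in> prime_divisors R. x \<in> P} \<union> {P \<in> prime_divisors R. y \<in> P}"
      using P(1) by blast
  qed
  then show ?thesis
    using finite_prime_divisors xy \<open>x \<noteq> 0\<close> finite_subset by (metis (lifting) finite_Un)
qed

text \<open>For each Q in B there is an element of Q outside p, and a product of high powers of such
  elements works. The prime p may also be zero, and then the result is just a non-zero common
  multiple.\<close>

lemma approximation:
  assumes "finite B" "B \<subseteq> prime_divisors R" "is_prime R p" "p \<notin> B"
  shows "\<exists>r\<in>R - p. \<forall>Q\<in>B. N Q \<le> order_at R Q r"
  using assms(1,2,4)
proof (induction B)
  case empty
  then show ?case using is_primeD(2)[OF assms(3)] by blast
next
  case (insert Q B)
  then obtain r where r: "r \<in> R - p" "\<And>Q. Q \<in> B \<Longrightarrow> N Q \<le> order_at R Q r" by auto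
  have "\<not> Q \<subseteq> p" by (rule pd_not_subset) (use insert.prems assms(3) in auto)
  then obtain c where c: "c \<in> Q" "c \<notin> p" by blast
  have Q: "Q \<in> prime_divisors R" using insert.prems by simp
  then have cR: "c \<in> R" using c is_primeD(4)[OF pd_prime] by blast
  interpret p: subdom_prime R p by unfold_locales fact
  have nz: "r \<noteq> 0" "c \<noteq> 0" using r(1) c(2) p.zero_in by auto
  \<comment> \<open>A negative \<open>N Q\<close> demands nothing of an element of R, so
    \<open>nat\<close> may truncate the exponent to 0.\<close>
  let ?r = "r * c ^ nat (N Q)"
  have "?r \<in> R - p" using r(1) c cR by (intro p.mult_notin p.power_notin) auto
  moreover have ord: "order_at R Q' ?r = order_at R Q' r + int (nat (N Q)) * order_at R Q' c"
    if "Q' \<in> prime_divisors R" for Q'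
    using that r(1) cR nz by (simp add: ord_mult ord_power subset_frac_field)
  moreover have "N Q' \<le> order_at R Q' ?r" if "Q' \<in> insert Q B" for Q'
  proof -
    have pd: "Q' \<in> prime_divisors R" using that insert.prems by auto
    have nn: "0 \<le> order_at R Q' r" "0 \<le> order_at R Q' c"
      using ord_nonneg[OF pd] r(1) cR nz by auto
    show ?thesis
    proof (cases "Q' = Q")
      case True
      have "1 \<le> order_at R Q c" using ord_pos_iff[OF Q cR nz(2)] c(1) by simp
      then have "int (nat (N Q)) * 1 \<le> int (nat (N Q)) * order_at R Q c"
        by (intro mult_left_mono) auto
      then show ?thesis using ord[OF pd] nn True by auto
    next
      case False
      then have "N Q' \<le> order_at R Q' r" using r(2) that by auto
      moreover have "0 \<le> int (nat (N Q)) * order_at R Q' c" using nn by simp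
      ultimately show ?thesis using ord[OF pd] by linarith
    qed
  qed
  ultimately show ?case by blast
qed

text \<open>The local-to-global principle. Applied to the ideal of those r that bring a given
  element into a ring, it turns membership near every point into membership.\<close>

lemma one_in_ideal:
  assumes "is_ideal R I" "\<And>P. P \<in> prime_divisors R \<Longrightarrow> \<exists>s\<in>I. s \<notin> P"
  shows "1 \<in> I"
proof -
  have "I = R" using proper_ideal_subset[OF assms(1)] assms(2) by blast
  then show ?thesis by simp
qed

text \<open>The sections of i D rounded down: orders are integers, so rounding does not affect the
  inequality, as \<open>sections_floor_div\<close> shows. Without the floor the condition is
  additive in i, which makes multiplication of sections immediate.\<close>

definition sec :: "('k set \<Rightarrow> rat) \<Rightarrow> int \<Rightarrow> 'k set" where
  "sec D i = {f \<in> frac_field R. f = 0 \<or>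
    (\<forall>P\<in>prime_divisors R. 0 \<le> of_int (order_at R P f) + of_int i * D P)}"

lemma secD:
  "f \<in> sec D i \<Longrightarrow> f \<in> frac_field R"
  "f \<in> sec D i \<Longrightarrow> f \<noteq> 0 \<Longrightarrow> P \<in> prime_divisors R \<Longrightarrow> 0 \<le> of_int (order_at R P f) + of_int i * D P"
  by (auto simp: sec_def)

lemma sections_floor_div:
  assumes "q_divisor R D"
  shows "sections R (floor_div (\<lambda>P. of_int i * D P)) = sec D i"
proof -
  have D0: "D P = 0" if "P \<notin> prime_divisors R" for P
    using assms that by (auto simp: q_divisor_def)
  have fl: "0 \<le> of_int a + (of_int \<lfloor>x\<rfloor> :: rat) \<longleftrightarrow> 0 \<le> of_int a + x" for a and x :: rat
  proof -
    have "0 \<le> of_int a + (of_int \<lfloor>x\<rfloor> :: rat) \<longleftrightarrow> - a \<le> \<lfloor>x\<rfloor>"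
      by (metis add.commute minus_le_iff of_int_0_le_iff of_int_add le_minus_iff diff_minus_eq_add diff_ge_0_iff_ge)
    then show ?thesis by (simp add: le_floor_iff add.commute) linarith
  qed
  have "0 \<le> div_of R f + floor_div (\<lambda>P. of_int i * D P) \<longleftrightarrow>
    (\<forall>P\<in>prime_divisors R. 0 \<le> of_int (order_at R P f) + of_int i * D P)" for f
    by (auto simp: le_fun_def div_of_def floor_div_def fl D0)
  then show ?thesis by (simp add: sections_def sec_def)
qed

lemma sec_scale:
  assumes "f \<in> sec D i" "r \<in> R"
  shows "r * f \<in> sec D i"
proof (cases "r = 0 \<or> f = 0")
  case True
  then show ?thesis using subset_frac_field[OF zero_mem] by (auto simp: sec_def)
next
  case False
  interpret F: subdom "frac_field R" by (rule frac_field_subdom)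
  have *: "f \<in> frac_field R" "r \<in> frac_field R" using assms secD subset_frac_field by auto
  have "0 \<le> of_int (order_at R P (r * f)) + of_int i * D P" if P: "P \<in> prime_divisors R" for P
    using secD(2)[OF assms(1) _ P] ord_nonneg[OF P assms(2)] False * P by (auto simp: ord_mult)
  then show ?thesis using * by (auto simp: sec_def)
qed

lemma sec_zero_mem: "0 \<in> sec D i"
  using subset_frac_field[OF zero_mem] by (auto simp: sec_def)

lemma sec_add:
  assumes "f \<in> sec D i" "g \<in> sec D i"
  shows "f + g \<in> sec D i"
proof (cases "f = 0 \<or> g = 0 \<or> f + g = 0")
  case True
  then show ?thesis using assms sec_zero_mem by auto
next
  case False
  interpret F: subdom "frac_field R" by (rule frac_field_subdom)
  have "0 \<le> of_int (order_at R P (f + g)) + of_int i * D P" if P: "P \<in> prime_divisors R" for P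
  proof -
    let ?m = "min (order_at R P f) (order_at R P g)"
    have "?m \<le> order_at R P (f + g)"
      by (rule ord_add[OF P]) (use False assms secD in auto)
    then have "of_int ?m \<le> (of_int (order_at R P (f + g)) :: rat)" by (simp only: of_int_le_iff)
    moreover have "0 \<le> of_int ?m + of_int i * D P"
      using secD(2)[OF assms(1) _ P] secD(2)[OF assms(2) _ P] False by (auto simp: min_def)
    ultimately show ?thesis by linarith
  qed
  then show ?thesis using F.add_mem[OF secD(1)[OF assms(1)] secD(1)[OF assms(2)]] by (simp add: sec_def)
qed

lemma sec_mult:
  assumes "f \<in> sec D i" "g \<in> sec D j"
  shows "f * g \<in> sec D (i + j)"
proof (cases "f = 0 \<or> g = 0")
  case True
  then show ?thesis using sec_zero_mem by auto
next
  case False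
  interpret F: subdom "frac_field R" by (rule frac_field_subdom)
  have "0 \<le> of_int (order_at R P (f * g)) + of_int (i + j) * D P" if P: "P \<in> prime_divisors R" for P
    using secD(2)[OF assms(1) _ P] secD(2)[OF assms(2) _ P] False secD(1)[OF assms(1)] secD(1)[OF assms(2)] P
    by (simp add: ord_mult algebra_simps)
  then show ?thesis using F.mult_mem[OF secD(1)[OF assms(1)] secD(1)[OF assms(2)]] by (simp add: sec_def)
qed

lemma sec_uminus: "f \<in> sec D i \<Longrightarrow> - f \<in> sec D i"
  using sec_scale[of f D i "- 1"] by simp

lemma sec_sum: "(\<And>x. x \<in> X \<Longrightarrow> f x \<in> sec D i) \<Longrightarrow> sum f X \<in> sec D i"
  by (induction X rule: infinite_finite_induct) (auto intro: sec_add sec_zero_mem)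

text \<open>R is the intersection of its local rings: the denominators of f form an ideal that no
  prime divisor contains.\<close>

lemma sec_0: "sec D 0 = R"
proof
  show "R \<subseteq> sec D 0" using ord_nonneg subset_frac_field by (auto simp: sec_def)
  show "sec D 0 \<subseteq> R"
  proof
    fix f assume f: "f \<in> sec D 0"
    have fK: "f \<in> frac_field R" using f secD by blast
    define I where "I = {r \<in> R. r * f \<in> R}"
    have "1 \<in> I"
    proof (rule one_in_ideal)
      show "is_ideal R I" by (auto simp: is_ideal_def I_def distrib_right mult.assoc)
      fix P assume P: "P \<in> prime_divisors R"
      interpret P: subdom_prime R P by unfold_locales (rule pd_prime[OF P])
      have "f \<in> local_ring R P"
      proof (cases "f = 0")
        case True
        then show ?thesis using P.subset_local_ring by simp
      next
        case False
        then show ?thesis using secD(2)[OF f _ P] ord_nonneg_iff[OF P fK] by simp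
      qed
      then obtain a b where ab: "a \<in> R" "b \<in> R - P" "f = a / b" "b \<noteq> 0" by (rule P.local_ringE)
      then show "\<exists>s\<in>I. s \<notin> P" by (intro bexI[of _ b]) (auto simp: I_def)
    qed
    then show "f \<in> R" by (simp add: I_def)
  qed
qed

text \<open>Away from p only finitely many points obstruct f from being a section, and
  \<open>approximation\<close> removes them with a factor that does not vanish at p. For p = {0} the
  condition at p is vacuous and the statement merely supplies a denominator.\<close>

lemma sec_clear:
  assumes D: "q_divisor R D" and p: "is_prime R p" and f: "f \<in> frac_field R"
    and fp: "f \<noteq> 0 \<Longrightarrow> p \<in> prime_divisors R \<Longrightarrow> 0 \<le> of_int (order_at R p f) + of_int i * D p"
  shows "\<exists>r\<in>R - p. r * f \<in> sec D i"
proof (cases "f = 0")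
  case True
  then show ?thesis using is_primeD(2)[OF p] sec_zero_mem by (intro bexI[of _ 1]) auto
next
  case False
  \<comment> \<open>Outside B and p both the order of f and the coefficient of D vanish, so it is
    enough there that r belongs to R.\<close>
  define B where "B = {Q \<in> prime_divisors R. order_at R Q f \<noteq> 0} \<union> {Q. D Q \<noteq> 0} - {p}"
  have Bpd: "B \<subseteq> prime_divisors R" using D by (auto simp: B_def q_divisor_def)
  have "finite B"
    using D finite_support[OF f False] by (auto simp: B_def q_divisor_def)
  then obtain r where r: "r \<in> R - p"
    "\<And>Q. Q \<in> B \<Longrightarrow> \<lceil>- of_int (order_at R Q f) - of_int i * D Q\<rceil> \<le> order_at R Q r"
    using approximation[OF _ Bpd p, of "\<lambda>Q. \<lceil>- of_int (order_at R Q f) - of_int i * D Q\<rceil>"]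
    by (auto simp: B_def)
  have rn: "r \<noteq> 0" using r(1) is_primeD(5)[OF p] by auto
  have rK: "r \<in> frac_field R" using r(1) subset_frac_field by blast
  interpret F: subdom "frac_field R" by (rule frac_field_subdom)
  have "0 \<le> of_int (order_at R Q (r * f)) + of_int i * D Q" if Q: "Q \<in> prime_divisors R" for Q
  proof -
    have o: "order_at R Q (r * f) = order_at R Q r + order_at R Q f"
      using Q rK rn f False by (simp add: ord_mult)
    have nn: "0 \<le> order_at R Q r" using ord_nonneg[OF Q] r(1) rn by blast
    consider "Q \<in> B" | "Q = p" | "order_at R Q f = 0" "D Q = 0"
      using Q by (auto simp: B_def)
    then show ?thesis
    proof cases
      case 1
      then show ?thesis using r(2)[OF 1] o by (simp add: ceiling_le_iff)
    next
      case 2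
      have "(0::rat) \<le> of_int (order_at R Q r)" using nn by simp
      moreover have "0 \<le> of_int (order_at R Q f) + of_int i * D Q" using fp[OF False] Q 2 by simp
      ultimately show ?thesis unfolding o of_int_add by linarith
    next
      case 3
      then show ?thesis using o nn by simp
    qed
  qed
  then have "r * f \<in> sec D i" using f rK by (auto simp: sec_def)
  then show ?thesis using r(1) by blast
qed

text \<open>Formulated for any family stable under R, so that it clears denominators both in spaces
  of sections and in the homogeneous pieces of A.\<close>

lemma common_multiplier:
  assumes p: "is_prime R p" and "finite F"
    and scale: "\<And>i r x. x \<in> T i \<Longrightarrow> r \<in> R \<Longrightarrow> r * x \<in> T i"
    and ex: "\<And>i. i \<in> F \<Longrightarrow> \<exists>r\<in>R - p. r * f i \<in> T i"
  shows "\<exists>r\<in>R - p. \<forall>i\<in>F. r * f i \<in> T i"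
  using assms(2) ex
proof (induction F)
  case empty
  then show ?case using is_primeD(2)[OF p] by blast
next
  case (insert j F)
  then obtain r s where rs: "r \<in> R - p" "\<forall>i\<in>F. r * f i \<in> T i" "s \<in> R - p" "s * f j \<in> T j"
    by (metis insertCI)
  interpret p: subdom_prime R p by unfold_locales fact
  have "r * s \<in> R - p" using p.mult_notin rs by blast
  moreover have "r * s * f i \<in> T i" if "i \<in> insert j F" for i
  proof (cases "i = j")
    case True
    then show ?thesis using scale[OF rs(4), of r] rs by (simp add: mult.assoc)
  next
    case False
    then show ?thesis using scale[of "r * f i" i s] rs that by (simp add: mult_ac)
  qed
  ultimately show ?case by blast
qed

text \<open>A power of a uniformizer attains the bound at P, and \<open>sec_clear\<close> makes it a
  section without changing its order there. This is what allows a divisor to be recovered from its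
  sections.\<close>

lemma sec_exact:
  assumes D: "q_divisor R D" and P: "P \<in> prime_divisors R"
  shows "\<exists>f\<in>sec D i. f \<noteq> 0 \<and> order_at R P f = - \<lfloor>of_int i * D P\<rfloor>"
proof -
  obtain t where t: "t \<in> frac_field R" "t \<noteq> 0" "order_at R P t = 1"
    using ex_uniformizer[OF P] by blast
  let ?f = "t powi (- \<lfloor>of_int i * D P\<rfloor>)"
  have f: "?f \<in> frac_field R" "?f \<noteq> 0" "order_at R P ?f = - \<lfloor>of_int i * D P\<rfloor>"
    using t P by (auto simp: frac_field_powi ord_powi)
  have "0 \<le> of_int (order_at R P ?f) + of_int i * D P"
    using f(3) of_int_floor_le[of "of_int i * D P"] by simp
  then obtain r where r: "r \<in> R - P" "r * ?f \<in> sec D i"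
    using sec_clear[OF D pd_prime[OF P] f(1), of i] by blast
  have "r \<noteq> 0" using r(1) is_primeD(5)[OF pd_prime[OF P]] by auto
  moreover have "order_at R P (r * ?f) = - \<lfloor>of_int i * D P\<rfloor>"
    using r(1) \<open>r \<noteq> 0\<close> f P ord_notin[OF P r(1)] by (simp add: ord_mult subset_frac_field)
  ultimately show ?thesis using r f(2) by (intro bexI[OF _ r(2)]) auto
qed

lemma pd_nonempty: "prime_divisors R \<noteq> {}"
proof -
  have "{0} \<noteq> R" using one_mem by (metis singletonD zero_neq_one)
  then show ?thesis using proper_ideal_subset[of "{0}"] prime_zero is_primeD(1) by blast
qed

lemma sec_nontrivial: "q_divisor R D \<Longrightarrow> \<exists>f\<in>sec D i. f \<noteq> 0"
  using pd_nonempty sec_exact by blast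

end

section \<open>The cone over a divisor\<close>

lemma poly_in_subdom:
  assumes "subdom T" "\<And>i. coeff p i * u ^ i \<in> T"
  shows "poly p u \<in> T"
proof -
  interpret T: subdom T by fact
  show ?thesis unfolding poly_altdef by (intro T.sum_mem assms)
qed

lemma poly_in_ideal:
  assumes "subdom T" "is_ideal T I" "\<And>i. coeff p i * u ^ i \<in> I"
  shows "poly p u \<in> I"
proof -
  interpret T: subdom T by fact
  have sum: "sum f F \<in> I" if "\<And>i. i \<in> F \<Longrightarrow> f i \<in> I" for F :: "nat set" and f
    using that by (induction F rule: infinite_finite_induct)
      (auto intro: T.is_idealD(2,3)[OF assms(2)])
  show ?thesis unfolding poly_altdef by (intro sum assms(3))
qed

lemma poly_factor_monom:
  fixes p :: "'k::field poly"
  assumes "p \<noteq> 0"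
  shows "\<exists>n q. p = Polynomial.monom 1 n * q \<and> coeff q 0 \<noteq> 0 \<and> (\<forall>i. coeff q i = coeff p (i + n))"
  using assms
proof (induction p rule: pCons_induct)
  case (pCons c p)
  show ?case
  proof (cases "c = 0")
    case True
    then obtain n q where q: "p = Polynomial.monom 1 n * q" "coeff q 0 \<noteq> 0" "\<forall>i. coeff q i = coeff p (i + n)"
      using pCons by auto
    then have "pCons c p = Polynomial.monom 1 (Suc n) * q"
      using True by (simp add: monom_Suc)
    moreover have "\<forall>i. coeff q i = coeff (pCons c p) (i + Suc n)" using q(3) by simp
    ultimately show ?thesis using q(2) by blast
  next
    case False
    then show ?thesis by (intro exI[of _ "0::nat"] exI[of _ "pCons c p"]) (auto simp: monom_0)
  qed
qed simp

text \<open>The divisor is arbitrary, so that one computation serves \<open>V\<^sub>+\<close> and,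
  after reversal of the grading, \<open>V\<^sub>-\<close>. Transcendence of u makes the coefficients
  of an element of the cone well defined.\<close>

locale cone = dedekind R for R :: "'k::field set" +
  fixes u :: 'k and D :: "'k set \<Rightarrow> rat"
  assumes D: "q_divisor R D"
    and transc: "\<And>p. p \<in> polys (frac_field R) \<Longrightarrow> poly p u = 0 \<Longrightarrow> p = 0"
begin

sublocale F: subdom "frac_field R"
  by (rule frac_field_subdom)

definition sec_polys :: "'k poly set" where
  "sec_polys = {p. \<forall>i. coeff p i \<in> sec D (int i)}"

definition S :: "'k set" where
  "S = (\<lambda>p. poly p u) ` sec_polys"

lemma poly_u_eq:
  "p \<in> polys (frac_field R) \<Longrightarrow> q \<in> polys (frac_field R) \<Longrightarrow> poly p u = poly q u \<Longrightarrow> p = q"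
  using transc[of "p - q"] F.polys_diff by simp

lemma u_nz: "u \<noteq> 0"
proof
  assume "u = 0"
  then have "[:0, 1:] = (0 :: 'k poly)"
    by (intro transc F.polys_pCons F.polys_0) auto
  then show False by simp
qed

lemma sec_polys_subset: "p \<in> sec_polys \<Longrightarrow> p \<in> polys (frac_field R)"
  using secD(1) by (auto simp: sec_polys_def polys_def)

lemma sec_polys_mult:
  assumes "p \<in> sec_polys" "q \<in> sec_polys"
  shows "p * q \<in> sec_polys"
proof -
  have "coeff p k * coeff q (n - k) \<in> sec D (int n)" if "k \<in> {..n}" for n k
  proof -
    have "coeff p k \<in> sec D (int k)" "coeff q (n - k) \<in> sec D (int (n - k))"
      using assms by (simp_all add: sec_polys_def del: of_nat_diff)
    moreover have "int k + int (n - k) = int n" using that by simp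
    ultimately show ?thesis using sec_mult by metis
  qed
  then show ?thesis by (auto simp: sec_polys_def coeff_mult intro!: sec_sum)
qed

lemma sec_polys_const: "r \<in> R \<Longrightarrow> [:r:] \<in> sec_polys"
  using sec_zero_mem by (auto simp: sec_polys_def coeff_pCons sec_0 split: nat.split)

lemma sec_polys_monom: "f \<in> sec D (int n) \<Longrightarrow> Polynomial.monom f n \<in> sec_polys"
  using sec_zero_mem by (auto simp: sec_polys_def)

lemma S_memI: "p \<in> sec_polys \<Longrightarrow> poly p u \<in> S"
  by (auto simp: S_def)

lemma R_subset_S: "r \<in> R \<Longrightarrow> r \<in> S"
  using S_memI[OF sec_polys_const] by simp

lemma monom_in_S: "f \<in> sec D (int n) \<Longrightarrow> f * u ^ n \<in> S"
  using S_memI[OF sec_polys_monom] by (simp add: poly_monom)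

sublocale S: subdom S
proof
  show "0 \<in> S" "1 \<in> S" using R_subset_S by auto
  fix f g assume "f \<in> S" "g \<in> S"
  then obtain p q where *: "f = poly p u" "g = poly q u" "p \<in> sec_polys" "q \<in> sec_polys"
    by (auto simp: S_def)
  have "p + q \<in> sec_polys" "- p \<in> sec_polys" "p * q \<in> sec_polys"
    using * sec_add sec_uminus sec_polys_mult by (auto simp: sec_polys_def)
  then show "f + g \<in> S" "f * g \<in> S" "- f \<in> S"
    using S_memI[of "p + q"] S_memI[of "- p"] S_memI[of "p * q"] *(1,2) by simp_all
qed

lemma clear_poly:
  assumes p: "is_prime R p" and q: "q \<in> polys (frac_field R)"
    and qp: "\<And>i. coeff q i \<noteq> 0 \<Longrightarrow> p \<in> prime_divisors R \<Longrightarrow>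
      0 \<le> of_int (order_at R p (coeff q i)) + of_int (int i) * D p"
  shows "\<exists>r\<in>R - p. smult r q \<in> sec_polys"
proof -
  have "\<exists>r\<in>R - p. \<forall>i\<in>{..degree q}. r * coeff q i \<in> sec D (int i)"
  proof (rule common_multiplier[OF p])
    fix i show "\<exists>r\<in>R - p. r * coeff q i \<in> sec D (int i)"
      by (rule sec_clear[OF D p]) (use q qp in \<open>auto simp: polys_def\<close>)
  qed (auto intro: sec_scale)
  then obtain r where r: "r \<in> R - p" "\<And>i. i \<le> degree q \<Longrightarrow> r * coeff q i \<in> sec D (int i)" by auto
  have "r * coeff q i \<in> sec D (int i)" for i
    using r(2)[of i] sec_zero_mem by (cases "i \<le> degree q") (auto simp: coeff_eq_0)
  then show ?thesis using r(1) by (auto simp: sec_polys_def)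
qed

lemma contract_prime:
  assumes "is_prime S Q"
  shows "is_prime R (Q \<inter> R)"
  unfolding is_prime_def is_ideal_def
  using S.is_primeD(2,3,5,6,7)[OF assms] R_subset_S by simp

section \<open>Prime divisors of the cone that dominate the curve\<close>

definition Splus :: "'k set" where
  "Splus = (\<lambda>p. poly p u) ` {p \<in> sec_polys. coeff p 0 = 0}"

lemma Splus_iff: "p \<in> sec_polys \<Longrightarrow> poly p u \<in> Splus \<longleftrightarrow> coeff p 0 = 0"
  using poly_u_eq sec_polys_subset by (auto simp: Splus_def)

lemma Splus_prime: "is_prime S Splus"
  unfolding is_prime_def is_ideal_def
proof (intro conjI ballI impI)
  show "Splus \<subseteq> S" by (auto simp: Splus_def S_def)
  show "0 \<in> Splus" "1 \<notin> Splus"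
    using Splus_iff[OF sec_polys_const, of 0] Splus_iff[OF sec_polys_const, of 1] by auto
next
  fix f g assume "f \<in> Splus" "g \<in> Splus"
  then obtain p q where *: "f = poly p u" "g = poly q u" "p \<in> sec_polys" "q \<in> sec_polys"
    "coeff p 0 = 0" "coeff q 0 = 0"
    by (auto simp: Splus_def)
  have "p + q \<in> sec_polys" using * sec_add by (auto simp: sec_polys_def)
  then show "f + g \<in> Splus" using Splus_iff[of "p + q"] * by simp
next
  fix f g assume "f \<in> S" "g \<in> Splus"
  then obtain p q where *: "f = poly p u" "g = poly q u" "p \<in> sec_polys" "q \<in> sec_polys" "coeff q 0 = 0"
    by (auto simp: Splus_def S_def)
  then show "f * g \<in> Splus" using Splus_iff[OF sec_polys_mult, of p q] by (simp add: coeff_mult)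
next
  fix f g assume "f \<in> S" "g \<in> S" "f * g \<in> Splus"
  then obtain p q where *: "f = poly p u" "g = poly q u" "p \<in> sec_polys" "q \<in> sec_polys"
    by (auto simp: S_def)
  then show "f \<in> Splus \<or> g \<in> Splus" 
    using Splus_iff[OF sec_polys_mult, of p q] Splus_iff \<open>f * g \<in> Splus\<close> by (simp add: coeff_mult)
qed

lemma Splus_Int: "Splus \<inter> R = {0}"
proof -
  have "r = 0" if "r \<in> R" "r \<in> Splus" for r
    using Splus_iff[OF sec_polys_const[OF that(1)]] that(2) by simp
  then show ?thesis using S.is_primeD(5)[OF Splus_prime] by auto
qed

text \<open>Non-zero functions on the curve are units at a prime that dominates it, so the local
  ring there contains all of K[u].\<close>

lemma local_ring_generic:
  assumes "is_prime S Q" "Q \<inter> R = {0}" "q \<in> polys (frac_field R)"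
  shows "poly q u \<in> local_ring S Q"
proof -
  interpret Q: subdom_prime S Q by unfold_locales fact
  have "\<exists>r\<in>R - {0}. smult r q \<in> sec_polys"
    by (rule clear_poly[OF prime_zero assms(3)]) (use pd_nonzero in auto)
  then obtain r where r: "r \<in> R" "r \<noteq> 0" "smult r q \<in> sec_polys" by auto
  have "r \<in> S - Q" using r assms(2) R_subset_S by auto
  then have "poly (smult r q) u / r \<in> local_ring S Q"
    using S_memI[OF r(3)] by (intro Q.local_ringI)
  then show ?thesis using r by simp
qed

text \<open>The polynomials over K = Frac R whose value vanishes at Q form an ideal of K[u]. One of
  least degree generates it by division with remainder, and its value at u is a uniformizer.\<close>

lemma uniformizer_generic:
  assumes Q: "is_prime S Q" "Q \<inter> R = {0}" "Q \<noteq> {0}"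
  shows "\<exists>g. uniformizer S Q g \<and> g \<noteq> 0"
proof -
  interpret Q: subdom_prime S Q by unfold_locales fact
  interpret L: subdom "local_ring S Q" by (rule Q.local_ring_subdom)
  define Z where "Z = {q \<in> polys (frac_field R). poly q u \<in> local_max S Q}"
  have Q_Z: "\<exists>q\<in>Z. x = poly q u" if x: "x \<in> Q" for x
  proof -
    obtain q where q: "q \<in> sec_polys" "x = poly q u"
      using Q.primeD(4)[OF x] by (auto simp: S_def)
    then show ?thesis using x Q.local_maxI[of x 1] sec_polys_subset by (auto simp: Z_def)
  qed
  obtain x where x: "x \<in> Q" "x \<noteq> 0" using Q(3) Q.zero_in by blast
  then have "\<exists>q. q \<in> Z \<and> q \<noteq> 0" using Q_Z[OF x(1)] by auto
  then obtain g where g: "g \<in> Z" "g \<noteq> 0" and min: "\<And>q. q \<in> Z \<Longrightarrow> q \<noteq> 0 \<Longrightarrow> degree g \<le> degree q"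
    using ex_has_least_nat[of "\<lambda>q. q \<in> Z \<and> q \<noteq> 0" _ degree] by blast
  have gK: "g \<in> polys (frac_field R)" and gmax: "poly g u \<in> local_max S Q" using g by (auto simp: Z_def)
  \<comment> \<open>Long division, by induction on a bound for the support instead of the degree, so
    that the zero polynomial is the base case. The point is that the quotient keeps its coefficients
    in the subfield \<open>frac_field R\<close>.\<close>
  have div: "\<exists>h\<in>polys (frac_field R). q = h * g" if "q \<in> Z" "\<forall>k\<ge>n. coeff q k = 0" for q n
    using that
  proof (induction n arbitrary: q)
    case 0
    then have "q = 0" by (intro poly_eqI) simp
    then show ?case using F.polys_0 by auto
  next
    case (Suc n)
    show ?case
    proof (cases "coeff q n = 0")
      case True
      then have "\<forall>k\<ge>n. coeff q k = 0" using Suc.prems(2) by (metis Suc_leI le_neq_implies_less)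
      then show ?thesis using Suc.IH Suc.prems(1) by blast
    next
      case False
      then have "q \<noteq> 0" by auto
      have "degree q \<le> n" using Suc.prems(2) by (intro degree_le) auto
      then have gn: "degree g \<le> n" using min[OF Suc.prems(1) \<open>q \<noteq> 0\<close>] by simp
      define c where "c = coeff q n / lead_coeff g"
      define m where "m = Polynomial.monom c (n - degree g)"
      have "c \<in> frac_field R"
        using Suc.prems(1) gK unfolding c_def Z_def polys_def by (intro frac_field_divide) auto
      then have mK: "m \<in> polys (frac_field R)" unfolding m_def by (rule F.polys_monom)
      have qK: "q \<in> polys (frac_field R)" "poly q u \<in> local_max S Q"
        using Suc.prems(1) by (auto simp: Z_def)
      have "poly m u * poly g u \<in> local_max S Q"
        using L.is_idealD(4)[OF Q.local_max_ideal local_ring_generic[OF Q(1,2) mK] gmax] .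
      then have "poly (q - m * g) u \<in> local_max S Q"
        using L.is_idealD(7)[OF Q.local_max_ideal qK(2)] by simp
      then have "q - m * g \<in> Z"
        using F.polys_diff[OF qK(1) F.polys_mult[OF mK gK]] by (simp add: Z_def)
      moreover have "coeff (q - m * g) k = 0" if "k \<ge> n" for k
      proof (cases "k = n")
        case True
        then show ?thesis using gn g(2) by (simp add: m_def coeff_monom_mult c_def)
      next
        case False
        then have "degree g < k - (n - degree g)" using that gn by linarith
        then show ?thesis using that False Suc.prems(2)
          by (simp add: m_def coeff_monom_mult coeff_eq_0)
      qed
      ultimately obtain h where "h \<in> polys (frac_field R)" "q - m * g = h * g"
        using Suc.IH by blast
      then have "h + m \<in> polys (frac_field R)" "q = (h + m) * g"
        using mK F.polys_add by (auto simp: algebra_simps)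
      then show ?thesis by blast
    qed
  qed
  have "uniformizer S Q (poly g u)"
  proof (rule Q.uniformizerI[OF gmax])
    fix x assume "x \<in> Q"
    then obtain q where q: "q \<in> Z" "x = poly q u" using Q_Z by blast
    then obtain h where "h \<in> polys (frac_field R)" "q = h * g"
      using div[of q "Suc (degree q)"] by (auto simp: coeff_eq_0)
    then show "\<exists>y\<in>local_ring S Q. x = y * poly g u"
      using q local_ring_generic[OF Q(1,2)] by auto
  qed
  moreover have "poly g u \<noteq> 0" using transc[OF gK] g(2) by blast
  ultimately show ?thesis by blast
qed

text \<open>Writing a polynomial as u^n q with q(0) non-zero isolates the order: after clearing
  denominators by a function on the curve, which is a unit here, q(u) does not vanish on the
  section.\<close>

lemma Splus_dvr: "dvr_at S Splus u"
proof -
  interpret Q: subdom_prime S Splus by unfold_locales (rule Splus_prime)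
  have u: "u \<in> local_max S Splus"
  proof -
    have "\<exists>r\<in>R - {0}. smult r [:0, 1:] \<in> sec_polys"
      by (rule clear_poly[OF prime_zero F.polys_pCons]) (use pd_nonzero F.polys_1 in \<open>auto simp: one_pCons\<close>)
    then obtain r where r: "r \<in> R" "r \<noteq> 0" "smult r [:0, 1:] \<in> sec_polys" by auto
    have "r \<in> S - Splus" using r Splus_Int R_subset_S by auto
    moreover have "poly (smult r [:0, 1:]) u \<in> Splus" using Splus_iff[OF r(3)] by simp
    ultimately have "poly (smult r [:0, 1:]) u / r \<in> local_max S Splus" by (rule Q.local_maxI[rotated])
    then show ?thesis using r by simp
  qed
  show ?thesis
  proof
    show "u \<noteq> 0" by (rule u_nz)
    show "uniformizer S Splus u"
    proof (rule Q.uniformizerI[OF u])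
      fix x assume "x \<in> Splus"
      then obtain p where p: "p \<in> sec_polys" "coeff p 0 = 0" "x = poly p u" by (auto simp: Splus_def)
      then obtain q where q: "p = pCons 0 q" by (metis coeff_pCons_0 pCons_cases)
      have "coeff p (Suc i) \<in> frac_field R" for i
        using sec_polys_subset[OF p(1)] by (simp add: polys_def)
      then have "q \<in> polys (frac_field R)" using q by (simp add: polys_def)
      then show "\<exists>y\<in>local_ring S Splus. x = y * u"
        using p q local_ring_generic[OF Splus_prime Splus_Int] by (intro bexI[of _ "poly q u"]) auto
    qed
    fix x assume "x \<in> S" "x \<noteq> 0"
    then obtain p where p: "p \<in> sec_polys" "x = poly p u" unfolding S_def by blast
    with \<open>x \<noteq> 0\<close> have "p \<noteq> 0" by auto
    obtain n q where q: "p = Polynomial.monom 1 n * q" "coeff q 0 \<noteq> 0" "\<forall>i. coeff q i = coeff p (i + n)"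
      using poly_factor_monom[OF \<open>p \<noteq> 0\<close>] by blast
    have qK: "q \<in> polys (frac_field R)" using q(3) sec_polys_subset[OF p(1)] by (auto simp: polys_def)
    have "\<exists>r\<in>R - {0}. smult r q \<in> sec_polys"
      by (rule clear_poly[OF prime_zero qK]) (use pd_nonzero in auto)
    then obtain r where r: "r \<in> R" "r \<noteq> 0" "smult r q \<in> sec_polys" by auto
    have "r \<in> S - Splus" using r Splus_Int R_subset_S by auto
    moreover have "poly (smult r q) u \<in> S - Splus" using Splus_iff[OF r(3)] S_memI[OF r(3)] q(2) r(2) by simp
    ultimately have "local_unit S Splus (poly (smult r q) u / r)" by (intro Q.local_unitI)
    then have "local_unit S Splus (poly q u)" using r(2) by simp
    moreover have "x = poly q u * u ^ n" using p q by (simp add: poly_monom)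
    ultimately show "\<exists>v n. local_unit S Splus v \<and> x = v * u ^ n" by blast
  qed
qed

text \<open>Two distinct primes of height one do not contain each other, so some term f u^i of
  positive degree is a unit at Q. Non-zero functions on the curve are units there as well, hence so
  is u. The local ring is not analysed further: a uniformizer is needed only to give the order a
  value.\<close>

lemma order_generic:
  assumes Q: "Q \<in> prime_divisors S" "Q \<inter> R = {0}" "Q \<noteq> Splus"
  shows "order_at S Q u = 0"
proof -
  have pr: "is_prime S Q" and Q0: "Q \<noteq> {0}" using Q S.prime_divisors_iff by auto
  interpret Q: subdom_prime S Q by unfold_locales fact
  obtain g where g: "uniformizer S Q g" "g \<noteq> 0"
    using uniformizer_generic[OF pr Q(2) Q0] by blast
  have Rin: "r = 0" if "r \<in> R" "r \<in> Q" for r using that Q(2) by auto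
  have "Splus \<in> prime_divisors S" using dvr_at.prime_divisor[OF Splus_dvr] .
  then have "\<not> Splus \<subseteq> Q"
    using Q S.prime_divisors_iff[of Splus] S.prime_divisors_iff[of Q] by blast
  then obtain p where p: "p \<in> sec_polys" "coeff p 0 = 0" "poly p u \<notin> Q" by (auto simp: Splus_def)
  \<comment> \<open>An ideal that contains every term of a polynomial contains its value, so some
    term remains outside Q.\<close>
  then obtain i where i: "coeff p i * u ^ i \<notin> Q"
    using poly_in_ideal[OF S.subdom_axioms Q.primeD(1)] by blast
  have f: "coeff p i \<in> sec D (int i)" using p by (auto simp: sec_polys_def)
  have "i \<noteq> 0" using i p(2) by (cases i) auto
  have "coeff p i \<in> frac_field R" using secD(1)[OF f] .
  then obtain a b where ab: "a \<in> R" "b \<in> R" "b \<noteq> 0" "coeff p i = a / b" by (rule frac_fieldE)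
  \<comment> \<open>The element u itself need not lie in the cone; a multiple r u by a function on
    the curve does.\<close>
  have "\<exists>r\<in>R - {0}. r * 1 \<in> sec D (int 1)"
    by (rule sec_clear[OF D prime_zero]) (use pd_nonzero in auto)
  then obtain r where r: "r \<in> R" "r \<noteq> 0" "r \<in> sec D 1" by auto
  have ru: "r * u \<in> S" using monom_in_S[of r 1] r by simp
  have "r * u \<notin> Q"
  proof
    assume "r * u \<in> Q"
    then have "(r * u) ^ (i - 1) * (r * u) \<in> Q" by (rule Q.primeD(7)[OF S.power_mem[OF ru]])
    then have "(r * u) ^ i \<in> Q" using \<open>i \<noteq> 0\<close> by (metis power_minus_mult neq0_conv)
    then have "a * (r * u) ^ i \<in> Q" using Q.primeD(7) R_subset_S ab(1) by blast
    moreover have "a * (r * u) ^ i = (b * r ^ i) * (coeff p i * u ^ i)"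
      using ab by (simp add: power_mult_distrib)
    ultimately have "(b * r ^ i) * (coeff p i * u ^ i) \<in> Q" by simp
    moreover have "b * r ^ i \<in> R" "b * r ^ i \<noteq> 0" using ab r by auto
    ultimately show False
      using Q.primeD(3)[of "b * r ^ i" "coeff p i * u ^ i"] i R_subset_S Rin monom_in_S[OF f] by blast
  qed
  then have "local_unit S Q (r * u / r)"
    using ru r Rin R_subset_S by (intro Q.local_unitI) auto
  then have "local_unit S Q u" using r(2) by simp
  then show ?thesis by (rule Q.order_at_eqI[OF g]) simp
qed

end

section \<open>Prime divisors of the cone over a point\<close>

text \<open>That e and d are coprime is recorded by a Bezout identity, because its coefficients give
  the exponents of the uniformizer \<open>t powi a * u ^ b\<close>. The type of b makes the degree
  of this monomial non-negative.\<close>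

locale cone_at = cone R u D for R :: "'k::field set" and u D +
  fixes P :: "'k set" and t :: 'k and a e :: int and b d :: nat
  assumes P: "P \<in> prime_divisors R" and t: "uniformizer R P t"
    and d: "0 < d" and DP: "D P = of_int e / of_nat d" and bezout: "a * int d + int b * e = 1"
begin

lemma t_props: "t \<in> frac_field R" "t \<noteq> 0" "order_at R P t = 1"
  using uniformizer_ord[OF P t] by auto

text \<open>\<open>wt f i\<close> is \<open>d\<close> times \<open>ord\<^sub>P f + i D(P)\<close>, hence an integer.\<close>

definition wt :: "'k \<Rightarrow> nat \<Rightarrow> int" where
  "wt f i = int d * order_at R P f + int i * e"

text \<open>Zero is given infinite weight, so the order of 0 is never consulted.\<close>

definition wt_ge :: "int \<Rightarrow> nat \<Rightarrow> 'k set" where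
  "wt_ge m i = {f \<in> frac_field R. f = 0 \<or> m \<le> wt f i}"

lemma wt_nonneg_iff: "0 \<le> of_int (order_at R P f) + of_int (int i) * D P \<longleftrightarrow> 0 \<le> wt f i"
proof -
  have "of_nat d * (of_int (order_at R P f) + of_int (int i) * D P) = (of_int (wt f i) :: rat)"
    using d by (simp add: wt_def DP field_simps)
  moreover have "0 \<le> of_nat d * x \<longleftrightarrow> 0 \<le> x" for x :: rat
    using d by (simp add: zero_le_mult_iff)
  ultimately show ?thesis by (metis of_int_0_le_iff)
qed

lemma sec_wt_ge: "f \<in> sec D (int i) \<Longrightarrow> f \<in> wt_ge 0 i"
  using secD(1)[of f D "int i"] secD(2)[of f D "int i" P] P wt_nonneg_iff by (auto simp: wt_ge_def)

lemma wt_mult: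
  "f \<in> frac_field R \<Longrightarrow> f \<noteq> 0 \<Longrightarrow> g \<in> frac_field R \<Longrightarrow> g \<noteq> 0 \<Longrightarrow> wt (f * g) (i + j) = wt f i + wt g j"
  using P by (simp add: wt_def ord_mult algebra_simps)

lemma wt_ge_zero: "0 \<in> wt_ge m i"
  by (simp add: wt_ge_def)

lemma wt_ge_add:
  assumes "f \<in> wt_ge m i" "g \<in> wt_ge m i"
  shows "f + g \<in> wt_ge m i"
proof (cases "f = 0 \<or> g = 0 \<or> f + g = 0")
  case True
  then show ?thesis using assms wt_ge_zero by auto
next
  case False
  let ?m = "min (order_at R P f) (order_at R P g)"
  have "?m \<le> order_at R P (f + g)"
    by (rule ord_add[OF P]) (use False assms in \<open>auto simp: wt_ge_def\<close>)
  then have "int d * ?m \<le> int d * order_at R P (f + g)" by (intro mult_left_mono) auto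
  moreover have "m \<le> int d * ?m + int i * e"
    using assms False by (auto simp: wt_ge_def wt_def min_def)
  ultimately show ?thesis using assms by (auto simp: wt_ge_def wt_def)
qed

lemma wt_ge_mult:
  assumes "f \<in> wt_ge m i" "g \<in> wt_ge n j"
  shows "f * g \<in> wt_ge (m + n) (i + j)"
  using assms wt_mult[of f g i j] by (cases "f = 0 \<or> g = 0") (auto simp: wt_ge_def)

lemma wt_ge_uminus:
  assumes "f \<in> wt_ge m i"
  shows "- f \<in> wt_ge m i"
proof -
  have "0 \<le> order_at R P (- 1)" "0 \<le> 2 * order_at R P (- 1)" "order_at R P ((- 1) * (- 1)) = 2 * order_at R P (- 1)"
    using ord_nonneg[OF P, of "- 1"] ord_mult[OF P, of "- 1" "- 1"] by auto
  then have "order_at R P (- 1) = 0" using ord_one[OF P] by simp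
  then have "- 1 \<in> wt_ge 0 0" by (auto simp: wt_ge_def wt_def)
  then show ?thesis using wt_ge_mult[OF _ assms, of "- 1" 0 0] by simp
qed

lemma wt_ge_sum: "(\<And>x. x \<in> X \<Longrightarrow> f x \<in> wt_ge m i) \<Longrightarrow> sum f X \<in> wt_ge m i"
  by (induction X rule: infinite_finite_induct) (auto intro: wt_ge_add wt_ge_zero)

text \<open>The centre on the cone of the monomial valuation that takes the value
  \<open>wt f i\<close> on f u^i.\<close>

definition QP :: "'k set" where
  "QP = (\<lambda>p. poly p u) ` {p \<in> sec_polys. \<forall>i. coeff p i \<in> wt_ge 1 i}"

lemma QP_iff: "p \<in> sec_polys \<Longrightarrow> poly p u \<in> QP \<longleftrightarrow> (\<forall>i. coeff p i \<in> wt_ge 1 i)"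
  using poly_u_eq sec_polys_subset by (auto simp: QP_def)

lemma sec_polys_wt: "p \<in> sec_polys \<Longrightarrow> coeff p i \<in> wt_ge 0 i"
  by (rule sec_wt_ge) (auto simp: sec_polys_def)

text \<open>Gauss's lemma for weights. Take the lowest degrees i and j in which p and q have a term
  of weight 0; every other product contributing to degree i + j has positive weight, so p q has a
  term of weight 0 there.\<close>

lemma QP_mult:
  assumes "p \<in> sec_polys" "q \<in> sec_polys" "\<not> (\<forall>i. coeff p i \<in> wt_ge 1 i)" "\<not> (\<forall>i. coeff q i \<in> wt_ge 1 i)"
  shows "\<not> (\<forall>i. coeff (p * q) i \<in> wt_ge 1 i)"
proof
  assume pq: "\<forall>i. coeff (p * q) i \<in> wt_ge 1 i"
  define i where "i = (LEAST i. coeff p i \<notin> wt_ge 1 i)"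
  define j where "j = (LEAST j. coeff q j \<notin> wt_ge 1 j)"
  have i: "coeff p i \<notin> wt_ge 1 i" using assms(3) unfolding i_def by (metis (mono_tags, lifting) LeastI)
  have i_min: "coeff p k \<in> wt_ge 1 k" if "k < i" for k using not_less_Least that unfolding i_def by blast
  have j: "coeff q j \<notin> wt_ge 1 j" using assms(4) unfolding j_def by (metis (mono_tags, lifting) LeastI)
  have j_min: "coeff q k \<in> wt_ge 1 k" if "k < j" for k using not_less_Least that unfolding j_def by blast
  have p0: "coeff p k \<in> wt_ge 0 k" and q0: "coeff q k \<in> wt_ge 0 k" for k
    using assms sec_polys_wt by auto
  have "coeff p k * coeff q (i + j - k) \<in> wt_ge 1 (i + j)" if k: "k \<in> {..i + j} - {i}" for k
  proof (cases "k < i")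
    case True
    then show ?thesis
      using wt_ge_mult[OF i_min[OF True] q0[of "i + j - k"]] k by simp
  next
    case False
    then have "i + j - k < j" using k by auto
    then show ?thesis
      using wt_ge_mult[OF p0[of k] j_min[of "i + j - k"]] k by simp
  qed
  then have "(\<Sum>k\<in>{..i + j} - {i}. coeff p k * coeff q (i + j - k)) \<in> wt_ge 1 (i + j)"
    by (rule wt_ge_sum)
  then have "coeff (p * q) (i + j) + - (\<Sum>k\<in>{..i + j} - {i}. coeff p k * coeff q (i + j - k)) \<in> wt_ge 1 (i + j)"
    by (intro wt_ge_add wt_ge_uminus pq[rule_format])
  moreover have "coeff (p * q) (i + j) = coeff p i * coeff q j +
      (\<Sum>k\<in>{..i + j} - {i}. coeff p k * coeff q (i + j - k))"
    unfolding coeff_mult by (subst sum.remove[of _ i]) auto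
  ultimately have "coeff p i * coeff q j \<in> wt_ge 1 (i + j)" by simp
  moreover have nz: "coeff p i \<noteq> 0" "coeff q j \<noteq> 0" using i j wt_ge_zero by metis+
  moreover have "wt (coeff p i) i \<le> 0" "wt (coeff q j) j \<le> 0"
    using i j p0[of i] q0[of j] by (auto simp: wt_ge_def)
  ultimately show False
    using wt_mult[of "coeff p i" "coeff q j" i j] p0[of i] q0[of j] by (auto simp: wt_ge_def)
qed

lemma QP_Int: "QP \<inter> R = P"
proof -
  have "r \<in> QP \<longleftrightarrow> r \<in> P" if r: "r \<in> R" for r
  proof -
    have "r \<in> QP \<longleftrightarrow> r \<in> wt_ge 1 0"
      using QP_iff[OF sec_polys_const[OF r]] wt_ge_zero by (auto simp: coeff_pCons split: nat.splits)
    also have "\<dots> \<longleftrightarrow> r \<in> P"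
    proof (cases "r = 0")
      case True
      then show ?thesis using wt_ge_zero is_primeD(5)[OF pd_prime[OF P]] by simp
    next
      case False
      have "1 \<le> int d * order_at R P r \<longleftrightarrow> 0 < order_at R P r"
        using d by (metis int_one_le_iff_zero_less of_nat_0_less_iff zero_less_mult_pos zero_less_mult_iff)
      then show ?thesis using ord_pos_iff[OF P r False] False subset_frac_field[OF r]
        by (simp add: wt_ge_def wt_def)
    qed
    finally show ?thesis .
  qed
  then show ?thesis using is_primeD(4)[OF pd_prime[OF P]] by blast
qed

lemma QP_prime: "is_prime S QP"
  unfolding is_prime_def is_ideal_def
proof (intro conjI ballI impI)
  show "QP \<subseteq> S" by (auto simp: QP_def S_def)
  show "0 \<in> QP" "1 \<notin> QP"
    using QP_Int is_primeD(2,5)[OF pd_prime[OF P]] one_mem zero_mem by blast+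
next
  fix f g assume "f \<in> QP" "g \<in> QP"
  then obtain p q where *: "f = poly p u" "g = poly q u" "p \<in> sec_polys" "q \<in> sec_polys"
    "\<forall>i. coeff p i \<in> wt_ge 1 i" "\<forall>i. coeff q i \<in> wt_ge 1 i"
    by (auto simp: QP_def)
  have "p + q \<in> sec_polys" using * sec_add by (auto simp: sec_polys_def)
  then show "f + g \<in> QP" using QP_iff[of "p + q"] * wt_ge_add by simp
next
  fix f g assume "f \<in> S" "g \<in> QP"
  then obtain p q where *: "f = poly p u" "g = poly q u" "p \<in> sec_polys" "q \<in> sec_polys"
    "\<forall>i. coeff q i \<in> wt_ge 1 i"
    by (auto simp: QP_def S_def)
  have "coeff (p * q) n \<in> wt_ge 1 n" for n
    unfolding coeff_mult
  proof (rule wt_ge_sum)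
    fix k assume "k \<in> {..n}"
    then show "coeff p k * coeff q (n - k) \<in> wt_ge 1 n"
      using wt_ge_mult[OF sec_polys_wt[OF *(3), of k] *(5)[rule_format, of "n - k"]] by simp
  qed
  then show "f * g \<in> QP" using QP_iff[OF sec_polys_mult, of p q] * by simp
next
  fix f g assume "f \<in> S" "g \<in> S" "f * g \<in> QP"
  then obtain p q where *: "f = poly p u" "g = poly q u" "p \<in> sec_polys" "q \<in> sec_polys"
    by (auto simp: S_def)
  then have "poly (p * q) u \<in> QP" using \<open>f * g \<in> QP\<close> by simp
  then show "f \<in> QP \<or> g \<in> QP"
    using QP_iff[OF sec_polys_mult, of p q] QP_iff[of p] QP_iff[of q] * QP_mult[of p q] by blast
qed

sublocale Q: subdom_prime S QP
  by unfold_locales (rule QP_prime)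

lemma R_notin_QP: "r \<in> R - P \<Longrightarrow> r \<in> S - QP"
  using QP_Int R_subset_S by blast

text \<open>A function outside P has order 0 at P and is a unit at \<open>QP\<close>, so clearing
  denominators with it alters neither the weights nor the local question.\<close>

lemma clear_wt:
  assumes q: "q \<in> polys (frac_field R)" and "\<And>i. coeff q i \<in> wt_ge 0 i"
  obtains r where "r \<in> R - P" "smult r q \<in> sec_polys"
    "\<And>m i. coeff (smult r q) i \<in> wt_ge m i \<longleftrightarrow> coeff q i \<in> wt_ge m i"
proof -
  have "\<exists>r\<in>R - P. smult r q \<in> sec_polys"
    by (rule clear_poly[OF pd_prime[OF P] q])
      (use assms(2) in \<open>auto simp: wt_ge_def wt_nonneg_iff simp flip: wt_nonneg_iff\<close>)
  then obtain r where r: "r \<in> R - P" "smult r q \<in> sec_polys" by blast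
  have "r \<noteq> 0" using r(1) is_primeD(5)[OF pd_prime[OF P]] by auto
  have "coeff (smult r q) i \<in> wt_ge m i \<longleftrightarrow> coeff q i \<in> wt_ge m i" for m i
  proof (cases "coeff q i = 0")
    case False
    have K: "coeff q i \<in> frac_field R" "r \<in> frac_field R" "r * coeff q i \<in> frac_field R"
      using q r(1) subset_frac_field by (auto simp: polys_def)
    have "wt (r * coeff q i) i = wt (coeff q i) i"
      using wt_mult[of r "coeff q i" 0 i] K False \<open>r \<noteq> 0\<close> ord_notin[OF P r(1)] by (simp add: wt_def)
    then show ?thesis using K False \<open>r \<noteq> 0\<close> by (simp add: wt_ge_def)
  qed simp
  with r show thesis by (rule that)
qed

lemma local_unit_poly:
  assumes q: "q \<in> polys (frac_field R)" "\<And>i. coeff q i \<in> wt_ge 0 i" "coeff q j \<notin> wt_ge 1 j"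
  shows "local_unit S QP (poly q u)"
proof -
  obtain r where r: "r \<in> R - P" "smult r q \<in> sec_polys"
    "\<And>m i. coeff (smult r q) i \<in> wt_ge m i \<longleftrightarrow> coeff q i \<in> wt_ge m i"
    using clear_wt[OF q(1,2)] by metis
  have "poly (smult r q) u \<in> S - QP"
    using QP_iff[OF r(2)] S_memI[OF r(2)] r(3) q(3) by blast
  then have "local_unit S QP (poly (smult r q) u / r)"
    using R_notin_QP[OF r(1)] by (intro Q.local_unitI)
  moreover have "r \<noteq> 0" using r(1) is_primeD(5)[OF pd_prime[OF P]] by auto
  ultimately show ?thesis by simp
qed

text \<open>\<open>eps\<close> has weight 0 and positive degree: multiplying by its powers makes degrees
  non-negative without changing weights.\<close>

definition eps :: 'k where "eps = t powi (- e) * u ^ d"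

definition unif_QP :: 'k where "unif_QP = t powi a * u ^ b"

lemma eps_unit: "local_unit S QP eps"
proof -
  have f: "t powi (- e) \<in> frac_field R" "t powi (- e) \<noteq> 0" "wt (t powi (- e)) d = 0"
    using t_props P by (auto simp: frac_field_powi wt_def ord_powi)
  have "local_unit S QP (poly (Polynomial.monom (t powi (- e)) d) u)"
    by (rule local_unit_poly[where j = d]) (use f in \<open>auto simp: wt_ge_def intro: F.polys_monom\<close>)
  then show ?thesis by (simp add: eps_def poly_monom)
qed

lemma unif_QP_nz: "unif_QP \<noteq> 0"
  using t_props u_nz by (simp add: unif_QP_def)

lemma unif_QP_local_max: "unif_QP \<in> local_max S QP"
proof -
  have f: "t powi a \<in> frac_field R" "t powi a \<noteq> 0" "wt (t powi a) b = 1"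
    using t_props P bezout by (auto simp: frac_field_powi wt_def ord_powi mult.commute)
  let ?q = "Polynomial.monom (t powi a) b"
  have "?q \<in> polys (frac_field R)" "\<And>i. coeff ?q i \<in> wt_ge 0 i"
    using f by (auto simp: wt_ge_def intro: F.polys_monom)
  then obtain r where r: "r \<in> R - P" "smult r ?q \<in> sec_polys"
    "\<And>m i. coeff (smult r ?q) i \<in> wt_ge m i \<longleftrightarrow> coeff ?q i \<in> wt_ge m i"
    using clear_wt[of ?q] by metis
  have "coeff ?q i \<in> wt_ge 1 i" for i using f by (auto simp: wt_ge_def)
  then have "poly (smult r ?q) u \<in> QP" using QP_iff[OF r(2)] r(3) by blast
  then have "poly (smult r ?q) u / r \<in> local_max S QP"
    using R_notin_QP[OF r(1)] by (rule Q.local_maxI)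
  moreover have "r \<noteq> 0" using r(1) is_primeD(5)[OF pd_prime[OF P]] by auto
  ultimately show ?thesis by (simp add: poly_monom unif_QP_def)
qed

text \<open>The exponent vectors (-e, d) and (a, b) have determinant -(a d + b e) = -1, so
  \<open>eps\<close> and \<open>unif_QP\<close> form a basis of the group of monomials in t and u:
  one unit and one element of weight 1.\<close>

lemma eps_unif_QP_powi:
  "eps powi k * unif_QP powi l = t powi (a * l - e * k) * u powi (int d * k + int b * l)"
proof -
  have "eps powi k = t powi (- e * k) * u powi (int d * k)"
    by (simp only: eps_def power_int_mult_distrib power_int_mult power_int_of_nat)
  moreover have "unif_QP powi l = t powi (a * l) * u powi (int b * l)"
    by (simp only: unif_QP_def power_int_mult_distrib power_int_mult power_int_of_nat)
  moreover have "t powi (a * l - e * k) = t powi (- e * k) * t powi (a * l)"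
    using t_props(2) power_int_add[of t "- e * k" "a * l"] by simp
  moreover have "u powi (int d * k + int b * l) = u powi (int d * k) * u powi (int b * l)"
    using u_nz by (simp add: power_int_add)
  ultimately show ?thesis by (simp only: mult_ac)
qed

text \<open>The exponent m is the least weight of a term of q. Multiplying by a monomial of weight
  -m produces a polynomial of least weight 0, whose value is a unit at \<open>QP\<close>.\<close>

lemma QP_factor:
  assumes q: "q \<in> sec_polys" "q \<noteq> 0"
  obtains m v where "local_unit S QP v" "poly q u = v * unif_QP ^ m" "\<And>i. coeff q i \<in> wt_ge (int m) i"
    "m = 0 \<Longrightarrow> poly q u \<notin> QP"
proof -
  have qK: "coeff q i \<in> frac_field R" for i using sec_polys_subset[OF q(1)] by (simp add: polys_def)
  define I where "I = {i. coeff q i \<noteq> 0}"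
  have "finite I" unfolding I_def using MOST_coeff_eq_0[of q] by (simp add: eventually_cofinite)
  moreover have "I \<noteq> {}" using q(2) by (auto simp: I_def poly_eq_iff)
  ultimately obtain j where j: "j \<in> I" "\<And>i. i \<in> I \<Longrightarrow> wt (coeff q j) j \<le> wt (coeff q i) i"
    using ex_min_if_finite[of "(\<lambda>i. wt (coeff q i) i) ` I"] by (force simp: not_less)
  define m where "m = nat (wt (coeff q j) j)"
  have m: "int m = wt (coeff q j) j"
    using j(1) sec_polys_wt[OF q(1), of j] by (auto simp: m_def I_def wt_ge_def)
  have ge: "coeff q i \<in> wt_ge (int m) i" for i
    using j(2)[of i] qK m by (auto simp: wt_ge_def I_def)
  \<comment> \<open>The monomial of weight -m is \<open>eps ^ k\<close> divided by
    \<open>unif_QP ^ m\<close>, in which u has exponent d k - b m. With k = b m this exponent is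
    non-negative, so the product remains a polynomial in u.\<close>
  define k where "k = b * m"
  define s where "s = d * k - b * m"
  have "b * m \<le> d * k" using d by (simp add: k_def)
  then have s: "int s = int d * int k - int b * int m" unfolding s_def by (simp add: of_nat_diff)
  define c where "c = t powi (- a * int m - e * int k)"
  have c: "c \<in> frac_field R" "c \<noteq> 0" "order_at R P c = - a * int m - e * int k"
    using t_props P by (auto simp: c_def frac_field_powi ord_powi)
  have "wt c s = - int m * (a * int d + int b * e)"
    unfolding wt_def c(3) s by (simp add: algebra_simps)
  then have wc: "wt c s = - int m" using bezout by simp
  define q' where "q' = smult c (Polynomial.monom 1 s * q)"
  have cq': "coeff q' i = (if i < s then 0 else c * coeff q (i - s))" for i
    by (simp add: q'_def coeff_monom_mult)
  have cge: "c \<in> wt_ge (- int m) s" using c wc by (simp add: wt_ge_def)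
  have q'ge: "coeff q' i \<in> wt_ge 0 i" for i
    using wt_ge_mult[OF cge ge[of "i - s"]] wt_ge_zero by (auto simp: cq')
  have "wt (c * coeff q j) (s + j) = 0"
    using wt_mult[of c "coeff q j" s j] c qK j(1) wc m by (simp add: I_def)
  then have "coeff q' (s + j) \<notin> wt_ge 1 (s + j)"
    using c j(1) by (simp add: cq' wt_ge_def I_def)
  moreover have "q' \<in> polys (frac_field R)"
    using c qK by (auto simp: polys_def cq')
  ultimately have unit: "local_unit S QP (poly q' u)" using q'ge by (intro local_unit_poly)
  have "c * u ^ s = eps powi int k * unif_QP powi (- int m)"
    unfolding eps_unif_QP_powi c_def by (simp flip: power_int_of_nat add: s)
  then have "c * u ^ s * unif_QP ^ m = eps ^ k"
    using unif_QP_nz by (simp add: power_int_minus field_simps)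
  moreover have "poly q' u = c * u ^ s * poly q u" by (simp add: q'_def poly_monom)
  ultimately have "poly q' u * unif_QP ^ m = eps ^ k * poly q u"
    by (metis mult.assoc mult.commute)
  then have "poly q u = poly q' u / eps ^ k * unif_QP ^ m"
    using Q.local_unit_nonzero[OF eps_unit] by (simp add: field_simps)
  moreover have "local_unit S QP (poly q' u / eps ^ k)"
    using unit eps_unit by (intro Q.local_unit_divide Q.local_unit_power)
  moreover have "poly q u \<notin> QP" if "m = 0"
  proof -
    have "coeff q j \<notin> wt_ge 1 j" using j(1) m that by (auto simp: wt_ge_def I_def)
    then show ?thesis using QP_iff[OF q(1)] by blast
  qed
  ultimately show thesis using that ge by blast
qed

lemma QP_dvr: "dvr_at S QP unif_QP"
proof
  interpret L: subdom "local_ring S QP" by (rule Q.local_ring_subdom)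
  show "unif_QP \<noteq> 0" by (rule unif_QP_nz)
  show "uniformizer S QP unif_QP"
  proof (rule Q.uniformizerI[OF unif_QP_local_max])
    fix x assume x: "x \<in> QP" "x \<noteq> 0"
    then obtain q where q: "q \<in> sec_polys" "x = poly q u" unfolding QP_def by blast
    then have "q \<noteq> 0" using x by auto
    obtain m v where mv: "local_unit S QP v" "poly q u = v * unif_QP ^ m" "m = 0 \<Longrightarrow> poly q u \<notin> QP"
      using QP_factor[OF q(1) \<open>q \<noteq> 0\<close>] by metis
    then obtain n where "m = Suc n" using x q by (cases m) auto
    then have "x = (v * unif_QP ^ n) * unif_QP" using mv q by simp
    moreover have "v * unif_QP ^ n \<in> local_ring S QP"
      using Q.local_unit_mem[OF mv(1)] unif_QP_local_max Q.local_max_subset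
      by (intro L.mult_mem L.power_mem) auto
    ultimately show "\<exists>y\<in>local_ring S QP. x = y * unif_QP" by blast
  qed
  fix x assume x: "x \<in> S" "x \<noteq> 0"
  then obtain q where q: "q \<in> sec_polys" "x = poly q u" unfolding S_def by blast
  then have "q \<noteq> 0" using x by auto
  then show "\<exists>v n. local_unit S QP v \<and> x = v * unif_QP ^ n"
    using QP_factor[OF q(1)] q(2) by metis
qed

sublocale Q: dvr_at S QP unif_QP
  by (rule QP_dvr)

text \<open>Inverting the unimodular matrix behind \<open>eps_unif_QP_powi\<close> expresses t as
  \<open>eps\<close> to the -b times \<open>unif_QP\<close> to the d. As \<open>eps\<close> is a
  unit, d is the order; the same inversion gives \<open>order_u\<close>.\<close>

lemma order_t: "order_at S QP t = int d"
proof (rule Q.order_atI)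
  show "local_unit S QP (eps powi (- int b))" using eps_unit by (rule Q.local_unit_powi)
  have "a * int d - e * (- int b) = 1" using bezout by (simp add: mult.commute)
  then show "t = eps powi (- int b) * unif_QP powi int d"
    unfolding eps_unif_QP_powi by (simp add: mult.commute)
qed

lemma order_u: "order_at S QP u = e"
proof (rule Q.order_atI)
  show "local_unit S QP (eps powi a)" using eps_unit by (rule Q.local_unit_powi)
  have "int d * a + int b * e = 1" using bezout by (simp add: mult.commute)
  then show "u = eps powi a * unif_QP powi e"
    unfolding eps_unif_QP_powi by (simp add: mult.commute)
qed

text \<open>Let c in P have order 1. If f u^i has weight at least 1, its d-th power is divisible by
  c up to a function outside P, hence lies in Q, and so does f u^i. Thus \<open>QP\<close> is
  contained in Q, and both have height one.\<close>

lemma QP_unique: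
  assumes Q: "Q \<in> prime_divisors S" "Q \<inter> R = P"
  shows "Q = QP"
proof -
  have pr: "is_prime S Q" using Q S.prime_divisors_iff by blast
  interpret Q': subdom_prime S Q by unfold_locales fact
  interpret RP: subdom_prime R P by unfold_locales (rule pd_prime[OF P])
  have "t \<in> local_max R P" using t by (simp add: RP.uniformizer_iff)
  then obtain c s where cs: "t = c / s" "c \<in> P" "s \<in> R - P" by (rule RP.local_maxE)
  have c0: "c \<noteq> 0" and s0: "s \<noteq> 0" using cs t_props(2) by auto
  have cK: "c \<in> frac_field R" "s \<in> frac_field R"
    using cs(2,3) RP.primeD(4) subset_frac_field by auto
  have oc: "order_at R P c = 1"
    using t_props(3) ord_divide[OF P cK(1) c0 cK(2) s0] ord_notin[OF P cs(3)] cs(1) by simp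
  have key: "f * u ^ i \<in> Q" if f: "f \<in> sec D (int i)" "f \<in> wt_ge 1 i" for f i
  proof (cases "f = 0")
    case False
    have fK: "f \<in> frac_field R" using secD(1)[OF f(1)] .
    have gK: "f ^ d / c \<in> frac_field R" using fK cK(1) by (intro frac_field_divide) auto
    \<comment> \<open>Division by c costs weight d, exactly what the d-th power of an element of
      weight at least 1 can afford.\<close>
    have "wt (f ^ d / c) (i * d) = int d * (wt f i - 1)"
      using fK cK False c0 oc P by (simp add: wt_def ord_divide ord_power algebra_simps)
    moreover have "0 \<le> int d * (wt f i - 1)" using f(2) False by (simp add: wt_ge_def)
    ultimately have "\<exists>r\<in>R - P. r * (f ^ d / c) \<in> sec D (int (i * d))"
      by (intro sec_clear[OF D pd_prime[OF P] gK]) (simp add: wt_nonneg_iff del: of_nat_mult of_int_of_nat_eq)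
    then obtain r where r: "r \<in> R - P" "r * (f ^ d / c) \<in> sec D (int (i * d))" by blast
    have "c \<in> Q" using cs(2) Q(2) by blast
    then have "(r * (f ^ d / c) * u ^ (i * d)) * c \<in> Q"
      by (rule Q'.primeD(7)[OF monom_in_S[OF r(2)]])
    moreover have "(r * (f ^ d / c) * u ^ (i * d)) * c = r * (f * u ^ i) ^ d"
      using c0 by (simp add: power_mult_distrib power_mult)
    ultimately have "r * (f * u ^ i) ^ d \<in> Q" by simp
    moreover have "r \<in> S" "r \<notin> Q" using r(1) Q(2) R_subset_S by auto
    moreover have fS: "f * u ^ i \<in> S" by (rule monom_in_S[OF f(1)])
    ultimately have "(f * u ^ i) ^ d \<in> Q" using Q'.primeD(3)[of r] S.power_mem by blast
    then show ?thesis by (rule S.prime_power[OF pr fS])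
  qed simp
  have "QP \<subseteq> Q"
  proof
    fix x assume "x \<in> QP"
    then obtain p where p: "p \<in> sec_polys" "\<forall>i. coeff p i \<in> wt_ge 1 i" "x = poly p u"
      by (auto simp: QP_def)
    show "x \<in> Q"
      unfolding p(3) by (rule poly_in_ideal[OF S.subdom_axioms Q'.primeD(1)])
        (use p key in \<open>auto simp: sec_polys_def\<close>)
  qed
  then show ?thesis
    using Q(1) QP_prime Q.prime_divisor S.prime_divisors_iff[of Q] S.prime_divisors_iff[of QP] by metis
qed

end

section \<open>The divisor of u on the cone\<close>

context cone
begin

lemma cone_at_exists:
  assumes P: "P \<in> prime_divisors R" and t: "uniformizer R P t"
  shows "\<exists>a b d e. cone_at R u D P t a e b d"
proof -
  obtain e d' where q: "quotient_of (D P) = (e, d')" by fastforce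
  have d': "0 < d'" "coprime e d'" "D P = of_int e / of_int d'"
    using quotient_of_denom_pos[OF q] quotient_of_coprime[OF q] quotient_of_div[OF q] by auto
  have "gcd d' e = 1" using d'(2) by (simp add: coprime_iff_gcd_eq_1 gcd.commute)
  then obtain x y where xy: "x * d' + y * e = 1" using bezout_int[of d' e] by metis
  \<comment> \<open>Adding a multiple of (-e, d') to the pair (x, y) preserves the Bezout identity;
    the multiple \<open>\<bar>y\<bar>\<close> makes the second entry non-negative.\<close>
  define b where "b = y + d' * \<bar>y\<bar>"
  define a where "a = x - e * \<bar>y\<bar>"
  have "\<bar>y\<bar> * 1 \<le> \<bar>y\<bar> * d'" using d'(1) by (intro mult_left_mono) auto
  then have "0 \<le> b" by (simp add: b_def mult.commute abs_if split: if_splits)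
  moreover have "a * d' + b * e = 1" using xy by (simp add: a_def b_def algebra_simps)
  ultimately have "cone_at R u D P t a e (nat b) (nat d')"
    using d' P t by unfold_locales auto
  then show ?thesis by blast
qed

text \<open>Coefficients are compared prime by prime. On the section div u contributes 1, which the
  indicator cancels, and u is a unit at the other primes dominating the curve. At the prime over P
  the equation reads d D'(P) = e, that is D'(P) = D(P). Every point has such a prime above it,
  whence uniqueness.\<close>

theorem pullback_eq_iff:
  assumes D': "q_divisor R D'"
  shows "pullback_div R S D' = div_of S u - indicator {Splus} \<longleftrightarrow> D' = D"
proof -
  have some: "uniformizer R P (SOME t. uniformizer R P t)" if "P \<in> prime_divisors R" for P
    using ex_uniformizer[OF that] by (metis someI)
  have not_pd: "{0} \<notin> prime_divisors R" using pd_nonzero by blast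
  have Splus_pd: "Splus \<in> prime_divisors S" by (rule dvr_at.prime_divisor[OF Splus_dvr])
  have uS: "order_at S Splus u = 1" by (rule dvr_at.order_uniformizer[OF Splus_dvr])
  have off: "pullback_div R S D' Q = (div_of S u - indicator {Splus}) Q"
    if "\<not> (Q \<in> prime_divisors S \<and> Q \<inter> R \<in> prime_divisors R)" for Q
  proof (cases "Q \<in> prime_divisors S")
    case False
    then show ?thesis using Splus_pd by (auto simp: pullback_div_def div_of_def indicator_def)
  next
    case True
    then have "is_prime R (Q \<inter> R)" using contract_prime S.prime_divisors_iff by blast
    then have Q0: "Q \<inter> R = {0}" using that True by (metis prime_cases)
    show ?thesis
      using True Q0 not_pd uS order_generic[OF True Q0] Splus_Int
      by (auto simp: pullback_div_def div_of_def indicator_def)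
  qed
  have at: "Q \<inter> R \<in> prime_divisors R \<Longrightarrow> Q \<in> prime_divisors S \<Longrightarrow>
      pullback_div R S D' Q = (div_of S u - indicator {Splus}) Q \<longleftrightarrow> D' (Q \<inter> R) = D (Q \<inter> R)" for Q
  proof -
    assume pd: "Q \<inter> R \<in> prime_divisors R" "Q \<in> prime_divisors S"
    \<comment> \<open>The local analysis is instantiated with the very uniformizer that
      \<open>pullback_div\<close> chooses.\<close>
    let ?t = "SOME t. uniformizer R (Q \<inter> R) t"
    obtain a b d e where "cone_at R u D (Q \<inter> R) ?t a e b d"
      using cone_at_exists[OF pd(1) some[OF pd(1)]] by blast
    then interpret c: cone_at R u D "Q \<inter> R" ?t a e b d .
    have "Q = c.QP" by (rule c.QP_unique[OF pd(2) refl])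
    moreover have "Q \<noteq> Splus" using pd not_pd Splus_Int by auto
    ultimately have "pullback_div R S D' Q = (div_of S u - indicator {Splus}) Q \<longleftrightarrow>
        D' (Q \<inter> R) * of_nat d = of_int e"
      using pd c.order_t c.order_u by (simp add: pullback_div_def div_of_def)
    moreover have "D (Q \<inter> R) * of_nat d = of_int e" using c.d c.DP by simp
    ultimately show ?thesis using c.d by (metis mult_right_cancel neq0_conv of_nat_eq_0_iff)
  qed
  have ex: "\<exists>Q. Q \<in> prime_divisors S \<and> Q \<inter> R = P" if P: "P \<in> prime_divisors R" for P
  proof -
    obtain a b d e where "cone_at R u D P (SOME t. uniformizer R P t) a e b d"
      using cone_at_exists[OF P some[OF P]] by blast
    then interpret c: cone_at R u D P "SOME t. uniformizer R P t" a e b d .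
    show ?thesis using c.Q.prime_divisor c.QP_Int by blast
  qed
  show ?thesis
  proof
    assume eq: "pullback_div R S D' = div_of S u - indicator {Splus}"
    show "D' = D"
    proof
      fix P
      show "D' P = D P"
      proof (cases "P \<in> prime_divisors R")
        case True
        then obtain Q where "Q \<in> prime_divisors S" "Q \<inter> R = P" using ex by blast
        then show ?thesis using at[of Q] eq True by simp
      next
        case False
        then have "D P = 0" "D' P = 0" using D D' by (auto simp: q_divisor_def)
        then show ?thesis by simp
      qed
    qed
  next
    assume "D' = D"
    then show "pullback_div R S D' = div_of S u - indicator {Splus}"
      using off at by (intro ext) blast
  qed
qed

end

section \<open>Laurent polynomials and the algebra of a pair of divisors\<close>

lemma poly_mapping_sum_single:
  assumes "finite F" "Poly_Mapping.keys p \<subseteq> F"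
  shows "p = (\<Sum>k\<in>F. Poly_Mapping.single k (Poly_Mapping.lookup p k))"
proof (rule poly_mapping_eqI)
  fix j
  have "Poly_Mapping.lookup p j = (\<Sum>k\<in>F. if k = j then Poly_Mapping.lookup p k else 0)"
    using assms by (auto simp: sum.delta' in_keys_iff)
  then show "Poly_Mapping.lookup p j = Poly_Mapping.lookup (\<Sum>k\<in>F. Poly_Mapping.single k (Poly_Mapping.lookup p k)) j"
    by (simp add: lookup_sum lookup_single when_def)
qed

lemma lookup_mult_int:
  fixes p q :: "int \<Rightarrow>\<^sub>0 'k::comm_ring_1"
  shows "Poly_Mapping.lookup (p * q) k = (\<Sum>l\<in>Poly_Mapping.keys p. Poly_Mapping.lookup p l * Poly_Mapping.lookup q (k - l))"
proof -
  have "p * q = (\<Sum>l\<in>Poly_Mapping.keys p. Poly_Mapping.single l (Poly_Mapping.lookup p l)) * (\<Sum>m\<in>Poly_Mapping.keys q. Poly_Mapping.single m (Poly_Mapping.lookup q m))"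
    using poly_mapping_sum_single[of "Poly_Mapping.keys p" p] poly_mapping_sum_single[of "Poly_Mapping.keys q" q] by simp
  also have "\<dots> = (\<Sum>l\<in>Poly_Mapping.keys p. \<Sum>m\<in>Poly_Mapping.keys q. Poly_Mapping.single (l + m) (Poly_Mapping.lookup p l * Poly_Mapping.lookup q m))"
    by (simp add: sum_product mult_single)
  finally have "Poly_Mapping.lookup (p * q) k = (\<Sum>l\<in>Poly_Mapping.keys p. \<Sum>m\<in>Poly_Mapping.keys q. if m = k - l then Poly_Mapping.lookup p l * Poly_Mapping.lookup q m else 0)"
    by (simp add: lookup_sum lookup_single when_def eq_diff_eq add.commute)
  also have "\<dots> = (\<Sum>l\<in>Poly_Mapping.keys p. Poly_Mapping.lookup p l * Poly_Mapping.lookup q (k - l))"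
    by (intro sum.cong refl) (auto simp: sum.delta in_keys_iff)
  finally show ?thesis .
qed

text \<open>Substitutes the field element u for the indeterminate. Restricted to the graded mappings
  of the pieces of A it is the inverse of the isomorphism in (a).\<close>

definition laurent_eval :: "'k::field \<Rightarrow> (int \<Rightarrow>\<^sub>0 'k) \<Rightarrow> 'k" where
  "laurent_eval u p = (\<Sum>k\<in>Poly_Mapping.keys p. Poly_Mapping.lookup p k * u powi k)"

lemma laurent_eval_superset:
  "finite F \<Longrightarrow> Poly_Mapping.keys p \<subseteq> F \<Longrightarrow> laurent_eval u p = (\<Sum>k\<in>F. Poly_Mapping.lookup p k * u powi k)"
  unfolding laurent_eval_def by (intro sum.mono_neutral_left) (auto simp: in_keys_iff)

lemma laurent_eval_single [simp]: "laurent_eval u (Poly_Mapping.single k c) = c * u powi k"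
  by (simp add: laurent_eval_def)

lemma laurent_eval_0 [simp]: "laurent_eval u 0 = 0"
  by (simp add: laurent_eval_def)

lemma laurent_eval_add: "laurent_eval u (p + q) = laurent_eval u p + laurent_eval u q"
proof -
  have "Poly_Mapping.keys (p + q) \<subseteq> Poly_Mapping.keys p \<union> Poly_Mapping.keys q" by (rule keys_add)
  then show ?thesis
    using laurent_eval_superset[of "Poly_Mapping.keys p \<union> Poly_Mapping.keys q" p u]
      laurent_eval_superset[of "Poly_Mapping.keys p \<union> Poly_Mapping.keys q" q u]
      laurent_eval_superset[of "Poly_Mapping.keys p \<union> Poly_Mapping.keys q" "p + q" u]
    by (simp add: lookup_add distrib_right sum.distrib)
qed

lemma laurent_eval_uminus: "laurent_eval u (- p) = - laurent_eval u p"
  by (simp add: laurent_eval_def sum_negf)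

lemma laurent_eval_diff: "laurent_eval u (p - q) = laurent_eval u p - laurent_eval u q"
  using laurent_eval_add[of u p "- q"] laurent_eval_uminus[of u q] by simp

lemma laurent_eval_sum: "laurent_eval u (sum f X) = (\<Sum>x\<in>X. laurent_eval u (f x))"
  by (induction X rule: infinite_finite_induct) (auto simp: laurent_eval_add)

lemma laurent_eval_mult:
  assumes "u \<noteq> 0"
  shows "laurent_eval u (p * q) = laurent_eval u p * laurent_eval u q"
proof -
  have "p * q = (\<Sum>l\<in>Poly_Mapping.keys p. Poly_Mapping.single l (Poly_Mapping.lookup p l)) * (\<Sum>m\<in>Poly_Mapping.keys q. Poly_Mapping.single m (Poly_Mapping.lookup q m))"
    using poly_mapping_sum_single[of "Poly_Mapping.keys p" p] poly_mapping_sum_single[of "Poly_Mapping.keys q" q] by simp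
  also have "\<dots> = (\<Sum>l\<in>Poly_Mapping.keys p. \<Sum>m\<in>Poly_Mapping.keys q. Poly_Mapping.single (l + m) (Poly_Mapping.lookup p l * Poly_Mapping.lookup q m))"
    by (simp add: sum_product mult_single)
  finally have "laurent_eval u (p * q) =
      (\<Sum>l\<in>Poly_Mapping.keys p. \<Sum>m\<in>Poly_Mapping.keys q. (Poly_Mapping.lookup p l * u powi l) * (Poly_Mapping.lookup q m * u powi m))"
    using assms by (simp add: laurent_eval_sum power_int_add mult_ac)
  then show ?thesis by (simp add: laurent_eval_def sum_product)
qed

definition graded_mappings :: "(int \<Rightarrow> 'k::field set) \<Rightarrow> (int \<Rightarrow>\<^sub>0 'k) set" where
  "graded_mappings M = {p. \<forall>i. Poly_Mapping.lookup p i \<in> M i}"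

lemma graded_sum_single:
  fixes M :: "int \<Rightarrow> 'k::field set"
  assumes "\<And>i. 0 \<in> M i"
  shows "graded_sum (\<lambda>i. Poly_Mapping.single i ` M i) UNIV = graded_mappings M"
proof
  show "graded_mappings M \<subseteq> graded_sum (\<lambda>i. Poly_Mapping.single i ` M i) UNIV"
  proof
    fix p assume "p \<in> graded_mappings M"
    then have "\<forall>i\<in>Poly_Mapping.keys p. Poly_Mapping.single i (Poly_Mapping.lookup p i) \<in> Poly_Mapping.single i ` M i"
      by (auto simp: graded_mappings_def)
    then show "p \<in> graded_sum (\<lambda>i. Poly_Mapping.single i ` M i) UNIV"
      unfolding graded_sum_def using poly_mapping_sum_single[of "Poly_Mapping.keys p" p]
      by (intro CollectI exI[of _ "Poly_Mapping.keys p"] exI[of _ "\<lambda>i. Poly_Mapping.single i (Poly_Mapping.lookup p i)"]) auto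
  qed
  show "graded_sum (\<lambda>i. Poly_Mapping.single i ` M i) UNIV \<subseteq> graded_mappings M"
  proof
    fix p assume "p \<in> graded_sum (\<lambda>i. Poly_Mapping.single i ` M i) UNIV"
    then obtain F c where F: "finite F" "\<forall>i\<in>F. c i \<in> Poly_Mapping.single i ` M i" "p = (\<Sum>i\<in>F. c i)"
      by (auto simp: graded_sum_def)
    then obtain f where f: "\<And>i. i \<in> F \<Longrightarrow> f i \<in> M i \<and> c i = Poly_Mapping.single i (f i)"
      unfolding image_iff by metis
    have "Poly_Mapping.lookup p k \<in> M k" for k
    proof -
      have "Poly_Mapping.lookup p k = (\<Sum>i\<in>F. if i = k then f i else 0)"
        unfolding F(3) lookup_sum by (intro sum.cong) (auto simp: f lookup_single when_def)
      then show ?thesis using F(1) f assms by (simp add: sum.delta)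
    qed
    then show "p \<in> graded_mappings M" by (simp add: graded_mappings_def)
  qed
qed

text \<open>The substitution of u / \<phi> for u. With this sign it adds div \<phi> to the divisor
  in positive degrees and subtracts it in negative ones.\<close>

definition twist :: "'k::field \<Rightarrow> (int \<Rightarrow>\<^sub>0 'k) \<Rightarrow> (int \<Rightarrow>\<^sub>0 'k)" where
  "twist \<phi> = Poly_Mapping.mapp (\<lambda>k c. c * \<phi> powi (- k))"

lemma lookup_twist: "Poly_Mapping.lookup (twist \<phi> p) k = Poly_Mapping.lookup p k * \<phi> powi (- k)"
  by (simp add: twist_def mapp.rep_eq when_def in_keys_iff)

lemma twist_add: "twist \<phi> (p + q) = twist \<phi> p + twist \<phi> q"
  by (intro poly_mapping_eqI) (simp add: lookup_twist lookup_add distrib_right)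

lemma keys_twist: "\<phi> \<noteq> 0 \<Longrightarrow> Poly_Mapping.keys (twist \<phi> p) = Poly_Mapping.keys p"
  by (auto simp: in_keys_iff lookup_twist)

lemma twist_mult:
  assumes "\<phi> \<noteq> 0"
  shows "twist \<phi> (p * q) = twist \<phi> p * twist \<phi> q"
proof (rule poly_mapping_eqI)
  fix k
  have "\<phi> powi (- k) = \<phi> powi (- l) * \<phi> powi (- (k - l))" for l
    using assms by (simp flip: power_int_add)
  then show "Poly_Mapping.lookup (twist \<phi> (p * q)) k = Poly_Mapping.lookup (twist \<phi> p * twist \<phi> q) k"
    unfolding lookup_twist lookup_mult_int keys_twist[OF assms] sum_distrib_right
    by (intro sum.cong refl) (metis mult.assoc mult.left_commute)
qed

lemma twist_single: "twist \<phi> (Poly_Mapping.single k c) = Poly_Mapping.single k (c * \<phi> powi (- k))"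
  by (intro poly_mapping_eqI) (simp add: lookup_twist lookup_single when_def)

lemma twist_twist: "\<phi> \<noteq> 0 \<Longrightarrow> twist \<phi> (twist (inverse \<phi>) p) = p"
  by (intro poly_mapping_eqI) (simp add: lookup_twist power_int_inverse power_int_minus)

section \<open>Isomorphisms between the algebras of two pairs of divisors\<close>

context dedekind
begin

definition dpd_coeff :: "('k set \<Rightarrow> rat) \<Rightarrow> ('k set \<Rightarrow> rat) \<Rightarrow> int \<Rightarrow> 'k set" where
  "dpd_coeff Dp Dm i = (if 0 \<le> i then sec Dp i else sec Dm (- i))"

lemma dpd_coeff_zero: "0 \<in> dpd_coeff Dp Dm i"
  by (simp add: dpd_coeff_def sec_zero_mem)

lemma dpd_piece_eq:
  assumes "q_divisor R Dp" "q_divisor R Dm"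
  shows "dpd_piece R Dp Dm i = Poly_Mapping.single i ` dpd_coeff Dp Dm i"
  using sections_floor_div[OF assms(1), of i] sections_floor_div[OF assms(2), of "- i"]
  by (simp add: dpd_piece_def dpd_coeff_def)

lemma dpd_ring_eq:
  assumes "q_divisor R Dp" "q_divisor R Dm"
  shows "dpd_ring R Dp Dm = graded_mappings (dpd_coeff Dp Dm)"
proof -
  have "dpd_piece R Dp Dm = (\<lambda>i. Poly_Mapping.single i ` dpd_coeff Dp Dm i)"
    using dpd_piece_eq[OF assms] by blast
  then show ?thesis
    unfolding dpd_ring_def using graded_sum_single[of "dpd_coeff Dp Dm"] dpd_coeff_zero by simp
qed

lemma sec_shift:
  assumes f: "f \<in> sec D i" and \<psi>: "\<psi> \<in> frac_field R" "\<psi> \<noteq> 0"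
    and D': "\<And>P. P \<in> prime_divisors R \<Longrightarrow> D' P = D P - of_int (order_at R P \<psi>)"
  shows "f * \<psi> powi i \<in> sec D' i"
proof (cases "f = 0")
  case False
  interpret F: subdom "frac_field R" by (rule frac_field_subdom)
  have fK: "f \<in> frac_field R" using secD(1)[OF f] .
  have "0 \<le> of_int (order_at R P (f * \<psi> powi i)) + of_int i * D' P" if P: "P \<in> prime_divisors R" for P
    using secD(2)[OF f False P] fK False \<psi> P
    by (simp add: D' ord_mult ord_powi frac_field_powi algebra_simps)
  then show ?thesis using fK \<psi> by (auto simp: sec_def frac_field_powi)
qed (simp add: sec_zero_mem)

text \<open>In a degree d equal to the denominator of D(P) rounding down loses nothing. A section
  attaining the bound at P in this degree compares the two divisors there exactly.\<close>

lemma sec_shift_le: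
  assumes D: "q_divisor R D" and P: "P \<in> prime_divisors R" and \<psi>: "\<psi> \<in> frac_field R" "\<psi> \<noteq> 0"
    and sub: "\<And>i f. 0 \<le> i \<Longrightarrow> f \<in> sec D i \<Longrightarrow> f * \<psi> powi i \<in> sec D' i"
  shows "D P \<le> D' P + of_int (order_at R P \<psi>)"
proof -
  obtain e d where q: "quotient_of (D P) = (e, d)" by fastforce
  have d: "0 < d" "D P = of_int e / of_int d"
    using quotient_of_denom_pos[OF q] quotient_of_div[OF q] by auto
  then have dD: "of_int d * D P = of_int e" by simp
  obtain f where f: "f \<in> sec D d" "f \<noteq> 0" "order_at R P f = - \<lfloor>of_int d * D P\<rfloor>"
    using sec_exact[OF D P] by blast
  have "f * \<psi> powi d \<in> sec D' d" using sub[OF _ f(1)] d(1) by simp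
  then have "0 \<le> of_int (order_at R P (f * \<psi> powi d)) + of_int d * D' P"
    using secD(2) f(2) \<psi>(2) P by simp
  also have "order_at R P (f * \<psi> powi d) = - e + d * order_at R P \<psi>"
    using f P \<psi> secD(1)[OF f(1)] by (simp add: ord_mult ord_powi frac_field_powi dD)
  finally have "of_int d * D P \<le> of_int d * (D' P + of_int (order_at R P \<psi>))"
    unfolding dD by (simp add: algebra_simps)
  then show ?thesis using d(1) by simp
qed

lemma dpd_iso_of_twist:
  assumes q: "q_divisor R Dp" "q_divisor R Dm" "q_divisor R Dp'" "q_divisor R Dm'"
    and \<phi>: "\<phi> \<in> frac_field R" "\<phi> \<noteq> 0"
    and Dp': "Dp' = Dp + div_of R \<phi>" and Dm': "Dm' = Dm - div_of R \<phi>"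
  shows "dpd_iso_dpd R Dp Dm Dp' Dm'"
proof -
  have i\<phi>: "inverse \<phi> \<in> frac_field R" "inverse \<phi> \<noteq> 0" using \<phi> frac_field_inverse by auto
  have pd: "Dp' P = Dp P + of_int (order_at R P \<phi>)" "Dm' P = Dm P - of_int (order_at R P \<phi>)"
    if "P \<in> prime_divisors R" for P
    using that by (auto simp: Dp' Dm' div_of_def)
  have fwd: "c * \<phi> powi (- i) \<in> dpd_coeff Dp' Dm' i" if c: "c \<in> dpd_coeff Dp Dm i" for c i
  proof (cases "0 \<le> i")
    case True
    then have "c * inverse \<phi> powi i \<in> sec Dp' i"
      using c i\<phi> \<phi> pd by (intro sec_shift[of c Dp i]) (auto simp: dpd_coeff_def ord_inverse)
    then show ?thesis using True by (simp add: dpd_coeff_def power_int_inverse power_int_minus)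
  next
    case False
    then have "c * \<phi> powi (- i) \<in> sec Dm' (- i)"
      using c \<phi> pd by (intro sec_shift[of c Dm]) (auto simp: dpd_coeff_def)
    then show ?thesis using False by (simp add: dpd_coeff_def)
  qed
  have bwd: "c * inverse \<phi> powi (- i) \<in> dpd_coeff Dp Dm i" if c: "c \<in> dpd_coeff Dp' Dm' i" for c i
  proof (cases "0 \<le> i")
    case True
    then have "c * \<phi> powi i \<in> sec Dp i"
      using c \<phi> pd by (intro sec_shift[of c Dp' i]) (auto simp: dpd_coeff_def)
    then show ?thesis using True by (simp add: dpd_coeff_def power_int_inverse power_int_minus)
  next
    case False
    then have "c * inverse \<phi> powi (- i) \<in> sec Dm (- i)"
      using c i\<phi> \<phi> pd by (intro sec_shift[of c Dm']) (auto simp: dpd_coeff_def ord_inverse)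
    then show ?thesis using False by (simp add: dpd_coeff_def)
  qed
  have inv: "twist \<phi> (twist (inverse \<phi>) p) = p" "twist (inverse \<phi>) (twist \<phi> p) = p" for p
    using twist_twist[OF \<phi>(2)] twist_twist[OF i\<phi>(2)] by auto
  have "bij_betw (twist \<phi>) (graded_mappings (dpd_coeff Dp Dm)) (graded_mappings (dpd_coeff Dp' Dm'))"
    by (rule bij_betw_byWitness[where f' = "twist (inverse \<phi>)"])
      (use inv fwd bwd in \<open>auto simp: graded_mappings_def lookup_twist\<close>)
  then have iso: "twist \<phi> \<in> ring_iso (ring_on (dpd_ring R Dp Dm)) (ring_on (dpd_ring R Dp' Dm'))"
    using twist_single[of \<phi> 0 1] \<phi>(2) bij_betwE
    by (intro ring_iso_memI) (auto simp: dpd_ring_eq q twist_add twist_mult)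
  have "twist \<phi> ` dpd_piece R Dp Dm i = dpd_piece R Dp' Dm' i" for i
  proof
    show "twist \<phi> ` dpd_piece R Dp Dm i \<subseteq> dpd_piece R Dp' Dm' i"
      using fwd by (auto simp: dpd_piece_eq q twist_single)
    show "dpd_piece R Dp' Dm' i \<subseteq> twist \<phi> ` dpd_piece R Dp Dm i"
    proof
      fix p assume "p \<in> dpd_piece R Dp' Dm' i"
      then have "twist (inverse \<phi>) p \<in> dpd_piece R Dp Dm i"
        using bwd by (auto simp: dpd_piece_eq q twist_single)
      then show "p \<in> twist \<phi> ` dpd_piece R Dp Dm i" using inv(1)[of p] by (metis imageI)
    qed
  qed
  then show ?thesis
    unfolding dpd_iso_dpd_def graded_algebra_iso_def
    using iso twist_single[of \<phi> 0] by (intro bexI[of _ "twist \<phi>"]) auto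
qed

text \<open>In each degree the isomorphism is R-linear on a space of rank one over R, hence
  multiplication by a rational function. Multiplicativity makes it the i-th power of the factor
  \<open>\<psi>\<close> found in degree 1.\<close>

lemma dpd_iso_coeff:
  assumes q: "q_divisor R Dp" "q_divisor R Dm" "q_divisor R Dp'" "q_divisor R Dm'"
    and le: "Dp + Dm \<le> 0"
    and iso: "dpd_iso_dpd R Dp Dm Dp' Dm'"
  obtains \<psi> where "\<psi> \<in> frac_field R" "\<psi> \<noteq> 0"
    "\<And>i. dpd_coeff Dp' Dm' i = (\<lambda>f. f * \<psi> powi i) ` dpd_coeff Dp Dm i"
proof -
  let ?M = "dpd_coeff Dp Dm" and ?M' = "dpd_coeff Dp' Dm'"
  let ?s = "Poly_Mapping.single :: int \<Rightarrow> 'k \<Rightarrow> int \<Rightarrow>\<^sub>0 'k"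
  interpret F: subdom "frac_field R" by (rule frac_field_subdom)
  obtain h where h: "h \<in> ring_iso (ring_on (graded_mappings ?M)) (ring_on (graded_mappings ?M'))"
    and piece: "\<And>i. h ` ?s i ` ?M i = ?s i ` ?M' i" and const: "\<And>r. r \<in> R \<Longrightarrow> h (?s 0 r) = ?s 0 r"
    using iso unfolding dpd_iso_dpd_def graded_algebra_iso_def
    by (auto simp: dpd_ring_eq dpd_piece_eq q)
  have s_mem: "?s i f \<in> graded_mappings ?M" if "f \<in> ?M i" for f i
    using that dpd_coeff_zero by (auto simp: graded_mappings_def lookup_single when_def)
  have h_mult: "h (x * y) = h x * h y" if "x \<in> graded_mappings ?M" "y \<in> graded_mappings ?M" for x y
    using h that by (auto simp: ring_iso_def ring_hom_def)
  have inj: "inj_on h (graded_mappings ?M)" using h by (auto simp: ring_iso_def bij_betw_def)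
  define H where "H i f = Poly_Mapping.lookup (h (?s i f)) i" for i f
  have H: "h (?s i f) = ?s i (H i f)" "H i f \<in> ?M' i" if "f \<in> ?M i" for i f
  proof -
    have "h (?s i f) \<in> ?s i ` ?M' i" using piece[of i] that by blast
    then show "h (?s i f) = ?s i (H i f)" "H i f \<in> ?M' i" by (auto simp: H_def)
  qed
  have H_mult: "H (i + j) (f * g) = H i f * H j g" if "f \<in> ?M i" "g \<in> ?M j" "f * g \<in> ?M (i + j)" for f g i j
  proof -
    have "?s (i + j) (H (i + j) (f * g)) = h (?s i f * ?s j g)"
      using H(1)[OF that(3)] by (simp add: mult_single)
    also have "\<dots> = ?s (i + j) (H i f * H j g)"
      using h_mult[OF s_mem[OF that(1)] s_mem[OF that(2)]] H(1)[OF that(1)] H(1)[OF that(2)]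
      by (simp add: mult_single[of i "H i f"])
    finally show ?thesis by (metis lookup_single_eq)
  qed
  have M0: "?M 0 = R" by (simp add: dpd_coeff_def sec_0)
  have H0: "H 0 r = r" if "r \<in> R" for r using const[OF that] by (simp add: H_def)
  have M_scale: "r * f \<in> ?M i" if "r \<in> R" "f \<in> ?M i" for r f i
    using that by (auto simp: dpd_coeff_def sec_scale split: if_splits)
  have H_scale: "H i (r * f) = r * H i f" if "r \<in> R" "f \<in> ?M i" for r f i
    using H_mult[of r 0 f i] that M_scale[OF that] M0 H0 by simp
  have MK: "f \<in> frac_field R" if "f \<in> ?M i" for f i
    using that secD(1) by (auto simp: dpd_coeff_def split: if_splits)
  have M'K: "f \<in> frac_field R" if "f \<in> ?M' i" for f i
    using that secD(1) by (auto simp: dpd_coeff_def split: if_splits)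
  obtain f where f: "f \<in> ?M 1" "f \<noteq> 0"
    using sec_nontrivial[OF q(1), of 1] by (auto simp: dpd_coeff_def)
  define g where "g = H 1 f"
  have g0: "g \<noteq> 0"
  proof
    assume "g = 0"
    then have "h (?s 1 f) = h (?s 1 0)"
      using H(1)[OF f(1)] H(1)[of 0 1] H_scale[of 0 0 1] dpd_coeff_zero by (simp add: g_def)
    then have "?s 1 f = ?s 1 0" by (rule inj_onD[OF inj]) (use f dpd_coeff_zero s_mem in metis)+
    then show False using f(2) by (metis lookup_single_eq)
  qed
  define \<psi> where "\<psi> = g / f"
  have \<psi>: "\<psi> \<in> frac_field R" "\<psi> \<noteq> 0"
    using g0 f MK[OF f(1)] M'K[OF H(2)[OF f(1)]] by (auto simp: \<psi>_def g_def frac_field_divide)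
  have fn: "f ^ n \<in> ?M (int n)" for n
  proof (induction n)
    case 0
    then show ?case using M0 by simp
  next
    case (Suc n)
    then show ?case using sec_mult[of f Dp 1 "f ^ n" "int n"] f(1) by (simp add: dpd_coeff_def)
  qed
  have Hfn: "H (int n) (f ^ n) = g ^ n" for n
  proof (induction n)
    case 0
    then show ?case using H0[of 1] by simp
  next
    case (Suc n)
    then show ?case using H_mult[of f 1 "f ^ n" "int n"] f(1) fn[of n] fn[of "Suc n"] by (simp add: g_def)
  qed
  have Hpsi: "H i c = c * \<psi> powi i" if c: "c \<in> ?M i" for i c
  proof (cases "0 \<le> i")
    case True
    then obtain n where n: "i = int n" using nonneg_int_cases by blast
    have "c / f ^ n \<in> frac_field R" using MK[OF c] MK[OF fn] by (intro frac_field_divide)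
    then obtain r s where rs: "r \<in> R" "s \<in> R" "s \<noteq> 0" "c / f ^ n = r / s" by (rule frac_fieldE)
    \<comment> \<open>Both c and f^n have degree n, so they are proportional over Frac R; with the
      denominator cleared, linearity over R applies.\<close>
    then have "s * c = r * f ^ n" using f(2) by (simp add: field_simps)
    then have "s * H i c = r * g ^ n"
      using H_scale[OF rs(2) c] H_scale[OF rs(1) fn[of n]] Hfn[of n] n by simp
    then have "H i c = (r / s) * g ^ n" using rs(3) by (simp add: field_simps)
    then have "H i c = c * \<psi> ^ n" unfolding rs(4)[symmetric] by (simp add: \<psi>_def power_divide)
    then show ?thesis using n by simp
  next
    case False
    then obtain n where n: "i = - int n" by (metis int_cases2 of_nat_0_le_iff)
    \<comment> \<open>A negative degree is moved to degree 0, where the isomorphism is the identity.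
      The product is regular because the two divisors have non-positive sum.\<close>
    have "c * f ^ n \<in> R"
    proof (cases "c = 0")
      case False
      have c': "c \<in> sec Dm (int n)" and f': "f ^ n \<in> sec Dp (int n)"
        using c fn[of n] \<open>\<not> 0 \<le> i\<close> n by (auto simp: dpd_coeff_def)
      have "c * f ^ n \<in> sec Dp 0"
        unfolding sec_def
      proof (intro CollectI conjI disjI2 ballI)
        show "c * f ^ n \<in> frac_field R" using secD(1)[OF c'] secD(1)[OF f'] by blast
        fix P assume P: "P \<in> prime_divisors R"
        have "Dp P + Dm P \<le> 0" using le by (simp add: le_fun_def)
        then have "of_nat n * (Dp P + Dm P) \<le> 0" by (simp add: mult_nonneg_nonpos)
        then show "0 \<le> of_int (order_at R P (c * f ^ n)) + of_int 0 * Dp P"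
          using secD(2)[OF c' False P] secD(2)[OF f' _ P] P False f(2) secD(1)[OF c'] secD(1)[OF f']
          by (simp add: ord_mult algebra_simps)
      qed
      then show ?thesis by (simp add: sec_0)
    qed simp
    then have "H 0 (c * f ^ n) = c * f ^ n" "c * f ^ n \<in> ?M (i + int n)" using H0 M0 n by auto
    then have "H i c * g ^ n = c * f ^ n" using H_mult[OF c fn[of n]] Hfn[of n] n by simp
    then have "H i c = c * (f / g) ^ n" using g0 by (simp add: field_simps)
    also have "\<dots> = c * \<psi> powi i" using n by (simp add: \<psi>_def power_int_minus power_divide)
    finally show ?thesis .
  qed
  have "?M' i = (\<lambda>f. f * \<psi> powi i) ` ?M i" for i
  proof
    show "(\<lambda>f. f * \<psi> powi i) ` ?M i \<subseteq> ?M' i" using H(2)[of _ i] Hpsi[of _ i] by auto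
    show "?M' i \<subseteq> (\<lambda>f. f * \<psi> powi i) ` ?M i"
    proof
      fix c assume "c \<in> ?M' i"
      then have "?s i c \<in> h ` ?s i ` ?M i" using piece[of i] by blast
      then obtain b where b: "b \<in> ?M i" "?s i c = h (?s i b)" by blast
      then have "c = b * \<psi> powi i" using H(1)[OF b(1)] Hpsi[OF b(1)] by (metis lookup_single_eq)
      then show "c \<in> (\<lambda>f. f * \<psi> powi i) ` ?M i" using b(1) by blast
    qed
  qed
  with \<psi> show thesis by (rule that)
qed

theorem dpd_iso_iff:
  assumes q: "q_divisor R Dp" "q_divisor R Dm" "q_divisor R Dp'" "q_divisor R Dm'"
    and le: "Dp + Dm \<le> 0"
  shows "dpd_iso_dpd R Dp Dm Dp' Dm' \<longleftrightarrow>
    (\<exists>\<phi>\<in>frac_field R. \<phi> \<noteq> 0 \<and> Dp' = Dp + div_of R \<phi> \<and> Dm' = Dm - div_of R \<phi>)"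
proof
  assume "dpd_iso_dpd R Dp Dm Dp' Dm'"
  then obtain \<psi> where \<psi>: "\<psi> \<in> frac_field R" "\<psi> \<noteq> 0"
    and M': "\<And>i. dpd_coeff Dp' Dm' i = (\<lambda>f. f * \<psi> powi i) ` dpd_coeff Dp Dm i"
    by (rule dpd_iso_coeff[OF q le]) blast
  let ?\<phi> = "inverse \<psi>"
  have \<phi>: "?\<phi> \<in> frac_field R" "?\<phi> \<noteq> 0" using \<psi> frac_field_inverse by auto
  have bwd: "f * ?\<phi> powi i \<in> dpd_coeff Dp Dm i" if "f \<in> dpd_coeff Dp' Dm' i" for f i
    using that \<psi>(2) by (auto simp: M' power_int_inverse mult.assoc)
  have p1: "f * \<psi> powi i \<in> sec Dp' i" if "0 \<le> i" "f \<in> sec Dp i" for f i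
    using that M'[of i] by (auto simp: dpd_coeff_def)
  have p2: "f * ?\<phi> powi i \<in> sec Dp i" if "0 \<le> i" "f \<in> sec Dp' i" for f i
    using that bwd[of f i] by (simp add: dpd_coeff_def)
  \<comment> \<open>In \<open>dpd_coeff\<close> degree 0 belongs to the first divisor, so i = 0 is
    treated apart; there both spaces of sections are R.\<close>
  have m1: "f * ?\<phi> powi i \<in> sec Dm' i" if "0 \<le> i" "f \<in> sec Dm i" for f i
  proof (cases "i = 0")
    case False
    then have "f * \<psi> powi (- i) \<in> dpd_coeff Dp' Dm' (- i)"
      using that M'[of "- i"] by (auto simp: dpd_coeff_def)
    then show ?thesis using that False by (simp add: dpd_coeff_def power_int_inverse power_int_minus)
  qed (use that in \<open>simp add: sec_0\<close>)
  have m2: "f * \<psi> powi i \<in> sec Dm i" if "0 \<le> i" "f \<in> sec Dm' i" for f i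
  proof (cases "i = 0")
    case False
    then have "f * ?\<phi> powi (- i) \<in> dpd_coeff Dp Dm (- i)"
      using that bwd[of f "- i"] by (auto simp: dpd_coeff_def)
    then show ?thesis using that False by (simp add: dpd_coeff_def power_int_inverse power_int_minus)
  qed (use that in \<open>simp add: sec_0\<close>)
  have "Dp' = Dp + div_of R ?\<phi>" "Dm' = Dm - div_of R ?\<phi>"
  proof -
    have "Dp' P = (Dp + div_of R ?\<phi>) P \<and> Dm' P = (Dm - div_of R ?\<phi>) P" for P
    proof (cases "P \<in> prime_divisors R")
      case True
      have o: "order_at R P ?\<phi> = - order_at R P \<psi>" using \<psi> True by (simp add: ord_inverse)
      \<comment> \<open>Each multiplication and its inverse bound the divisors from both sides, so
        the inequalities are equalities.\<close>
      show ?thesis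
        using sec_shift_le[OF q(1) True \<psi>, of Dp'] sec_shift_le[OF q(3) True \<phi>, of Dp]
          sec_shift_le[OF q(2) True \<phi>, of Dm'] sec_shift_le[OF q(4) True \<psi>, of Dm] p1 p2 m1 m2 True o
        by (auto simp: div_of_def)
    next
      case False
      then have "Dp P = 0" "Dp' P = 0" "Dm P = 0" "Dm' P = 0" using q by (auto simp: q_divisor_def)
      then show ?thesis using False by (simp add: div_of_def)
    qed
    then show "Dp' = Dp + div_of R ?\<phi>" "Dm' = Dm - div_of R ?\<phi>" by auto
  qed
  then show "\<exists>\<phi>\<in>frac_field R. \<phi> \<noteq> 0 \<and> Dp' = Dp + div_of R \<phi> \<and> Dm' = Dm - div_of R \<phi>"
    using \<phi> by blast
qed (use dpd_iso_of_twist q in blast)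

end

section \<open>Graded domains\<close>

locale graded_subring = subdom A for A :: "'k::field set" +
  fixes G :: "int \<Rightarrow> 'k set"
  assumes graded: "graded_ring A G" and one_mem_0: "1 \<in> G 0"
begin

lemma G_subset: "a \<in> G i \<Longrightarrow> a \<in> A"
  and G_zero: "0 \<in> G i"
proof -
  interpret Gi: additive_subgroup "G i" "ring_on A"
    using graded by (simp add: graded_ring_def)
  show "a \<in> G i \<Longrightarrow> a \<in> A" using Gi.a_subset by auto
  show "0 \<in> G i" using Gi.zero_closed by simp
qed

lemma G_mult: "a \<in> G i \<Longrightarrow> b \<in> G j \<Longrightarrow> a * b \<in> G (i + j)"
  using graded by (auto simp: graded_ring_def)

lemma G_power: "a \<in> G i \<Longrightarrow> a ^ n \<in> G (int n * i)"
proof (induction n)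
  case (Suc n)
  then show ?case using G_mult[of a i "a ^ n" "int n * i"] by (simp add: algebra_simps)
qed (simp add: one_mem_0)

lemma G_scale: "r \<in> G 0 \<Longrightarrow> a \<in> G i \<Longrightarrow> r * a \<in> G i"
  using G_mult[of r 0 a i] by simp

lemma decomposition_ex: "a \<in> A \<Longrightarrow> \<exists>c. decomposition G a c"
  using graded by (auto simp: graded_ring_def)

lemma decomposition_unique: "decomposition G a c \<Longrightarrow> decomposition G a d \<Longrightarrow> c = d"
proof -
  assume c: "decomposition G a c" and d: "decomposition G a d"
  have "a \<in> A"
    using c G_subset by (auto simp: decomposition_def intro!: sum_mem)
  then show "c = d" using graded c d by (auto simp: graded_ring_def)
qed

lemma component_eq: "decomposition G a c \<Longrightarrow> component G i a = c i"
  unfolding component_def using decomposition_unique[of a c] by (metis the_equality)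

lemma decomposition_component:
  assumes "a \<in> A"
  shows "decomposition G a (\<lambda>i. component G i a)"
proof -
  obtain c where "decomposition G a c" using decomposition_ex[OF assms] by blast
  then show ?thesis using component_eq[of a c] by simp
qed

lemma decompositionI:
  assumes "finite F" "\<And>i. i \<in> F \<Longrightarrow> c i \<in> G i" "a = (\<Sum>i\<in>F. c i)"
  shows "decomposition G a (\<lambda>i. if i \<in> F then c i else 0)"
proof -
  have "(\<Sum>i | (if i \<in> F then c i else 0) \<noteq> 0. if i \<in> F then c i else 0) = (\<Sum>i\<in>F. if i \<in> F then c i else 0)"
    using assms(1) by (intro sum.mono_neutral_left) auto
  then show ?thesis
    using assms G_zero finite_subset[of "{i. (if i \<in> F then c i else 0) \<noteq> 0}" F]
    by (auto simp: decomposition_def)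
qed

lemma homogeneous_sum_zero:
  assumes "finite F" "\<And>i. i \<in> F \<Longrightarrow> c i \<in> G i" "(\<Sum>i\<in>F. c i) = 0" "i \<in> F"
  shows "c i = 0"
proof -
  have "decomposition G 0 (\<lambda>i. if i \<in> F then c i else 0)"
    using decompositionI[OF assms(1,2)] assms(3) by auto
  moreover have "decomposition G 0 (\<lambda>_. 0)"
    using G_zero by (simp add: decomposition_def)
  ultimately have "(\<lambda>i. if i \<in> F then c i else 0) = (\<lambda>_. 0)" by (rule decomposition_unique)
  then show ?thesis using assms(4) by metis
qed

text \<open>Multiplication by b shifts decompositions by i; since that of b z has a single term, so
  has that of z.\<close>

lemma homogeneous_quotient:
  assumes z: "z \<in> A" and b: "b \<in> G i" "b \<noteq> 0" and bz: "b * z \<in> G (i + k)"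
  shows "z \<in> G k"
proof -
  obtain c where c: "decomposition G z c" using decomposition_ex[OF z] by blast
  have S: "{l. b * c (l - i) \<noteq> 0} = (+) i ` {j. c j \<noteq> 0}"
  proof
    show "{l. b * c (l - i) \<noteq> 0} \<subseteq> (+) i ` {j. c j \<noteq> 0}"
    proof
      fix l assume "l \<in> {l. b * c (l - i) \<noteq> 0}"
      then show "l \<in> (+) i ` {j. c j \<noteq> 0}" by (intro image_eqI[of _ _ "l - i"]) auto
    qed
  qed (use b in auto)
  have "(\<Sum>l | b * c (l - i) \<noteq> 0. b * c (l - i)) = (\<Sum>j | c j \<noteq> 0. b * c j)"
    unfolding S by (subst sum.reindex) auto
  also have "\<dots> = b * z" using c by (simp add: decomposition_def sum_distrib_left)
  finally have "decomposition G (b * z) (\<lambda>l. b * c (l - i))"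
    using c S G_mult[OF b(1), of "c (l - i)" "l - i" for l] by (auto simp: decomposition_def)
  moreover have "decomposition G (b * z) (\<lambda>l. if l \<in> {i + k} then b * z else 0)"
    by (rule decompositionI) (use bz in auto)
  ultimately have eq: "(\<lambda>l. b * c (l - i)) = (\<lambda>l. if l \<in> {i + k} then b * z else 0)"
    by (rule decomposition_unique)
  have "b * c k = b * z" using fun_cong[OF eq, of "i + k"] by simp
  then have "z = c k" using b by simp
  moreover have "c k \<in> G k" using c by (simp add: decomposition_def)
  ultimately show ?thesis by simp
qed

lemma nonneg_part_reverse:
  "graded_sum (\<lambda>i. G (- i)) {0..} = graded_sum G {..0}"
proof -
  have "graded_sum (\<lambda>i. H (- i)) (uminus ` I) \<subseteq> graded_sum H I" for H :: "int \<Rightarrow> 'k set" and I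
  proof
    fix x assume "x \<in> graded_sum (\<lambda>i. H (- i)) (uminus ` I)"
    then obtain F c where "x = (\<Sum>i\<in>F. c i)" "finite F" "F \<subseteq> uminus ` I" "\<forall>i\<in>F. c i \<in> H (- i)"
      unfolding graded_sum_def by blast
    then show "x \<in> graded_sum H I"
      unfolding graded_sum_def
      by (intro CollectI exI[of _ "uminus ` F"] exI[of _ "\<lambda>i. c (- i)"])
        (auto simp: sum.reindex)
  qed
  from this[of G "{..0}"] this[of "\<lambda>i. G (- i)" "{0..}"] show ?thesis by auto
qed

lemma graded_reverse: "graded_subring A (\<lambda>i. G (- i))"
proof
  have dec: "decomposition (\<lambda>i. G (- i)) a c \<longleftrightarrow> decomposition G a (\<lambda>i. c (- i))" for a c
  proof -
    have S: "{i. c (- i) \<noteq> 0} = uminus ` {i. c i \<noteq> 0}"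
      by (auto simp: image_iff) (metis minus_minus)
    have "(\<forall>i. c i \<in> G (- i)) \<longleftrightarrow> (\<forall>i. c (- i) \<in> G i)" by (metis minus_minus)
    moreover have "(\<Sum>i | c (- i) \<noteq> 0. c (- i)) = (\<Sum>i | c i \<noteq> 0. c i)"
      unfolding S by (subst sum.reindex) auto
    moreover have "finite {i. c (- i) \<noteq> 0} \<longleftrightarrow> finite {i. c i \<noteq> 0}"
      unfolding S by (rule finite_image_iff) auto
    ultimately show ?thesis by (simp add: decomposition_def)
  qed
  have "\<exists>!c. decomposition (\<lambda>i. G (- i)) a c" if a: "a \<in> A" for a
  proof (rule ex_ex1I)
    obtain c where "decomposition G a c" using decomposition_ex[OF a] by blast
    then show "\<exists>c. decomposition (\<lambda>i. G (- i)) a c"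
      by (intro exI[of _ "\<lambda>i. c (- i)"]) (simp add: dec)
    fix c d assume "decomposition (\<lambda>i. G (- i)) a c" "decomposition (\<lambda>i. G (- i)) a d"
    then have "(\<lambda>i. c (- i)) = (\<lambda>i. d (- i))" using decomposition_unique by (simp add: dec)
    then show "c = d" by (metis ext minus_minus)
  qed
  moreover have "a * b \<in> G (- (i + j))" if "a \<in> G (- i)" "b \<in> G (- j)" for a b i j
    using G_mult[OF that] by simp
  ultimately show "graded_ring A (\<lambda>i. G (- i))"
    using graded by (auto simp: graded_ring_def)
qed (use one_mem_0 in simp)

lemma component_reverse:
  assumes "a \<in> A"
  shows "component (\<lambda>i. G (- i)) 0 a = component G 0 a"
proof -
  interpret r: graded_subring A "\<lambda>i. G (- i)" by (rule graded_reverse)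
  interpret rr: graded_subring A "\<lambda>i. G (- (- i))" by (rule r.graded_reverse)
  let ?c = "\<lambda>i. component G i a"
  have c: "decomposition G a ?c" by (rule decomposition_component[OF assms])
  have "finite {i. ?c i \<noteq> 0}" "a = (\<Sum>i | ?c i \<noteq> 0. ?c i)" "\<And>i. ?c i \<in> G i"
    using c by (auto simp: decomposition_def)
  then have "decomposition (\<lambda>i. G (- i)) a (\<lambda>i. if i \<in> uminus ` {i. ?c i \<noteq> 0} then ?c (- i) else 0)"
    by (intro r.decompositionI) (auto simp: sum.reindex)
  then have "component (\<lambda>i. G (- i)) 0 a = (if 0 \<in> uminus ` {i. ?c i \<noteq> 0} then ?c (- 0) else 0)"
    by (rule r.component_eq)
  also have "\<dots> = ?c 0" by (auto simp: image_iff)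
  finally show ?thesis .
qed

end

text \<open>The assumptions are symmetric under reversing the grading together with inverting u, so
  that \<open>reverse\<close> carries every result about \<open>Dplus\<close> to the negative
  side.\<close>

locale torus_surface = A: graded_subring A G + dedekind "G 0" for A :: "'k::field set" and G +
  fixes \<kappa> :: "complex \<Rightarrow> 'k" and u :: 'k
  assumes normal: "normal_domain A" and fin_gen: "fin_gen_algebra \<kappa> A"
    and \<kappa>_mem: "\<And>c. \<kappa> c \<in> G 0"
    and G_1: "\<exists>a\<in>G 1. a \<noteq> 0" and G_m1: "\<exists>a\<in>G (- 1). a \<noteq> 0"
    and u_nonzero: "u \<noteq> 0" and u: "\<exists>f\<in>frac_field (G 0). \<exists>a\<in>G 1. u = f * a"
begin

sublocale F: subdom "frac_field (G 0)"
  by (rule frac_field_subdom)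

lemma R_subset_A: "r \<in> G 0 \<Longrightarrow> r \<in> A"
  by (rule A.G_subset)

lemma quotient_power_mem:
  assumes a: "a \<in> G i"
  shows "a / u powi i \<in> frac_field (G 0)"
proof -
  obtain f b where fb: "f \<in> frac_field (G 0)" "b \<in> G 1" "u = f * b" using u by blast
  then have nz: "f \<noteq> 0" "b \<noteq> 0" using u_nonzero by auto
  obtain c where c: "c \<in> G (- 1)" "c \<noteq> 0" using G_m1 by blast
  have "a / b powi i \<in> frac_field (G 0)"
  proof (cases "0 \<le> i")
    case True
    then obtain n where n: "i = int n" using nonneg_int_cases by blast
    \<comment> \<open>Numerator and denominator of a / b^n are multiplied by c^n, with c of degree
      -1, which brings both into degree 0.\<close>
    have "a * c ^ n \<in> G 0" using A.G_mult[OF a A.G_power[OF c(1), of n]] n by simp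
    moreover have bc: "b * c \<in> G 0" using A.G_mult[OF fb(2) c(1)] by simp
    have "(b * c) ^ n \<in> G 0" using power_mem[OF bc] .
    ultimately have "(a * c ^ n) / (b * c) ^ n \<in> frac_field (G 0)"
      using nz c by (intro frac_fieldI) auto
    then show ?thesis using n c(2) by (simp add: power_mult_distrib)
  next
    case False
    then obtain n where n: "i = - int n" by (metis int_cases2 of_nat_0_le_iff)
    have "a * b ^ n \<in> G 0" using A.G_mult[OF a A.G_power[OF fb(2), of n]] n by simp
    then show ?thesis using subset_frac_field n by (simp add: power_int_minus divide_inverse)
  qed
  then have "(a / b powi i) / f powi i \<in> frac_field (G 0)"
    by (rule frac_field_divide[OF _ frac_field_powi[OF fb(1)]])
  then show ?thesis by (simp add: fb(3) power_int_mult_distrib mult.commute)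
qed

definition L :: "int \<Rightarrow> 'k set" where
  "L i = {f \<in> frac_field (G 0). f * u powi i \<in> G i}"

lemma G_eq: "G i = (\<lambda>f. f * u powi i) ` L i"
proof
  show "G i \<subseteq> (\<lambda>f. f * u powi i) ` L i"
  proof
    fix a assume "a \<in> G i"
    then show "a \<in> (\<lambda>f. f * u powi i) ` L i"
      using quotient_power_mem[of a i] u_nonzero
      by (intro image_eqI[of _ _ "a / u powi i"]) (auto simp: L_def)
  qed
qed (auto simp: L_def)

lemma L_frac: "f \<in> L i \<Longrightarrow> f \<in> frac_field (G 0)"
  by (simp add: L_def)

lemma L_0: "L 0 = G 0"
  using subset_frac_field by (auto simp: L_def)

lemma L_zero: "0 \<in> L i"
  using A.G_zero by (simp add: L_def)

lemma L_mult: "f \<in> L i \<Longrightarrow> g \<in> L j \<Longrightarrow> f * g \<in> L (i + j)"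
  using A.G_mult[of "f * u powi i" i "g * u powi j" j] u_nonzero
  by (simp add: L_def power_int_add mult_ac)

lemma L_power: "f \<in> L i \<Longrightarrow> f ^ n \<in> L (int n * i)"
proof (induction n)
  case (Suc n)
  then show ?case using L_mult[of f i "f ^ n" "int n * i"] by (simp add: algebra_simps)
qed (simp add: L_0)

text \<open>\<open>G i\<close> has a non-zero element e, a power of one of degree 1 or -1. Then f
  u^i / e is a rational function on the curve, and its denominator is the required r.\<close>

lemma clear_denominator:
  assumes f: "f \<in> frac_field (G 0)"
  shows "\<exists>r\<in>G 0 - {0}. r * (f * u powi i) \<in> G i"
proof -
  obtain e where e: "e \<in> G i" "e \<noteq> 0"
  proof (cases "0 \<le> i")
    case True
    then obtain n where "i = int n" using nonneg_int_cases by blast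
    moreover obtain a where "a \<in> G 1" "a \<noteq> 0" using G_1 by blast
    ultimately show ?thesis using that[of "a ^ n"] A.G_power[of a 1 n] by simp
  next
    case False
    then obtain n where "i = - int n" by (metis int_cases2 of_nat_0_le_iff)
    moreover obtain a where "a \<in> G (- 1)" "a \<noteq> 0" using G_m1 by blast
    ultimately show ?thesis using that[of "a ^ n"] A.G_power[of a "- 1" n] by simp
  qed
  define g where "g = f / (e / u powi i)"
  have "g \<in> frac_field (G 0)" unfolding g_def using f quotient_power_mem[OF e(1)] by (rule frac_field_divide)
  then obtain p q where pq: "p \<in> G 0" "q \<in> G 0" "q \<noteq> 0" "g = p / q" by (rule frac_fieldE)
  have "q * (f * u powi i) = p * e"
    using pq e u_nonzero by (simp add: g_def field_simps)
  then have "q * (f * u powi i) \<in> G i" using A.G_scale[OF pq(1) e(1)] by simp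
  then show ?thesis using pq(2,3) by (intro bexI[of _ q]) auto
qed

text \<open>Once denominators are cleared, a relation between powers of u is a vanishing sum of
  homogeneous elements of distinct degrees. In particular u is transcendental over the function
  field of the curve.\<close>

lemma independent:
  assumes "finite F" "\<And>i. i \<in> F \<Longrightarrow> f i \<in> frac_field (G 0)" "(\<Sum>i\<in>F. f i * u powi i) = 0" "i \<in> F"
  shows "f i = 0"
proof -
  have "\<exists>r\<in>G 0 - {0}. \<forall>i\<in>F. r * (f i * u powi i) \<in> G i"
    by (rule common_multiplier[OF prime_zero assms(1)])
      (use A.G_scale clear_denominator assms(2) in auto)
  then obtain r where r: "r \<noteq> 0" "\<And>i. i \<in> F \<Longrightarrow> r * (f i * u powi i) \<in> G i" by auto
  have "(\<Sum>i\<in>F. r * (f i * u powi i)) = 0" using assms(3) by (simp flip: sum_distrib_left)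
  then have "r * (f i * u powi i) = 0"
    using A.homogeneous_sum_zero[OF assms(1), of "\<lambda>i. r * (f i * u powi i)"] r(2) assms(4) by blast
  then show ?thesis using r(1) u_nonzero by simp
qed

lemma laurent_eval_inj:
  assumes "\<And>i. Poly_Mapping.lookup p i \<in> frac_field (G 0)" "\<And>i. Poly_Mapping.lookup q i \<in> frac_field (G 0)"
    "laurent_eval u p = laurent_eval u q"
  shows "p = q"
proof -
  have "laurent_eval u (p - q) = 0" using assms(3) by (simp add: laurent_eval_diff)
  then have "Poly_Mapping.lookup (p - q) i = 0" if "i \<in> Poly_Mapping.keys (p - q)" for i
    using independent[of "Poly_Mapping.keys (p - q)" "Poly_Mapping.lookup (p - q)"] assms(1,2) that
    by (simp add: laurent_eval_def lookup_minus)
  then have "Poly_Mapping.keys (p - q) = {}" by (metis in_keys_iff equals0I)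
  then have "p - q = 0" by simp
  then show ?thesis by simp
qed

lemma laurent_eval_image: "A = laurent_eval u ` graded_mappings L"
proof
  show "laurent_eval u ` graded_mappings L \<subseteq> A"
  proof
    fix x assume "x \<in> laurent_eval u ` graded_mappings L"
    then obtain p where p: "\<And>i. Poly_Mapping.lookup p i \<in> L i" "x = laurent_eval u p"
      by (auto simp: graded_mappings_def)
    then have "Poly_Mapping.lookup p i * u powi i \<in> A" for i
      using A.G_subset[of _ i] by (simp add: L_def)
    then show "x \<in> A" unfolding p(2) laurent_eval_def by (intro A.sum_mem)
  qed
  show "A \<subseteq> laurent_eval u ` graded_mappings L"
  proof
    fix x assume "x \<in> A"
    then obtain c where c: "decomposition G x c" using A.decomposition_ex by blast
    define p where "p = (\<Sum>i | c i \<noteq> 0. Poly_Mapping.single i (c i / u powi i))"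
    have cG: "c i \<in> G i" for i using c by (auto simp: decomposition_def)
    have "Poly_Mapping.lookup p k = c k / u powi k" for k
    proof -
      have "Poly_Mapping.lookup p k = (\<Sum>i | c i \<noteq> 0. if i = k then c i / u powi i else 0)"
        by (simp add: p_def lookup_sum lookup_single when_def)
      then show ?thesis using c by (simp add: sum.delta decomposition_def)
    qed
    then have "p \<in> graded_mappings L"
      using quotient_power_mem[OF cG] cG u_nonzero by (simp add: graded_mappings_def L_def)
    moreover have "x = laurent_eval u p"
      using c u_nonzero by (simp add: p_def laurent_eval_sum decomposition_def)
    ultimately show "x \<in> laurent_eval u ` graded_mappings L" by blast
  qed
qed

text \<open>A set of generators is fixed by choice so that \<open>Dplus\<close> can be a definition;
  \<open>pullback_iff\<close> shows afterwards that the divisor does not depend on it.\<close>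

definition gens :: "'k set" where
  "gens = (SOME X. finite X \<and> X \<subseteq> A \<and> generate_ring (ring_on A) (range \<kappa> \<union> X) = A)"

lemma gens: "finite gens" "gens \<subseteq> A" "generate_ring (ring_on A) (range \<kappa> \<union> gens) = A"
proof -
  have "\<exists>X. finite X \<and> X \<subseteq> A \<and> generate_ring (ring_on A) (range \<kappa> \<union> X) = A"
    using fin_gen by (auto simp: fin_gen_algebra_def)
  from someI_ex[OF this] show "finite gens" "gens \<subseteq> A" "generate_ring (ring_on A) (range \<kappa> \<union> gens) = A"
    by (simp_all add: gens_def)
qed

definition hom_gens :: "(int \<times> 'k) set" where
  "hom_gens = {(i, component G i x / u powi i) | i x. x \<in> gens \<and> component G i x \<noteq> 0}"

lemma finite_hom_gens: "finite hom_gens"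
proof -
  have "finite {i. component G i x \<noteq> 0}" if "x \<in> gens" for x
    using A.decomposition_component[of x] that gens(2) by (auto simp: decomposition_def)
  then have "finite (\<Union>x\<in>gens. (\<lambda>i. (i, component G i x / u powi i)) ` {i. component G i x \<noteq> 0})"
    using gens(1) by blast
  moreover have "hom_gens \<subseteq> (\<Union>x\<in>gens. (\<lambda>i. (i, component G i x / u powi i)) ` {i. component G i x \<noteq> 0})"
    by (auto simp: hom_gens_def)
  ultimately show ?thesis by (rule finite_subset[rotated])
qed

lemma hom_gens_L:
  assumes "(i, f) \<in> hom_gens"
  shows "f \<in> L i" "f \<noteq> 0" "f \<in> frac_field (G 0)"
proof -
  obtain x where x: "x \<in> gens" "component G i x \<noteq> 0" "f = component G i x / u powi i"
    using assms by (auto simp: hom_gens_def)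
  have "component G i x \<in> G i"
    using A.decomposition_component[of x] x(1) gens(2) by (auto simp: decomposition_def)
  then show "f \<in> L i" "f \<noteq> 0" "f \<in> frac_field (G 0)"
    using x u_nonzero quotient_power_mem by (auto simp: L_def)
qed

text \<open>A half-plane of the \<open>(degree, order)\<close>-lattice through the origin that contains the
  generators contains all of \<open>A\<close>.\<close>

lemma weight_bound:
  assumes P: "P \<in> prime_divisors (G 0)"
    and gen: "\<And>i f. (i, f) \<in> hom_gens \<Longrightarrow> 0 \<le> of_int (order_at (G 0) P f) + of_int i * (\<alpha> :: rat)"
    and f: "f \<in> L i" "f \<noteq> 0"
  shows "0 \<le> of_int (order_at (G 0) P f) + of_int i * \<alpha>"
proof -
  define T where "T i = {f \<in> frac_field (G 0). f = 0 \<or> 0 \<le> of_int (order_at (G 0) P f) + of_int i * \<alpha>}" for i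
  have T_zero: "0 \<in> T i" for i by (simp add: T_def)
  have T_add: "f + g \<in> T i" if fg: "f \<in> T i" "g \<in> T i" for f g i
  proof (cases "f = 0 \<or> g = 0 \<or> f + g = 0")
    case True
    then show ?thesis using fg T_zero by auto
  next
    case False
    let ?m = "min (order_at (G 0) P f) (order_at (G 0) P g)"
    have "?m \<le> order_at (G 0) P (f + g)"
      by (rule ord_add[OF P]) (use False fg in \<open>auto simp: T_def\<close>)
    then have "of_int ?m \<le> (of_int (order_at (G 0) P (f + g)) :: rat)" by (simp only: of_int_le_iff)
    moreover have "0 \<le> of_int ?m + of_int i * \<alpha>" using fg False by (auto simp: T_def min_def)
    ultimately have "0 \<le> of_int (order_at (G 0) P (f + g)) + of_int i * \<alpha>" by linarith
    then show ?thesis using fg by (simp add: T_def)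
  qed
  have T_mult: "f * g \<in> T (i + j)" if fg: "f \<in> T i" "g \<in> T j" for f g i j
  proof (cases "f = 0 \<or> g = 0")
    case False
    then have "order_at (G 0) P (f * g) = order_at (G 0) P f + order_at (G 0) P g"
      using fg by (intro ord_mult[OF P]) (auto simp: T_def)
    then show ?thesis using fg False by (auto simp: T_def algebra_simps)
  qed (use T_zero in auto)
  have T_sum: "sum h X \<in> T i" if "\<And>x. x \<in> X \<Longrightarrow> h x \<in> T i" for h :: "int \<Rightarrow> 'k" and X i
    using that by (induction X rule: infinite_finite_induct) (auto intro: T_add T_zero)
  have T_const: "r \<in> T 0" if "r \<in> G 0" for r
    using that ord_nonneg[OF P that] subset_frac_field by (auto simp: T_def)
  \<comment> \<open>This set is a subring containing the constants and the generators, hence A.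
    Injectivity of \<open>laurent_eval\<close> then reads off the bound for the single coefficient
    f.\<close>
  let ?B = "laurent_eval u ` graded_mappings T"
  have single: "c * u powi i \<in> ?B" if "c \<in> T i" for c i
    by (rule image_eqI[of _ _ "Poly_Mapping.single i c"])
      (use that T_zero in \<open>auto simp: graded_mappings_def lookup_single when_def\<close>)
  have const: "r \<in> ?B" if "r \<in> G 0" for r using single[OF T_const[OF that]] by simp
  have B_add: "x + y \<in> ?B" and B_mult: "x * y \<in> ?B" if xy: "x \<in> ?B" "y \<in> ?B" for x y
  proof -
    obtain p q where pq: "x = laurent_eval u p" "y = laurent_eval u q"
      "\<And>i. Poly_Mapping.lookup p i \<in> T i" "\<And>i. Poly_Mapping.lookup q i \<in> T i"
      using xy by (auto simp: graded_mappings_def)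
    have "Poly_Mapping.lookup (p * q) k \<in> T k" for k
      unfolding lookup_mult_int
    proof (rule T_sum)
      fix l
      show "Poly_Mapping.lookup p l * Poly_Mapping.lookup q (k - l) \<in> T k"
        using T_mult[OF pq(3)[of l] pq(4)[of "k - l"]] by simp
    qed
    then show "x * y \<in> ?B"
      using pq u_nonzero by (intro image_eqI[of _ _ "p * q"]) (auto simp: laurent_eval_mult graded_mappings_def)
    show "x + y \<in> ?B"
      using pq T_add by (intro image_eqI[of _ _ "p + q"]) (auto simp: laurent_eval_add graded_mappings_def lookup_add)
  qed
  have B_uminus: "- x \<in> ?B" if "x \<in> ?B" for x
    using B_mult[OF const[of "- 1"] that] by simp
  have B_sum: "sum h X \<in> ?B" if "\<And>x. x \<in> X \<Longrightarrow> h x \<in> ?B" for h :: "int \<Rightarrow> 'k" and X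
    using that by (induction X rule: infinite_finite_induct) (use const[of 0] B_add in auto)
  have gens_B: "x \<in> ?B" if x: "x \<in> gens" for x
  proof -
    have dec: "decomposition G x (\<lambda>i. component G i x)" using A.decomposition_component x gens(2) by blast
    have "component G i x \<in> ?B" if "component G i x \<noteq> 0" for i
    proof -
      have H: "(i, component G i x / u powi i) \<in> hom_gens" using x that by (auto simp: hom_gens_def)
      have "component G i x / u powi i \<in> T i" using gen[OF H] hom_gens_L[OF H] by (simp add: T_def)
      from single[OF this] show ?thesis using u_nonzero by simp
    qed
    then have "(\<Sum>i | component G i x \<noteq> 0. component G i x) \<in> ?B" by (intro B_sum) auto
    moreover have "x = (\<Sum>i | component G i x \<noteq> 0. component G i x)"
      using dec unfolding decomposition_def by (elim conjE)
    ultimately show ?thesis by (simp only:)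
  qed
  have "x \<in> ?B" if "x \<in> generate_ring (ring_on A) (range \<kappa> \<union> gens)" for x
    using that
  proof induction
    case one
    then show ?case using const[of 1] by simp
  next
    case (incl h)
    then show ?case using gens_B const \<kappa>_mem by blast
  next
    case (a_inv h)
    then have "h \<in> A" using gens(3) by simp
    then show ?case using a_inv B_uminus A.a_inv_ring_on[of h] by simp
  next
    case (eng_add h1 h2)
    then show ?case using B_add by simp
  next
    case (eng_mult h1 h2)
    then show ?case using B_mult by simp
  qed
  moreover have "f * u powi i \<in> A" using f(1) A.G_subset by (auto simp: L_def)
  ultimately have "f * u powi i \<in> ?B" using gens(3) by simp
  then obtain p where p: "f * u powi i = laurent_eval u p" "\<And>i. Poly_Mapping.lookup p i \<in> T i"
    by (auto simp: graded_mappings_def)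
  have "Poly_Mapping.single i f = p"
    by (rule laurent_eval_inj)
      (use p f L_frac in \<open>auto simp: T_def lookup_single when_def subset_frac_field\<close>)
  then have "f \<in> T i" using p(2)[of i] by auto
  then show ?thesis using f(2) by (simp add: T_def)
qed

text \<open>The product f^j g^i has degree i j - i j = 0 and is therefore regular on the curve. This
  inequality is behind both the non-positivity of the sum of the two divisors and the bound for
  generators of negative degree.\<close>

lemma L_order_nonneg:
  assumes P: "P \<in> prime_divisors (G 0)" and f: "f \<in> L i" "f \<noteq> 0" and g: "g \<in> L (- j)" "g \<noteq> 0"
    and ij: "0 \<le> i" "0 \<le> j"
  shows "0 \<le> j * order_at (G 0) P f + i * order_at (G 0) P g"
proof -
  have "f ^ nat j * g ^ nat i \<in> L (int (nat j) * i + int (nat i) * (- j))"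
    using L_mult L_power f g by blast
  then have "f ^ nat j * g ^ nat i \<in> G 0" using ij L_0 by (simp add: mult.commute)
  then have "0 \<le> order_at (G 0) P (f ^ nat j * g ^ nat i)"
    using ord_nonneg[OF P] f g by simp
  also have "order_at (G 0) P (f ^ nat j * g ^ nat i) = j * order_at (G 0) P f + i * order_at (G 0) P g"
    using P f g ij L_frac[OF f(1)] L_frac[OF g(1)] by (simp add: ord_mult ord_power)
  finally show ?thesis .
qed

definition pos_gens :: "(int \<times> 'k) set" where
  "pos_gens = {(i, f) \<in> hom_gens. 0 < i}"

text \<open>Without generators of positive degree a sufficiently negative slope \<alpha> would
  define a half-plane containing all generators but not a given non-zero element of degree 1,
  contrary to \<open>weight_bound\<close>.\<close>

lemma pos_gens_nonempty: "pos_gens \<noteq> {}"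
proof
  assume empty: "pos_gens = {}"
  obtain P where P: "P \<in> prime_divisors (G 0)" using pd_nonempty by blast
  obtain a where a: "a \<in> G 1" "a \<noteq> 0" using G_1 by blast
  define f where "f = a / u"
  have f: "f \<in> L 1" "f \<noteq> 0"
    using quotient_power_mem[OF a(1)] a u_nonzero by (auto simp: f_def L_def)
  let ?ord = "\<lambda>g. of_int (order_at (G 0) P g) :: rat"
  \<comment> \<open>Steep enough that degree at most -1 outweighs the order of every generator, and
    that f in degree 1 violates the bound.\<close>
  define \<alpha> :: rat where "\<alpha> = - 1 - \<bar>?ord f\<bar> - (\<Sum>(i, g)\<in>hom_gens. \<bar>?ord g\<bar>)"
  have "0 \<le> ?ord g + of_int i * \<alpha>" if g: "(i, g) \<in> hom_gens" for i g
  proof (cases "i = 0")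
    case True
    then show ?thesis using hom_gens_L[OF g] L_0 ord_nonneg[OF P, of g] by simp
  next
    case False
    then have "i \<le> - 1" using empty g by (fastforce simp: pos_gens_def)
    have "(case (i, g) of (i, g) \<Rightarrow> \<bar>?ord g\<bar>) \<le> (\<Sum>(i, g)\<in>hom_gens. \<bar>?ord g\<bar>)"
      by (rule member_le_sum[OF g _ finite_hom_gens]) auto
    then have "\<alpha> \<le> - \<bar>?ord g\<bar>" "\<alpha> \<le> 0" by (auto simp: \<alpha>_def)
    moreover have "(- 1) * \<alpha> \<le> of_int i * \<alpha>"
      using \<open>i \<le> - 1\<close> \<open>\<alpha> \<le> 0\<close> by (intro mult_right_mono_neg) (auto simp flip: of_int_le_iff[where 'a = rat])
    ultimately show ?thesis by linarith
  qed
  from weight_bound[OF P this f] have "0 \<le> ?ord f + \<alpha>" by simp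
  moreover have "0 \<le> (\<Sum>(i, g)\<in>hom_gens. \<bar>?ord g\<bar>)" by (intro sum_nonneg) auto
  ultimately show False by (simp add: \<alpha>_def)
qed

definition Dplus :: "'k set \<Rightarrow> rat" where
  "Dplus P = (if P \<in> prime_divisors (G 0)
    then Max ((\<lambda>(i, f). - of_int (order_at (G 0) P f) / of_int i) ` pos_gens) else 0)"

text \<open>A common multiple of the degrees of the positive generators: in this one degree the
  bound given by \<open>Dplus\<close> is attained at every point.\<close>

definition Nplus :: int where
  "Nplus = prod fst pos_gens"

lemma finite_pos_gens: "finite pos_gens"
  by (rule finite_subset[OF _ finite_hom_gens]) (auto simp: pos_gens_def)

lemma Dplus_attained:
  assumes P: "P \<in> prime_divisors (G 0)"
  obtains i f where "(i, f) \<in> pos_gens" "of_int (order_at (G 0) P f) = - of_int i * Dplus P"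
proof -
  have "Dplus P \<in> (\<lambda>(i, f). - of_int (order_at (G 0) P f) / of_int i) ` pos_gens"
    using P finite_pos_gens pos_gens_nonempty by (auto simp: Dplus_def intro!: Max_in)
  then obtain i f where "(i, f) \<in> pos_gens" "Dplus P = - of_int (order_at (G 0) P f) / of_int i" by auto
  then show thesis by (intro that[of i f]) (auto simp: pos_gens_def)
qed

lemma Dplus_bound:
  assumes P: "P \<in> prime_divisors (G 0)" and f: "f \<in> L i" "f \<noteq> 0"
  shows "0 \<le> of_int (order_at (G 0) P f) + of_int i * Dplus P"
proof (rule weight_bound[OF P _ f])
  fix i f assume H: "(i, f) \<in> hom_gens"
  consider "0 < i" | "i = 0" | "i < 0" by linarith
  then show "0 \<le> of_int (order_at (G 0) P f) + of_int i * Dplus P"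
  proof cases
    case 1
    then have "(i, f) \<in> pos_gens" using H by (simp add: pos_gens_def)
    then have "- of_int (order_at (G 0) P f) / of_int i \<le> Dplus P"
      using P finite_pos_gens by (force simp: Dplus_def intro!: Max_ge)
    then show ?thesis using 1 by (simp add: field_simps)
  next
    case 2
    then show ?thesis using hom_gens_L[OF H] L_0 ord_nonneg[OF P, of f] by simp
  next
    case 3
    \<comment> \<open>A generator of negative degree is compared with the one that attains the
      maximum at P; suitable powers of the two multiply into degree 0.\<close>
    obtain d g where g: "(d, g) \<in> pos_gens" "of_int (order_at (G 0) P g) = - of_int d * Dplus P"
      using Dplus_attained[OF P] by blast
    then have d: "0 < d" "(d, g) \<in> hom_gens" by (auto simp: pos_gens_def)
    have "0 \<le> (- i) * order_at (G 0) P g + d * order_at (G 0) P f"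
      by (rule L_order_nonneg[OF P hom_gens_L(1,2)[OF d(2)]]) (use hom_gens_L[OF H] d 3 in auto)
    then have "(0::rat) \<le> of_int ((- i) * order_at (G 0) P g + d * order_at (G 0) P f)"
      by (simp only: of_int_0_le_iff)
    also have "\<dots> = of_int d * (of_int (order_at (G 0) P f) + of_int i * Dplus P)"
      using g(2) by (simp add: algebra_simps)
    finally show ?thesis using d(1) by (simp add: zero_le_mult_iff)
  qed
qed

lemma q_divisor_Dplus: "q_divisor (G 0) Dplus"
proof -
  have sub: "{P. Dplus P \<noteq> 0} \<subseteq> prime_divisors (G 0)" by (auto simp: Dplus_def)
  have "{P. Dplus P \<noteq> 0} \<subseteq>
      (\<Union>(i, f)\<in>pos_gens. {P \<in> prime_divisors (G 0). order_at (G 0) P f \<noteq> 0})"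
  proof
    fix P assume "P \<in> {P. Dplus P \<noteq> 0}"
    then have P: "P \<in> prime_divisors (G 0)" "Dplus P \<noteq> 0" using sub by auto
    obtain i f where "(i, f) \<in> pos_gens" "of_int (order_at (G 0) P f) = - of_int i * Dplus P"
      using Dplus_attained[OF P(1)] by blast
    moreover from this have "order_at (G 0) P f \<noteq> 0"
      using P(2) by (auto simp: pos_gens_def)
    ultimately show "P \<in> (\<Union>(i, f)\<in>pos_gens. {P \<in> prime_divisors (G 0). order_at (G 0) P f \<noteq> 0})"
      using P(1) by blast
  qed
  moreover have "finite (\<Union>(i, f)\<in>pos_gens. {P \<in> prime_divisors (G 0). order_at (G 0) P f \<noteq> 0})"
    using finite_pos_gens finite_support hom_gens_L by (auto simp: pos_gens_def)
  ultimately show ?thesis using sub finite_subset by (auto simp: q_divisor_def)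
qed

lemma Nplus_pos: "0 < Nplus"
  unfolding Nplus_def by (rule prod_pos) (auto simp: pos_gens_def)

lemma Nplus_attained:
  assumes P: "P \<in> prime_divisors (G 0)"
  obtains g where "g \<in> L Nplus" "g \<noteq> 0" "of_int (order_at (G 0) P g) = - of_int Nplus * Dplus P"
proof -
  obtain i f where f: "(i, f) \<in> pos_gens" "of_int (order_at (G 0) P f) = - of_int i * Dplus P"
    using Dplus_attained[OF P] by blast
  then have H: "(i, f) \<in> hom_gens" "0 < i" by (auto simp: pos_gens_def)
  note fL = hom_gens_L[OF H(1)]
  have "i dvd Nplus" unfolding Nplus_def using dvd_prodI[OF finite_pos_gens f(1), of fst] by simp
  then obtain m where m: "Nplus = i * m" by (rule dvdE)
  then have m0: "0 \<le> m" using Nplus_pos H(2) by (simp add: zero_less_mult_iff)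
  show thesis
  proof (rule that)
    show "f ^ nat m \<in> L Nplus" using L_power[OF fL(1), of "nat m"] m m0 by (simp add: mult.commute)
    show "f ^ nat m \<noteq> 0" using fL by simp
    show "of_int (order_at (G 0) P (f ^ nat m)) = - of_int Nplus * Dplus P"
      using ord_power[OF P fL(3,2), of "nat m"] f(2) m m0 by simp
  qed
qed

lemma L_eq_sec:
  assumes i: "0 \<le> i"
  shows "L i = sec Dplus i"
proof
  show "L i \<subseteq> sec Dplus i" using Dplus_bound L_frac by (auto simp: sec_def)
  show "sec Dplus i \<subseteq> L i"
  proof
    fix f assume f: "f \<in> sec Dplus i"
    show "f \<in> L i"
    proof (cases "f = 0")
      case False
      have fK: "f \<in> frac_field (G 0)" using secD(1)[OF f] .
      define b where "b = f * u powi i"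
      define n where "n = nat Nplus"
      have n: "0 < n" "int n = Nplus" using Nplus_pos by (auto simp: n_def)
      \<comment> \<open>The functions that bring b^n into A. The exponent n does not depend on the
        point, so one ideal serves all points in \<open>one_in_ideal\<close>.\<close>
      define I where "I = {r \<in> G 0. r * b ^ n \<in> A}"
      have "1 \<in> I"
      proof (rule one_in_ideal)
        show "is_ideal (G 0) I"
          using R_subset_A by (auto simp: is_ideal_def I_def distrib_right mult.assoc)
        fix P assume P: "P \<in> prime_divisors (G 0)"
        interpret RP: subdom_prime "G 0" P by unfold_locales (rule pd_prime[OF P])
        obtain g where g: "g \<in> L Nplus" "g \<noteq> 0" "of_int (order_at (G 0) P g) = - of_int Nplus * Dplus P"
          using Nplus_attained[OF P] by blast
        have gK: "g \<in> frac_field (G 0)" using L_frac[OF g(1)] .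
        \<comment> \<open>Numerator and denominator both stand for elements of degree n i. As g
          attains the bound at P, the quotient has non-negative order there.\<close>
        let ?q = "f ^ n / g ^ nat i"
        have qK: "?q \<in> frac_field (G 0)" using fK gK by (intro frac_field_divide) auto
        have "order_at (G 0) P ?q = Nplus * order_at (G 0) P f - i * order_at (G 0) P g"
          using P fK gK False g(2) i n(2) by (simp add: ord_divide ord_power)
        then have "(of_int (order_at (G 0) P ?q) :: rat) =
            of_int Nplus * of_int (order_at (G 0) P f) - of_int i * of_int (order_at (G 0) P g)"
          by simp
        also have "\<dots> = of_int Nplus * (of_int (order_at (G 0) P f) + of_int i * Dplus P)"
          by (simp add: g(3) algebra_simps)
        also have "\<dots> \<ge> 0" using secD(2)[OF f False P] Nplus_pos by simp
        finally have "0 \<le> order_at (G 0) P ?q" by simp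
        then have "?q \<in> local_ring (G 0) P" using ord_nonneg_iff[OF P qK] False g(2) by simp
        then obtain a s where as: "a \<in> G 0" "s \<in> G 0 - P" "?q = a / s" "s \<noteq> 0" by (rule RP.local_ringE)
        have "s * f ^ n = a * g ^ nat i" using as g(2) by (simp add: field_simps)
        then have "s * b ^ n = a * (g * u powi Nplus) ^ nat i"
          using i by (simp add: b_def power_mult_distrib power_int_def n(2)[symmetric] flip: power_mult)
            (simp add: mult.commute)
        moreover have "g * u powi Nplus \<in> A" using g(1) A.G_subset by (auto simp: L_def)
        ultimately have "s * b ^ n \<in> A" using as(1) R_subset_A by simp
        then show "\<exists>s\<in>I. s \<notin> P" using as by (auto simp: I_def)
      qed
      then have bn: "b ^ n \<in> A" by (simp add: I_def)
      obtain r where r: "r \<in> G 0 - {0}" "r * b \<in> G i"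
        using clear_denominator[OF fK, of i] by (auto simp: b_def)
      have "(r * b) / r \<in> frac_field A"
        using r A.G_subset by (intro A.frac_fieldI) auto
      then have "b \<in> frac_field A" using r by simp
      moreover have "\<exists>(n::nat) c. (\<forall>i<n. c i \<in> A) \<and> b ^ n + (\<Sum>i<n. c i * b ^ i) = 0"
      proof (intro exI conjI allI impI)
        \<comment> \<open>The equation of integral dependence is X^n - b^n, with its constant term
          at index 0, which is below n since n is positive.\<close>
        show "(if i = 0 then - (b ^ n) else 0) \<in> A" for i :: nat using bn by auto
        have "(\<Sum>i<n. (if i = 0 then - (b ^ n) else 0) * b ^ i) = (\<Sum>i<n. if i = 0 then - (b ^ n) else 0)"
          by (intro sum.cong) auto
        then show "b ^ n + (\<Sum>i<n. (if i = 0 then - (b ^ n) else 0) * b ^ i) = 0"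
          using n(1) by (simp add: sum.delta)
      qed
      ultimately have "b \<in> A" using normal by (auto simp: normal_domain_def)
      then have "b \<in> G i" using A.homogeneous_quotient[of b r 0 i] r by simp
      then show ?thesis using fK by (simp add: L_def b_def)
    qed (simp add: L_zero)
  qed
qed

section \<open>The non-negative part of A as a cone\<close>

sublocale C: cone "G 0" u Dplus
proof
  show "q_divisor (G 0) Dplus" by (rule q_divisor_Dplus)
  fix p assume p: "p \<in> polys (frac_field (G 0))" "poly p u = 0"
  have "(\<Sum>i\<in>int ` {..degree p}. coeff p (nat i) * u powi i) = 0"
    using p(2) by (simp add: poly_altdef sum.reindex)
  then have "coeff p k = 0" if "k \<le> degree p" for k
    using independent[of "int ` {..degree p}" "\<lambda>i. coeff p (nat i)" "int k"] p(1) that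
    by (auto simp: polys_def)
  then show "p = 0" by (metis leading_coeff_0_iff order_refl)
qed

lemma sec_polys_coeff:
  assumes "p \<in> C.sec_polys"
  shows "coeff p n * u ^ n \<in> G (int n)"
proof -
  have "coeff p n \<in> L (int n)" using assms L_eq_sec by (simp add: C.sec_polys_def)
  then show ?thesis by (simp add: L_def)
qed

lemma nonneg_part_eq: "graded_sum G {0..} = C.S"
proof
  show "graded_sum G {0..} \<subseteq> C.S"
  proof
    fix x assume "x \<in> graded_sum G {0..}"
    then obtain F c where F: "x = (\<Sum>i\<in>F. c i)" "F \<subseteq> {0..}" "\<forall>i\<in>F. c i \<in> G i"
      by (auto simp: graded_sum_def)
    have "c i \<in> C.S" if i: "i \<in> F" for i
    proof -
      obtain f where f: "f \<in> L i" "c i = f * u powi i" using F(3) i G_eq by blast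
      have "0 \<le> i" using F(2) i by auto
      then have "f \<in> sec Dplus (int (nat i))" using f(1) L_eq_sec by simp
      from C.monom_in_S[OF this] show ?thesis using f(2) \<open>0 \<le> i\<close> by (simp add: power_int_def)
    qed
    then show "x \<in> C.S" unfolding F(1) by (intro C.S.sum_mem)
  qed
  show "C.S \<subseteq> graded_sum G {0..}"
  proof
    fix x assume "x \<in> C.S"
    then obtain p where p: "p \<in> C.sec_polys" "x = poly p u" by (auto simp: C.S_def)
    have "coeff p (nat i) * u powi i \<in> G i" if "0 \<le> i" for i
      using sec_polys_coeff[OF p(1), of "nat i"] that by (simp add: power_int_def)
    then show "x \<in> graded_sum G {0..}"
      unfolding graded_sum_def
      by (intro CollectI exI[of _ "int ` {..degree p}"] exI[of _ "\<lambda>i. coeff p (nat i) * u powi i"])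
        (auto simp: p(2) poly_altdef sum.reindex sec_polys_coeff[OF p(1)])
  qed
qed

lemma nonneg_part_subset: "C.S \<subseteq> A"
proof -
  have "poly p u \<in> A" if "p \<in> C.sec_polys" for p
  proof (rule poly_in_subdom[OF A.subdom_axioms])
    show "coeff p i * u ^ i \<in> A" for i using A.G_subset sec_polys_coeff[OF that] by blast
  qed
  then show ?thesis by (auto simp: C.S_def)
qed

lemma component_0_poly:
  assumes "p \<in> C.sec_polys"
  shows "component G 0 (poly p u) = coeff p 0"
proof -
  let ?F = "int ` {..degree p}" and ?c = "\<lambda>i. coeff p (nat i) * u powi i"
  have "decomposition G (poly p u) (\<lambda>i. if i \<in> ?F then ?c i else 0)"
  proof (rule A.decompositionI)
    show "?c i \<in> G i" if "i \<in> ?F" for i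
      using that sec_polys_coeff[OF assms] by auto
  qed (auto simp: poly_altdef sum.reindex)
  from A.component_eq[OF this, of 0] show ?thesis by auto
qed

lemma section_divisor_eq: "section_divisor G C.S = indicator {C.Splus}"
proof -
  have "a_kernel (ring_on C.S) (ring_on (G 0)) (component G 0) = {x \<in> C.S. component G 0 x = 0}"
    by (simp add: a_kernel_def' )
  also have "\<dots> = C.Splus"
    using component_0_poly by (auto simp: C.S_def C.Splus_def)
  finally show ?thesis by (simp add: section_divisor_def)
qed

theorem pullback_iff:
  assumes "q_divisor (G 0) D'"
  shows "pullback_div (G 0) (graded_sum G {0..}) D' =
      div_of (graded_sum G {0..}) u - section_divisor G (graded_sum G {0..}) \<longleftrightarrow> D' = Dplus"
  unfolding nonneg_part_eq section_divisor_eq by (rule C.pullback_eq_iff[OF assms])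

text \<open>Only u has to be adapted: with c of degree -1 the product b c has degree 0, so u^(-1) =
  c / (f b c) is a rational function times an element of new degree 1.\<close>

lemma reverse: "torus_surface A (\<lambda>i. G (- i)) \<kappa> (inverse u)"
proof -
  interpret r: graded_subring A "\<lambda>i. G (- i)" by (rule A.graded_reverse)
  obtain f b where fb: "f \<in> frac_field (G 0)" "b \<in> G 1" "u = f * b" using u by blast
  then have nz: "f \<noteq> 0" "b \<noteq> 0" using u_nonzero by auto
  obtain c where c: "c \<in> G (- 1)" "c \<noteq> 0" using G_m1 by blast
  have "b * c \<in> G 0" using A.G_mult[OF fb(2) c(1)] by simp
  then have "inverse (f * (b * c)) \<in> frac_field (G 0)"
    using fb subset_frac_field by (intro frac_field_inverse) auto
  moreover have "inverse u = inverse (f * (b * c)) * c" using nz c fb by (simp add: field_simps)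
  moreover have "dedekind (G (- 0))" using dedekind_axioms by simp
  ultimately show ?thesis
    using normal fin_gen \<kappa>_mem G_1 G_m1 u_nonzero c r.graded_subring_axioms
    by (intro torus_surface.intro torus_surface_axioms.intro) auto
qed

end

section \<open>The presentation by divisors\<close>

lemma graded_sum_nontrivial:
  assumes "graded_sum G I \<noteq> {0}"
  shows "\<exists>i\<in>I. \<exists>a\<in>G i. a \<noteq> 0"
proof (rule ccontr)
  assume "\<not> ?thesis"
  then have z: "\<And>i a. i \<in> I \<Longrightarrow> a \<in> G i \<Longrightarrow> a = 0" by blast
  have "x = 0" if x: "x \<in> graded_sum G I" for x
  proof -
    obtain F c where "x = (\<Sum>i\<in>F. c i)" "F \<subseteq> I" "\<forall>i\<in>F. c i \<in> G i"
      using x by (auto simp: graded_sum_def)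
    then show ?thesis using z by (auto intro!: sum.neutral)
  qed
  moreover have "0 \<in> graded_sum G I"
    unfolding graded_sum_def by (intro CollectI exI[of _ "{}"] exI[of _ "\<lambda>_. 0"]) auto
  ultimately have "graded_sum G I = {0}" by blast
  with assms show False by simp
qed

text \<open>The degrees that occur are closed under addition and, as both signs occur, form a group
  generated by some d. If d were not 1, a d-th root of unity other than 1 would act
  trivially.\<close>

lemma (in graded_subring) effective_degree_one:
  fixes \<kappa> :: "complex \<Rightarrow> 'k"
  assumes eff: "effective_action \<kappa> A G" and \<kappa>1: "\<kappa> 1 = 1"
    and p: "0 < p" "a \<in> G p" "a \<noteq> 0" and n: "0 < n" "b \<in> G (- n)" "b \<noteq> 0"
  shows "\<exists>c\<in>G 1. c \<noteq> 0" and "\<exists>c\<in>G (- 1). c \<noteq> 0"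
proof -
  define I where "I = {i. \<exists>c\<in>G i. c \<noteq> 0}"
  have I_add: "i + j \<in> I" if ij: "i \<in> I" "j \<in> I" for i j
  proof -
    obtain x y where "x \<in> G i" "x \<noteq> 0" "y \<in> G j" "y \<noteq> 0" using ij by (auto simp: I_def)
    then have "x * y \<in> G (i + j)" "x * y \<noteq> 0" using G_mult by auto
    then show ?thesis unfolding I_def by blast
  qed
  have I_mult: "int k * i \<in> I" if i: "i \<in> I" for k i
  proof -
    obtain x where "x \<in> G i" "x \<noteq> 0" using i by (auto simp: I_def)
    then have "x ^ k \<in> G (int k * i)" "x ^ k \<noteq> 0" using G_power by auto
    then show ?thesis unfolding I_def by blast
  qed
  have pI: "p \<in> I" and nI: "- n \<in> I" using p n by (auto simp: I_def)
  have I_uminus: "- i \<in> I" if i: "i \<in> I" for i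
  proof -
    consider "0 < i" | "i = 0" | "i < 0" by linarith
    then show ?thesis
    proof cases
      case 1
      \<comment> \<open>This sum is -i, written as a combination of -n and i with non-negative
        coefficients; only such combinations are available so far.\<close>
      have "int (nat i) * (- n) + int (nat (n - 1)) * i \<in> I"
        by (intro I_add I_mult nI i)
      then show ?thesis using 1 n(1) by (simp add: algebra_simps)
    next
      case 3
      have "int (nat (- i)) * p + int (nat (p - 1)) * i \<in> I"
        by (intro I_add I_mult pI i)
      then show ?thesis using 3 p(1) by (simp add: algebra_simps)
    qed (use i in simp)
  qed
  have I_times: "k * i \<in> I" if i: "i \<in> I" for k i
  proof (cases "0 \<le> k")
    case True
    then show ?thesis using I_mult[OF i, of "nat k"] by simp
  next
    case False
    then show ?thesis using I_uminus[OF I_mult[OF i, of "nat (- k)"]] by simp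
  qed
  define d where "d = (LEAST d::nat. 0 < d \<and> int d \<in> I)"
  have d: "0 < d \<and> int d \<in> I"
    unfolding d_def by (rule LeastI[of _ "nat p"]) (use p(1) pI in auto)
  have d_min: "d \<le> k" if "0 < k" "int k \<in> I" for k
    unfolding d_def by (rule Least_le) (use that in auto)
  have dvd: "int d dvd i" if i: "i \<in> I" for i
  proof (rule ccontr)
    assume "\<not> int d dvd i"
    then have "i mod int d \<noteq> 0" by (simp add: dvd_eq_mod_eq_0)
    moreover have m: "0 \<le> i mod int d" "i mod int d < int d" using d by auto
    ultimately have "0 < nat (i mod int d)" by simp
    moreover have "i + (- (i div int d)) * int d \<in> I" using I_add[OF i I_times] d by blast
    then have "int (nat (i mod int d)) \<in> I" using m(1) by (simp add: minus_div_mult_eq_mod)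
    ultimately show False using d_min[of "nat (i mod int d)"] m by linarith
  qed
  have "d = 1"
  proof (rule ccontr)
    assume "d \<noteq> 1"
    \<comment> \<open>There are exactly d complex d-th roots of unity, hence one other than
      1.\<close>
    then have "\<not> {z::complex. z ^ d = 1} \<subseteq> {1}"
      using card_roots_unity_eq[of d] d card_mono[of "{1::complex}" "{z. z ^ d = 1}"] by auto
    then obtain t :: complex where t: "t ^ d = 1" "t \<noteq> 1" by blast
    then have t0: "t \<noteq> 0" using d by (metis power_0_left less_numeral_extra(3) zero_neq_one)
    have "torus_act \<kappa> G t x = x" if x: "x \<in> A" for x
    proof -
      have dec: "decomposition G x (\<lambda>i. component G i x)" by (rule decomposition_component[OF x])
      have "t powi i = 1" if c: "component G i x \<noteq> 0" for i
      proof -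
        have "i \<in> I" using dec c by (auto simp: decomposition_def I_def)
        then obtain k where "i = int d * k" using dvd by (auto elim: dvdE)
        then show ?thesis using t(1) by (simp add: power_int_mult)
      qed
      then have "torus_act \<kappa> G t x = (\<Sum>i | component G i x \<noteq> 0. component G i x)"
        unfolding torus_act_def by (intro sum.cong) (auto simp: \<kappa>1)
      moreover have "x = (\<Sum>i | component G i x \<noteq> 0. component G i x)"
        using dec unfolding decomposition_def by (elim conjE)
      ultimately show ?thesis by simp
    qed
    then show False using eff t t0 by (auto simp: effective_action_def)
  qed
  then have "1 \<in> I" using d by simp
  with I_uminus[OF this] show "\<exists>c\<in>G 1. c \<noteq> 0" "\<exists>c\<in>G (- 1). c \<noteq> 0" by (auto simp: I_def)
qed

context torus_surface
begin

lemma iso_to_dpd_Dplus: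
  assumes Dm: "q_divisor (G 0) Dm" and L_neg: "\<And>i. 0 \<le> i \<Longrightarrow> L (- i) = sec Dm i"
  shows "iso_to_dpd A G Dplus Dm"
proof -
  let ?ev = "laurent_eval u"
  have "L i = dpd_coeff Dplus Dm i" for i
    using L_eq_sec[of i] L_neg[of "- i"] by (simp add: dpd_coeff_def)
  then have L: "dpd_coeff Dplus Dm = L" by auto
  have ring: "dpd_ring (G 0) Dplus Dm = graded_mappings L"
    and piece: "\<And>i. dpd_piece (G 0) Dplus Dm i = Poly_Mapping.single i ` L i"
    using dpd_ring_eq[OF q_divisor_Dplus Dm] dpd_piece_eq[OF q_divisor_Dplus Dm] by (simp_all add: L)
  have inj: "inj_on ?ev (graded_mappings L)"
  proof (rule inj_onI)
    fix p q assume "p \<in> graded_mappings L" "q \<in> graded_mappings L" "?ev p = ?ev q"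
    then show "p = q" using L_frac by (intro laurent_eval_inj) (auto simp: graded_mappings_def)
  qed
  define h where "h = inv_into (graded_mappings L) ?ev"
  have h_ev: "h (?ev p) = p" if "p \<in> graded_mappings L" for p
    unfolding h_def by (rule inv_into_f_f[OF inj that])
  have single_mem: "Poly_Mapping.single i f \<in> graded_mappings L" if "f \<in> L i" for f i
    using that L_zero by (auto simp: graded_mappings_def lookup_single when_def)
  have h_hom: "h (f * u powi i) = Poly_Mapping.single i f" if "f \<in> L i" for f i
    using h_ev[OF single_mem[OF that]] by simp
  \<comment> \<open>Closure is carried over from A: evaluation is injective on Laurent polynomials
    over Frac R, so the sum and the product of p and q are the preimages found in
    \<open>graded_mappings L\<close>.\<close>
  have ring_closed: "p + q \<in> graded_mappings L" "p * q \<in> graded_mappings L"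
    if pq: "p \<in> graded_mappings L" "q \<in> graded_mappings L" for p q
  proof -
    have "?ev p \<in> A" "?ev q \<in> A" using pq laurent_eval_image by blast+
    then have "?ev p + ?ev q \<in> A" "?ev p * ?ev q \<in> A" by auto
    then obtain s m where s: "s \<in> graded_mappings L" "?ev (p + q) = ?ev s"
      and m: "m \<in> graded_mappings L" "?ev (p * q) = ?ev m"
      using laurent_eval_image laurent_eval_add laurent_eval_mult[OF u_nonzero]
      by (metis (no_types, lifting) imageE)
    have K: "Poly_Mapping.lookup r i \<in> frac_field (G 0)" if "r \<in> graded_mappings L" for r i
      using that L_frac by (auto simp: graded_mappings_def)
    have "Poly_Mapping.lookup (p + q) i \<in> frac_field (G 0)" for i
      using pq K by (simp add: lookup_add)
    then show "p + q \<in> graded_mappings L" using laurent_eval_inj[OF _ K[OF s(1)] s(2)] s(1) by simp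
    have "Poly_Mapping.lookup (p * q) i \<in> frac_field (G 0)" for i
      unfolding lookup_mult_int using pq K by (intro F.sum_mem F.mult_mem) auto
    then show "p * q \<in> graded_mappings L" using laurent_eval_inj[OF _ K[OF m(1)] m(2)] m(1) by simp
  qed
  have bij: "bij_betw h A (graded_mappings L)"
    unfolding h_def using inj laurent_eval_image
    by (intro bij_betw_inv_into) (simp add: bij_betw_def)
  have "h \<in> ring_iso (ring_on A) (ring_on (graded_mappings L))"
  proof (rule ring_iso_memI)
    show "bij_betw h (carrier (ring_on A)) (carrier (ring_on (graded_mappings L)))" using bij by simp
    show "h x \<in> carrier (ring_on (graded_mappings L))" if "x \<in> carrier (ring_on A)" for x
      using that bij bij_betwE by fastforce
    show "h \<one>\<^bsub>ring_on A\<^esub> = \<one>\<^bsub>ring_on (graded_mappings L)\<^esub>"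
      using h_hom[of 1 0] L_0 one_mem by simp
    fix x y assume "x \<in> carrier (ring_on A)" "y \<in> carrier (ring_on A)"
    then obtain p q where pq: "p \<in> graded_mappings L" "x = ?ev p" "q \<in> graded_mappings L" "y = ?ev q"
      using laurent_eval_image by auto
    show "h (x \<otimes>\<^bsub>ring_on A\<^esub> y) = h x \<otimes>\<^bsub>ring_on (graded_mappings L)\<^esub> h y"
      using h_ev[OF ring_closed(2)[OF pq(1,3)]] h_ev[OF pq(1)] h_ev[OF pq(3)] pq(2,4)
      by (simp add: laurent_eval_mult[OF u_nonzero])
    show "h (x \<oplus>\<^bsub>ring_on A\<^esub> y) = h x \<oplus>\<^bsub>ring_on (graded_mappings L)\<^esub> h y"
      using h_ev[OF ring_closed(1)[OF pq(1,3)]] h_ev[OF pq(1)] h_ev[OF pq(3)] pq(2,4)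
      by (simp add: laurent_eval_add)
  qed
  moreover have "h ` G i = Poly_Mapping.single i ` L i" for i
    unfolding G_eq[of i] image_image by (intro image_cong refl) (simp add: h_hom)
  moreover have "h r = Poly_Mapping.single 0 r" if "r \<in> G 0" for r
    using h_hom[of r 0] that L_0 by simp
  ultimately show ?thesis
    unfolding iso_to_dpd_def graded_algebra_iso_def ring piece by blast
qed

theorem presentation:
  obtains Dm where "q_divisor (G 0) Dm" "Dplus + Dm \<le> 0" "iso_to_dpd A G Dplus Dm"
    "\<And>D'. q_divisor (G 0) D' \<Longrightarrow> pullback_div (G 0) (graded_sum G {..0}) D' =
      div_of (graded_sum G {..0}) (inverse u) - section_divisor G (graded_sum G {..0}) \<longleftrightarrow> D' = Dm"
proof -
  interpret r: torus_surface A "\<lambda>i. G (- i)" \<kappa> "inverse u" by (rule reverse)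
  have rL: "r.L i = L (- i)" for i
    by (simp add: r.L_def L_def power_int_inverse power_int_minus)
  have qm: "q_divisor (G 0) r.Dplus" using r.q_divisor_Dplus by simp
  have L_neg: "L (- i) = sec r.Dplus i" if "0 \<le> i" for i
    using r.L_eq_sec[OF that] by (simp add: rL)
  have "Dplus P + r.Dplus P \<le> 0" for P
  proof (cases "P \<in> prime_divisors (G 0)")
    case True
    obtain f where f: "f \<in> L Nplus" "f \<noteq> 0" "of_int (order_at (G 0) P f) = - of_int Nplus * Dplus P"
      using Nplus_attained[OF True] by blast
    obtain g where g: "g \<in> r.L r.Nplus" "g \<noteq> 0" "of_int (order_at (G 0) P g) = - of_int r.Nplus * r.Dplus P"
      using r.Nplus_attained[of P] True by auto
    \<comment> \<open>Both f and g attain their bounds at P, so regularity of the degree 0 product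
      becomes the inequality between the two coefficients.\<close>
    have "0 \<le> r.Nplus * order_at (G 0) P f + Nplus * order_at (G 0) P g"
      using L_order_nonneg[OF True f(1,2), of g r.Nplus] g(1,2) Nplus_pos r.Nplus_pos by (simp add: rL)
    then have "(0::rat) \<le> of_int (r.Nplus * order_at (G 0) P f + Nplus * order_at (G 0) P g)"
      by (simp only: of_int_0_le_iff)
    also have "\<dots> = - (of_int (Nplus * r.Nplus) * (Dplus P + r.Dplus P))"
      by (simp add: f(3) g(3) algebra_simps)
    finally have "of_int (Nplus * r.Nplus) * (Dplus P + r.Dplus P) \<le> 0" by simp
    moreover have "0 < (of_int (Nplus * r.Nplus) :: rat)" using Nplus_pos r.Nplus_pos by simp
    ultimately show ?thesis by (meson mult_pos_pos not_le)
  next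
    case False
    then show ?thesis by (simp add: Dplus_def r.Dplus_def)
  qed
  then have le: "Dplus + r.Dplus \<le> 0" by (simp add: le_fun_def)
  have part: "graded_sum (\<lambda>i. G (- i)) {0..} = graded_sum G {..0}" by (rule A.nonneg_part_reverse)
  have "graded_sum (\<lambda>i. G (- i)) {0..} \<subseteq> A"
    unfolding r.nonneg_part_eq by (rule r.nonneg_part_subset)
  then have "graded_sum G {..0} \<subseteq> A" by (simp only: part)
  \<comment> \<open>The component of degree 0 is the same for both gradings, so the vertex section
    is the same prime.\<close>
  then have "section_divisor (\<lambda>i. G (- i)) (graded_sum G {..0}) = section_divisor G (graded_sum G {..0})"
    using A.component_reverse by (simp add: section_divisor_def a_kernel_def') (metis subsetD)
  then have "\<And>D'. q_divisor (G 0) D' \<Longrightarrow> pullback_div (G 0) (graded_sum G {..0}) D' =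
      div_of (graded_sum G {..0}) (inverse u) - section_divisor G (graded_sum G {..0}) \<longleftrightarrow> D' = r.Dplus"
    using r.pullback_iff by (simp add: part)
  then show thesis using that[OF qm le iso_to_dpd_Dplus[OF qm L_neg]] by blast
qed

end

theorem theorem4p3:
  fixes \<kappa> :: "complex \<Rightarrow> 'k::field" and A :: "'k set" and G :: "int \<Rightarrow> 'k set"
  assumes curve: "smooth_affine_curve \<kappa> (G 0)"
    and graded: "graded_ring A G"
    and fin_gen: "fin_gen_algebra \<kappa> A"
    and dom: "domain (ring_on A)"
    and normal: "normal_domain A"
    and dim: "krull_dim (ring_on A) = 2"
    and pos: "graded_sum G {0<..} \<noteq> {0}"
    and neg: "graded_sum G {..<0} \<noteq> {0}"
    and effective: "effective_action \<kappa> A G"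
  shows
    "(\<exists>Dp Dm. q_divisor (G 0) Dp \<and> q_divisor (G 0) Dm \<and> Dp + Dm \<le> 0 \<and> iso_to_dpd A G Dp Dm) \<and>
     (\<forall>u. u \<in> {f * a | f a. f \<in> frac_field (G 0) \<and> a \<in> G 1} \<and> u \<noteq> 0 \<longrightarrow>
        (\<exists>!Dp. q_divisor (G 0) Dp \<and>
           pullback_div (G 0) (graded_sum G {0..}) Dp =
             div_of (graded_sum G {0..}) u - section_divisor G (graded_sum G {0..})) \<and>
        (\<exists>!Dm. q_divisor (G 0) Dm \<and>
           pullback_div (G 0) (graded_sum G {..0}) Dm =
             div_of (graded_sum G {..0}) (inverse u) - section_divisor G (graded_sum G {..0})) \<and>
        (\<forall>Dp Dm. q_divisor (G 0) Dp \<and> q_divisor (G 0) Dm \<and>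
           pullback_div (G 0) (graded_sum G {0..}) Dp =
             div_of (graded_sum G {0..}) u - section_divisor G (graded_sum G {0..}) \<and>
           pullback_div (G 0) (graded_sum G {..0}) Dm =
             div_of (graded_sum G {..0}) (inverse u) - section_divisor G (graded_sum G {..0}) \<longrightarrow>
           Dp + Dm \<le> 0 \<and> iso_to_dpd A G Dp Dm)) \<and>
     (\<forall>Dp Dm Dp' Dm'.
        q_divisor (G 0) Dp \<and> q_divisor (G 0) Dm \<and> Dp + Dm \<le> 0 \<and>
        q_divisor (G 0) Dp' \<and> q_divisor (G 0) Dm' \<and> Dp' + Dm' \<le> 0 \<longrightarrow>
        (dpd_iso_dpd (G 0) Dp Dm Dp' Dm' \<longleftrightarrow>
          (\<exists>\<phi> \<in> frac_field (G 0). \<phi> \<noteq> 0 \<and>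
             Dp' = Dp + div_of (G 0) \<phi> \<and> Dm' = Dm - div_of (G 0) \<phi>)))"
proof -
  have "domain (ring_on (G 0))" using curve by (simp add: smooth_affine_curve_def)
  then interpret R: subdom "G 0" by (rule subdom_of_domain)
  interpret R: dedekind "G 0" by (rule smooth_affine_curve_dedekind[OF curve])
  interpret A: subdom A using dom by (rule subdom_of_domain)
  interpret A: graded_subring A G by unfold_locales (use graded in auto)
  have \<kappa>: "\<kappa> c \<in> G 0" "\<kappa> 1 = 1" for c
    using curve by (auto simp: smooth_affine_curve_def fin_gen_algebra_def ring_hom_def)
  obtain p a where p: "0 < p" "a \<in> G p" "a \<noteq> 0"
    using graded_sum_nontrivial[OF pos] by auto
  obtain n b where n: "n < 0" "b \<in> G n" "b \<noteq> 0"
    using graded_sum_nontrivial[OF neg] by auto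
  note G_1 = A.effective_degree_one[OF effective \<kappa>(2) p, of "- n" b]
  have surf: "torus_surface A G \<kappa> u"
    if "u \<in> {f * a | f a. f \<in> frac_field (G 0) \<and> a \<in> G 1}" "u \<noteq> 0" for u
    by unfold_locales (use that normal fin_gen \<kappa> G_1 n in auto)
  let ?eqp = "\<lambda>u D. pullback_div (G 0) (graded_sum G {0..}) D =
    div_of (graded_sum G {0..}) u - section_divisor G (graded_sum G {0..})"
  let ?eqm = "\<lambda>u D. pullback_div (G 0) (graded_sum G {..0}) D =
    div_of (graded_sum G {..0}) (inverse u) - section_divisor G (graded_sum G {..0})"
  \<comment> \<open>For each u one pair of divisors is characterized by the two equations;
    existence, uniqueness and the properties of every solution then follow together.\<close>
  have main: "\<exists>Dp Dm. q_divisor (G 0) Dp \<and> q_divisor (G 0) Dm \<and> Dp + Dm \<le> 0 \<and> iso_to_dpd A G Dp Dm \<and>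
      (\<forall>D. q_divisor (G 0) D \<longrightarrow> (?eqp u D \<longleftrightarrow> D = Dp)) \<and> (\<forall>D. q_divisor (G 0) D \<longrightarrow> (?eqm u D \<longleftrightarrow> D = Dm))"
    if u: "u \<in> {f * a | f a. f \<in> frac_field (G 0) \<and> a \<in> G 1}" "u \<noteq> 0" for u
  proof -
    interpret T: torus_surface A G \<kappa> u by (rule surf[OF u])
    obtain Dm where "q_divisor (G 0) Dm" "T.Dplus + Dm \<le> 0" "iso_to_dpd A G T.Dplus Dm"
      "\<And>D. q_divisor (G 0) D \<Longrightarrow> ?eqm u D \<longleftrightarrow> D = Dm"
      using T.presentation by blast
    then show ?thesis using T.q_divisor_Dplus T.pullback_iff by blast
  qed
  \<comment> \<open>For the bare existence statement any non-zero element of degree 1 may serve as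
    u.\<close>
  obtain c where c: "c \<in> G 1" "c \<noteq> 0" using G_1(1) n by auto
  have "c \<in> {f * a | f a. f \<in> frac_field (G 0) \<and> a \<in> G 1}"
    using c R.subset_frac_field[OF R.one_mem] by (intro CollectI exI[of _ 1] exI[of _ c]) auto
  from main[OF this c(2)]
  have 1: "\<exists>Dp Dm. q_divisor (G 0) Dp \<and> q_divisor (G 0) Dm \<and> Dp + Dm \<le> 0 \<and> iso_to_dpd A G Dp Dm"
    by blast
  have 2: "(\<exists>!Dp. q_divisor (G 0) Dp \<and> ?eqp u Dp) \<and> (\<exists>!Dm. q_divisor (G 0) Dm \<and> ?eqm u Dm) \<and>
      (\<forall>Dp Dm. q_divisor (G 0) Dp \<and> q_divisor (G 0) Dm \<and> ?eqp u Dp \<and> ?eqm u Dm \<longrightarrow>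
        Dp + Dm \<le> 0 \<and> iso_to_dpd A G Dp Dm)"
    if u: "u \<in> {f * a | f a. f \<in> frac_field (G 0) \<and> a \<in> G 1} \<and> u \<noteq> 0" for u
  proof -
    obtain Dp Dm where D: "q_divisor (G 0) Dp" "q_divisor (G 0) Dm" "Dp + Dm \<le> 0" "iso_to_dpd A G Dp Dm"
      and eqp: "\<And>D. q_divisor (G 0) D \<Longrightarrow> ?eqp u D \<longleftrightarrow> D = Dp"
      and eqm: "\<And>D. q_divisor (G 0) D \<Longrightarrow> ?eqm u D \<longleftrightarrow> D = Dm"
      using main[of u] u by blast
    have "\<exists>!Dp. q_divisor (G 0) Dp \<and> ?eqp u Dp"
      by (rule ex1I[of _ Dp]) (use D(1) eqp in blast)+
    moreover have "\<exists>!Dm. q_divisor (G 0) Dm \<and> ?eqm u Dm"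
      by (rule ex1I[of _ Dm]) (use D(2) eqm in blast)+
    moreover have "Dp' + Dm' \<le> 0 \<and> iso_to_dpd A G Dp' Dm'"
      if "q_divisor (G 0) Dp' \<and> q_divisor (G 0) Dm' \<and> ?eqp u Dp' \<and> ?eqm u Dm'" for Dp' Dm'
    proof -
      have "Dp' = Dp" "Dm' = Dm" using that eqp eqm by blast+
      then show ?thesis using D(3,4) by simp
    qed
    ultimately show ?thesis by blast
  qed
  show ?thesis
  proof (rule conjI[OF 1], rule conjI)
    show "\<forall>u. u \<in> {f * a | f a. f \<in> frac_field (G 0) \<and> a \<in> G 1} \<and> u \<noteq> 0 \<longrightarrow>
        (\<exists>!Dp. q_divisor (G 0) Dp \<and> ?eqp u Dp) \<and> (\<exists>!Dm. q_divisor (G 0) Dm \<and> ?eqm u Dm) \<and>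
        (\<forall>Dp Dm. q_divisor (G 0) Dp \<and> q_divisor (G 0) Dm \<and> ?eqp u Dp \<and> ?eqm u Dm \<longrightarrow>
          Dp + Dm \<le> 0 \<and> iso_to_dpd A G Dp Dm)"
      by (intro allI impI) (rule 2)
  qed (intro allI impI, rule R.dpd_iso_iff; simp)
qed

end
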